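(* Let $T$ be a complete totally transcendental theory eliminating imaginaries, $A$ a $\mathrm{dcl}$-closed small set of parameters, and $M$ a prime model over $A$. Let $X$ be an $A$-definable set with $X(M)=X(A)$ and let $G$ be an $A$-definable group living on $X$. Then $$\varinjlim_{B} H^{1}_{\mathrm{def}}(B/A,G(B))\cong H^{1}_{\mathrm{def}}(A^{X\mathrm{DG}_\infty}/A,\,G(A^{X\mathrm{DG}_\infty}))$$ as pointed sets, where the direct limit is taken over the family (directed under inclusion) of normal closures $B$ in $M$ of iterated definable Galois extensions of finite type of $A$ relative to $X$.
   Context: $A$ lies in a monster model $\bar M$ of $T$, $M\prec\bar M$, and $\mathrm{dcl}$ is computed in $\bar M$. $X(B)$ is the set of points of $X$ with all coordinates in $B$. "$G$ lives on $X$" means $G$ is contained in $\mathrm{dcl}(A,X)$ (e.g. $G\subseteq X^n$ for some $n$). A set $A\subseteq B\subseteq M$ is normal if for all $b\in B$, $b'\in M$ with $\mathrm{tp}(b/A)=\mathrm{tp}(b'/A)$ one has $b'\in B$. The normal closure of $B$ is the smallest normal $\mathrm{dcl}$-closed subset of $M$ containing $B$. Let $D$ be a set with $A\subseteq D\subseteq M$. A type $p$ over $D$ is strongly internal to $X$ if $b'\in\mathrm{dcl}(D,X(\bar M),b)$ for all realizations $b,b'$ of $p$; it is weakly orthogonal to $X$ if it has a unique extension to a complete type over $\mathrm{dcl}(D,X(\bar M))$. A definable Galois extension of finite type of $D$ relative to $X$ is a set $\mathrm{dcl}(D,b)$, with $b$ a finite tuple realizing a type over $D$ strongly internal and weakly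 orthogonal to $X$. A definable Galois extension of $D$ in $M$ relative to $X$ is a union of such finite type extensions contained in $M$. $A^{X\mathrm{DG}_1}$ is the union of all definable Galois extensions of $A$ in $M$ relative to $X$; $A^{X\mathrm{DG}_{n+1}}$ is the union of all definable Galois extensions of $A^{X\mathrm{DG}_n}$ in $M$ relative to $X$; $A^{X\mathrm{DG}_\infty}=\bigcup_nA^{X\mathrm{DG}_n}$. An iterated definable Galois extension of finite type of $A$ relative to $X$ is a $\mathrm{dcl}$-closed $B\subseteq M$ with a finite chain of $\mathrm{dcl}$-closed sets $A=B_0\subseteq B_1\subseteq\dots\subseteq B_n=B$, each $B_i$ a definable Galois extension of finite type of $B_{i-1}$ relative to $X$. $\mathrm{Aut}(B/A)$ is the group of elementary permutations of $B$ fixing $A$ pointwise. For $B$ normal, a definable cocycle is a map $\varphi:\mathrm{Aut}(B/A)\to G(B)$ with $\varphi(\sigma\tau)=\varphi(\sigma)\sigma(\varphi(\tau))$ for which there are a finite tuple $b$ from $B$ and an $A$-definable function $h$ with $\varphi(\sigma)=h(b,\sigma(b))$ for all $\sigma$. Cocycles $\varphi,\psi$ are cohomologous if for some $g\in G(B)$, $\varphi(\sigma)=g^{-1}\psi(\sigma)\sigma(g)$ for all $\sigma$. $H^1_{\mathrm{def}}(B/A,G(B))$ is the set of cohomology classes, pointed by the trivial class; equivalently, the pointed set of $A$-definable isomorphism classes of $A$-definable right principal homogeneous spaces for $G$ with a $B$-point. Transition maps for normal $B\subseteq C$ are induced by restriction $\mathrm{Aut}(C/A)\to\mathrm{Aut}(B/A)$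 and inclusion $G(B)\subseteq G(C)$. Isomorphism of pointed sets means basepoint-preserving bijection. *)

theory Defs
  imports "HOL-Algebra.Group" "HOL-Combinatorics.Permutations"
begin

unbundle cardinal_syntax

section \<open>First-order logic\<close>

text \<open>A language is a set of function symbols (constants being the nullary ones) and a set of
  relation symbols, each paired with its arity.\<close>

record ('f, 'r) language =
  funs :: "('f \<times> nat) set"
  rels :: "('r \<times> nat) set"

datatype 'f trm = Var nat | Fn 'f "'f trm list"

text \<open>Variables are de Bruijn indices: \<open>Ex\<close> binds the variable \<open>0\<close> of its body.\<close>

datatype ('f, 'r) form =
    Eq "'f trm" "'f trm"
  | Rel 'r "'f trm list"
  | Neg "('f, 'r) form"
  | Conj "('f, 'r) form" "('f, 'r) form"
  | Ex "('f, 'r) form"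

primrec wf_trm :: "('f, 'r) language \<Rightarrow> nat \<Rightarrow> 'f trm \<Rightarrow> bool" where
  "wf_trm L n (Var i) \<longleftrightarrow> i < n"
| "wf_trm L n (Fn f ts) \<longleftrightarrow> (f, length ts) \<in> funs L \<and> list_all (wf_trm L n) ts"

text \<open>\<open>wf_form L n \<phi>\<close>: \<open>\<phi>\<close> is an \<open>L\<close>-formula with free variables among \<open>0, \<dots>, n - 1\<close>.\<close>

primrec wf_form :: "('f, 'r) language \<Rightarrow> nat \<Rightarrow> ('f, 'r) form \<Rightarrow> bool" where
  "wf_form L n (Eq s t) \<longleftrightarrow> wf_trm L n s \<and> wf_trm L n t"
| "wf_form L n (Rel r ts) \<longleftrightarrow> (r, length ts) \<in> rels L \<and> list_all (wf_trm L n) ts"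
| "wf_form L n (Neg \<phi>) \<longleftrightarrow> wf_form L n \<phi>"
| "wf_form L n (Conj \<phi> \<psi>) \<longleftrightarrow> wf_form L n \<phi> \<and> wf_form L n \<psi>"
| "wf_form L n (Ex \<phi>) \<longleftrightarrow> wf_form L (Suc n) \<phi>"

record ('m, 'f, 'r) interp =
  univ :: "'m set"
  fun_int :: "'f \<Rightarrow> 'm list \<Rightarrow> 'm"
  rel_int :: "'r \<Rightarrow> 'm list \<Rightarrow> bool"

text \<open>The tuples of length \<open>n\<close> with all coordinates in \<open>B\<close>.\<close>

definition tuples :: "'m set \<Rightarrow> nat \<Rightarrow> 'm list set" where
  "tuples B n = {x. set x \<subseteq> B \<and> length x = n}"

definition is_struct :: "('f, 'r) language \<Rightarrow> ('m, 'f, 'r) interp \<Rightarrow> bool" where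
  "is_struct L S \<longleftrightarrow> univ S \<noteq> {} \<and>
     (\<forall>(f, n) \<in> funs L. \<forall>x \<in> tuples (univ S) n. fun_int S f x \<in> univ S)"

primrec trm_val :: "('m, 'f, 'r) interp \<Rightarrow> 'm list \<Rightarrow> 'f trm \<Rightarrow> 'm" where
  "trm_val S e (Var i) = e ! i"
| "trm_val S e (Fn f ts) = fun_int S f (map (trm_val S e) ts)"

primrec sat :: "('m, 'f, 'r) interp \<Rightarrow> ('f, 'r) form \<Rightarrow> 'm list \<Rightarrow> bool" where
  "sat S (Eq s t) e \<longleftrightarrow> trm_val S e s = trm_val S e t"
| "sat S (Rel r ts) e \<longleftrightarrow> rel_int S r (map (trm_val S e) ts)"
| "sat S (Neg \<phi>) e \<longleftrightarrow> \<not> sat S \<phi> e"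
| "sat S (Conj \<phi> \<psi>) e \<longleftrightarrow> sat S \<phi> e \<and> sat S \<psi> e"
| "sat S (Ex \<phi>) e \<longleftrightarrow> (\<exists>a \<in> univ S. sat S \<phi> (a # e))"

definition is_model :: "('f, 'r) language \<Rightarrow> ('f, 'r) form set \<Rightarrow> ('m, 'f, 'r) interp \<Rightarrow> bool" where
  "is_model L T S \<longleftrightarrow> is_struct L S \<and> (\<forall>\<phi> \<in> T. sat S \<phi> [])"

text \<open>Complete theories are taken to be deductively closed; their consistency is not part of this
  definition, but follows from the existence of a model.\<close>

definition complete_theory :: "('f, 'r) language \<Rightarrow> ('f, 'r) form set \<Rightarrow> bool" where
  "complete_theory L T \<longleftrightarrow>
     T \<subseteq> {\<phi>. wf_form L 0 \<phi>} \<and> (\<forall>\<phi>. wf_form L 0 \<phi> \<longrightarrow> \<phi> \<in> T \<or> Neg \<phi> \<in> T)"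

text \<open>\<open>elementary_map L U B f\<close>: \<open>f\<close> is a partial elementary map of \<open>U\<close> with domain \<open>B\<close>; only the
  values of \<open>f\<close> on \<open>B\<close> matter.\<close>

definition elementary_map ::
  "('f, 'r) language \<Rightarrow> ('m, 'f, 'r) interp \<Rightarrow> 'm set \<Rightarrow> ('m \<Rightarrow> 'm) \<Rightarrow> bool" where
  "elementary_map L U B f \<longleftrightarrow> f ` B \<subseteq> univ U \<and>
     (\<forall>n \<phi>. wf_form L n \<phi> \<longrightarrow> (\<forall>x \<in> tuples B n. sat U \<phi> x \<longleftrightarrow> sat U \<phi> (map f x)))"

definition elementary_submodel ::
  "('f, 'r) language \<Rightarrow> ('m, 'f, 'r) interp \<Rightarrow> 'm set \<Rightarrow> bool" where
  "elementary_submodel L U M \<longleftrightarrow> M \<subseteq> univ U \<and> is_struct L (U\<lparr>univ := M\<rparr>) \<and>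
     (\<forall>n \<phi>. wf_form L n \<phi> \<longrightarrow> (\<forall>x \<in> tuples M n. sat (U\<lparr>univ := M\<rparr>) \<phi> x \<longleftrightarrow> sat U \<phi> x))"


section \<open>Definability and types\<close>

text \<open>A formula with \<open>n\<close> free variables and parameters in \<open>B\<close> is a pair \<open>(\<phi>, c)\<close>, standing for
  \<open>\<phi>(x, c)\<close>: the variables from \<open>n\<close> on are replaced by the entries of \<open>c\<close>.\<close>

definition param_forms ::
  "('f, 'r) language \<Rightarrow> 'm set \<Rightarrow> nat \<Rightarrow> (('f, 'r) form \<times> 'm list) set" where
  "param_forms L B n = {(\<phi>, c). set c \<subseteq> B \<and> wf_form L (n + length c) \<phi>}"

definition psat :: "('m, 'f, 'r) interp \<Rightarrow> ('f, 'r) form \<times> 'm list \<Rightarrow> 'm list \<Rightarrow> bool" where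
  "psat U \<theta> x \<longleftrightarrow> sat U (fst \<theta>) (x @ snd \<theta>)"

definition def_set ::
  "('m, 'f, 'r) interp \<Rightarrow> nat \<Rightarrow> ('f, 'r) form \<times> 'm list \<Rightarrow> 'm list set" where
  "def_set U n \<theta> = {x \<in> tuples (univ U) n. psat U \<theta> x}"

text \<open>\<open>definable L U B n X\<close>: \<open>X\<close> is a \<open>B\<close>-definable subset of the \<open>n\<close>-th power of \<open>U\<close>.\<close>

definition definable ::
  "('f, 'r) language \<Rightarrow> ('m, 'f, 'r) interp \<Rightarrow> 'm set \<Rightarrow> nat \<Rightarrow> 'm list set \<Rightarrow> bool" where
  "definable L U B n X \<longleftrightarrow> (\<exists>\<theta> \<in> param_forms L B n. X = def_set U n \<theta>)"

text \<open>\<open>h\<close> is a \<open>B\<close>-definable function from the definable set \<open>Y\<close> of \<open>m\<close>-tuples to \<open>n\<close>-tuples.\<close>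

definition definable_fun ::
  "('f, 'r) language \<Rightarrow> ('m, 'f, 'r) interp \<Rightarrow> 'm set \<Rightarrow> nat \<Rightarrow> nat \<Rightarrow> 'm list set
     \<Rightarrow> ('m list \<Rightarrow> 'm list) \<Rightarrow> bool" where
  "definable_fun L U B m n Y h \<longleftrightarrow> definable L U B m Y \<and> h ` Y \<subseteq> tuples (univ U) n \<and>
     definable L U B (m + n) ((\<lambda>x. x @ h x) ` Y)"

definition dcl :: "('f, 'r) language \<Rightarrow> ('m, 'f, 'r) interp \<Rightarrow> 'm set \<Rightarrow> 'm set" where
  "dcl L U B = {a. definable L U B 1 {[a]}}"

definition tp ::
  "('f, 'r) language \<Rightarrow> ('m, 'f, 'r) interp \<Rightarrow> 'm set \<Rightarrow> 'm list
     \<Rightarrow> (('f, 'r) form \<times> 'm list) set" where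
  "tp L U B b = {\<theta> \<in> param_forms L B (length b). psat U \<theta> b}"

definition realizes ::
  "('m, 'f, 'r) interp \<Rightarrow> nat \<Rightarrow> 'm list \<Rightarrow> (('f, 'r) form \<times> 'm list) set \<Rightarrow> bool" where
  "realizes U n b p \<longleftrightarrow> b \<in> tuples (univ U) n \<and> (\<forall>\<theta> \<in> p. psat U \<theta> b)"

text \<open>Complete \<open>n\<close>-types over \<open>B\<close>. Here \<open>B\<close> need not be small, so that a complete type need not be
  realized in \<open>U\<close>, even if \<open>U\<close> is a monster model.\<close>

definition complete_type ::
  "('f, 'r) language \<Rightarrow> ('m, 'f, 'r) interp \<Rightarrow> 'm set \<Rightarrow> nat
     \<Rightarrow> (('f, 'r) form \<times> 'm list) set \<Rightarrow> bool" where
  "complete_type L U B n p \<longleftrightarrow> p \<subseteq> param_forms L B n \<and>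
     (\<forall>q \<subseteq> p. finite q \<longrightarrow> (\<exists>b. realizes U n b q)) \<and>
     (\<forall>(\<phi>, c) \<in> param_forms L B n. (\<phi>, c) \<in> p \<or> (Neg \<phi>, c) \<in> p)"


section \<open>The monster model and properties of the theory\<close>

definition small :: "'k rel \<Rightarrow> 'a set \<Rightarrow> bool" where
  "small \<kappa> B \<longleftrightarrow> |B| <o \<kappa>"

text \<open>A monster model is \<open>\<kappa>\<close>-saturated and strongly \<open>\<kappa>\<close>-homogeneous for a cardinal \<open>\<kappa>\<close> larger than
  the number of formulas of the language (in particular, \<open>\<kappa>\<close> is uncountable).\<close>

definition monster ::
  "('f, 'r) language \<Rightarrow> ('f, 'r) form set \<Rightarrow> 'k rel \<Rightarrow> ('m, 'f, 'r) interp \<Rightarrow> bool" where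
  "monster L T \<kappa> U \<longleftrightarrow> is_model L T U \<and> Card_order \<kappa> \<and> small \<kappa> {\<phi>. \<exists>n. wf_form L n \<phi>} \<and>
     (\<forall>B n p. B \<subseteq> univ U \<longrightarrow> small \<kappa> B \<longrightarrow> complete_type L U B n p \<longrightarrow> (\<exists>b. realizes U n b p)) \<and>
     (\<forall>B f. B \<subseteq> univ U \<longrightarrow> small \<kappa> B \<longrightarrow> elementary_map L U B f \<longrightarrow>
        (\<exists>g. bij_betw g (univ U) (univ U) \<and> elementary_map L U (univ U) g \<and> (\<forall>b \<in> B. g b = f b)))"

text \<open>The next two notions are properties of the complete theory of \<open>U\<close>, evaluated, as usual, in
  the monster model \<open>U\<close>.

  A theory is totally transcendental if there is no binary tree of consistent formulas with
  parameters (Tent and Ziegler, A Course in Model Theory, Section 5.2).\<close>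

definition totally_transcendental ::
  "('f, 'r) language \<Rightarrow> ('m, 'f, 'r) interp \<Rightarrow> bool" where
  "totally_transcendental L U \<longleftrightarrow>
     \<not> (\<exists>n (D :: bool list \<Rightarrow> 'm list set). \<forall>s.
          definable L U (univ U) n (D s) \<and> D s \<noteq> {} \<and>
          D (s @ [False]) \<subseteq> D s \<and> D (s @ [True]) \<subseteq> D s \<and> D (s @ [False]) \<inter> D (s @ [True]) = {})"

text \<open>Every class of a \<open>\<emptyset>\<close>-definable equivalence relation \<open>E\<close> on \<open>n\<close>-tuples is of the form
  \<open>\<phi>(U, b)\<close> for some formula \<open>\<phi>\<close> and a unique finite tuple \<open>b\<close> (Hodges, Model Theory,
  Section 4.4).\<close>

definition eliminates_imaginaries ::
  "('f, 'r) language \<Rightarrow> ('m, 'f, 'r) interp \<Rightarrow> bool" where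
  "eliminates_imaginaries L U \<longleftrightarrow>
     (\<forall>n E. equiv (tuples (univ U) n) E \<longrightarrow> definable L U {} (2 * n) {x @ y | x y. (x, y) \<in> E} \<longrightarrow>
        (\<forall>a \<in> tuples (univ U) n. \<exists>m \<phi>. wf_form L (n + m) \<phi> \<and>
           (\<exists>!b. b \<in> tuples (univ U) m \<and> E `` {a} = def_set U n (\<phi>, b))))"

text \<open>As usual, all models are elementary submodels of the monster model.\<close>

definition prime_model_over ::
  "('f, 'r) language \<Rightarrow> ('m, 'f, 'r) interp \<Rightarrow> 'm set \<Rightarrow> 'm set \<Rightarrow> bool" where
  "prime_model_over L U A M \<longleftrightarrow> elementary_submodel L U M \<and> A \<subseteq> M \<and>
     (\<forall>N. elementary_submodel L U N \<longrightarrow> A \<subseteq> N \<longrightarrow>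
        (\<exists>f. elementary_map L U M f \<and> f ` M \<subseteq> N \<and> (\<forall>a \<in> A. f a = a)))"


section \<open>Definable Galois extensions\<close>

definition points :: "'m list set \<Rightarrow> 'm set \<Rightarrow> 'm list set" where
  "points X B = {x \<in> X. set x \<subseteq> B}"

definition coords :: "'m list set \<Rightarrow> 'm set" where
  "coords X = (\<Union>x \<in> X. set x)"

definition strongly_internal ::
  "('f, 'r) language \<Rightarrow> ('m, 'f, 'r) interp \<Rightarrow> 'm list set \<Rightarrow> 'm set \<Rightarrow> nat
     \<Rightarrow> (('f, 'r) form \<times> 'm list) set \<Rightarrow> bool" where
  "strongly_internal L U X D n p \<longleftrightarrow>
     (\<forall>b b'. realizes U n b p \<longrightarrow> realizes U n b' p \<longrightarrow> set b' \<subseteq> dcl L U (D \<union> coords X \<union> set b))"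

definition weakly_orthogonal ::
  "('f, 'r) language \<Rightarrow> ('m, 'f, 'r) interp \<Rightarrow> 'm list set \<Rightarrow> 'm set \<Rightarrow> nat
     \<Rightarrow> (('f, 'r) form \<times> 'm list) set \<Rightarrow> bool" where
  "weakly_orthogonal L U X D n p \<longleftrightarrow>
     (\<exists>!q. complete_type L U (dcl L U (D \<union> coords X)) n q \<and> p \<subseteq> q)"

definition galois_ext_ft ::
  "('f, 'r) language \<Rightarrow> ('m, 'f, 'r) interp \<Rightarrow> 'm list set \<Rightarrow> 'm set \<Rightarrow> 'm set \<Rightarrow> bool" where
  "galois_ext_ft L U X D E \<longleftrightarrow>
     (\<exists>n p b. complete_type L U D n p \<and> strongly_internal L U X D n p \<and>
        weakly_orthogonal L U X D n p \<and> realizes U n b p \<and> E = dcl L U (D \<union> set b))"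

definition galois_ext ::
  "('f, 'r) language \<Rightarrow> ('m, 'f, 'r) interp \<Rightarrow> 'm list set \<Rightarrow> 'm set \<Rightarrow> 'm set \<Rightarrow> 'm set \<Rightarrow> bool" where
  "galois_ext L U X M D E \<longleftrightarrow>
     (\<exists>\<F>. \<F> \<noteq> {} \<and> (\<forall>F \<in> \<F>. galois_ext_ft L U X D F \<and> F \<subseteq> M) \<and> E = \<Union>\<F>)"

primrec XDG ::
  "('f, 'r) language \<Rightarrow> ('m, 'f, 'r) interp \<Rightarrow> 'm list set \<Rightarrow> 'm set \<Rightarrow> 'm set \<Rightarrow> nat \<Rightarrow> 'm set" where
  "XDG L U X M A 0 = A"
| "XDG L U X M A (Suc n) = \<Union>{E. galois_ext L U X M (XDG L U X M A n) E}"

definition XDG_inf ::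
  "('f, 'r) language \<Rightarrow> ('m, 'f, 'r) interp \<Rightarrow> 'm list set \<Rightarrow> 'm set \<Rightarrow> 'm set \<Rightarrow> 'm set" where
  "XDG_inf L U X M A = (\<Union>n \<in> {1..}. XDG L U X M A n)"

definition iterated_galois_ext_ft ::
  "('f, 'r) language \<Rightarrow> ('m, 'f, 'r) interp \<Rightarrow> 'm list set \<Rightarrow> 'm set \<Rightarrow> 'm set \<Rightarrow> 'm set \<Rightarrow> bool" where
  "iterated_galois_ext_ft L U X M A B \<longleftrightarrow> B \<subseteq> M \<and>
     (\<exists>n C. C 0 = A \<and> C n = B \<and> (\<forall>i \<le> n. dcl L U (C i) = C i) \<and>
        (\<forall>i < n. C i \<subseteq> C (Suc i) \<and> galois_ext_ft L U X (C i) (C (Suc i))))"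

definition normal_set ::
  "('f, 'r) language \<Rightarrow> ('m, 'f, 'r) interp \<Rightarrow> 'm set \<Rightarrow> 'm set \<Rightarrow> 'm set \<Rightarrow> bool" where
  "normal_set L U A M B \<longleftrightarrow> A \<subseteq> B \<and> B \<subseteq> M \<and>
     (\<forall>b \<in> B. \<forall>b' \<in> M. tp L U A [b] = tp L U A [b'] \<longrightarrow> b' \<in> B)"

definition normal_closure ::
  "('f, 'r) language \<Rightarrow> ('m, 'f, 'r) interp \<Rightarrow> 'm set \<Rightarrow> 'm set \<Rightarrow> 'm set \<Rightarrow> 'm set" where
  "normal_closure L U A M B = \<Inter>{N. normal_set L U A M N \<and> dcl L U N = N \<and> B \<subseteq> N}"

definition galois_family ::
  "('f, 'r) language \<Rightarrow> ('m, 'f, 'r) interp \<Rightarrow> 'm list set \<Rightarrow> 'm set \<Rightarrow> 'm set \<Rightarrow> 'm set set" where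
  "galois_family L U X M A = {normal_closure L U A M B | B. iterated_galois_ext_ft L U X M A B}"


section \<open>Definable Galois cohomology\<close>

text \<open>A \<open>B\<close>-definable group of \<open>k\<close>-tuples.\<close>

definition definable_group ::
  "('f, 'r) language \<Rightarrow> ('m, 'f, 'r) interp \<Rightarrow> 'm set \<Rightarrow> nat \<Rightarrow> 'm list monoid \<Rightarrow> bool" where
  "definable_group L U B k G \<longleftrightarrow> group G \<and> definable L U B k (carrier G) \<and>
     definable L U B (3 * k)
       {x @ y @ (x \<otimes>\<^bsub>G\<^esub> y) | x y. x \<in> carrier G \<and> y \<in> carrier G}"

definition lives_on ::
  "('f, 'r) language \<Rightarrow> ('m, 'f, 'r) interp \<Rightarrow> 'm set \<Rightarrow> 'm list set \<Rightarrow> 'm list monoid \<Rightarrow> bool" where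
  "lives_on L U A X G \<longleftrightarrow> coords (carrier G) \<subseteq> dcl L U (A \<union> coords X)"

text \<open>The elements of \<open>Aut(B/A)\<close> are extended by the identity outside \<open>B\<close>.\<close>

definition aut ::
  "('f, 'r) language \<Rightarrow> ('m, 'f, 'r) interp \<Rightarrow> 'm set \<Rightarrow> 'm set \<Rightarrow> ('m \<Rightarrow> 'm) set" where
  "aut L U A B = {\<sigma>. \<sigma> permutes B \<and> elementary_map L U B \<sigma> \<and> (\<forall>a \<in> A. \<sigma> a = a)}"

type_synonym 'm cochain = "('m \<Rightarrow> 'm) \<Rightarrow> 'm list"

definition def_cocycles ::
  "('f, 'r) language \<Rightarrow> ('m, 'f, 'r) interp \<Rightarrow> 'm list monoid \<Rightarrow> 'm set \<Rightarrow> 'm set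
     \<Rightarrow> 'm cochain set" where
  "def_cocycles L U G A B =
     {\<phi> \<in> aut L U A B \<rightarrow>\<^sub>E points (carrier G) B.
        (\<forall>\<sigma> \<in> aut L U A B. \<forall>\<tau> \<in> aut L U A B. \<phi> (\<sigma> \<circ> \<tau>) = \<phi> \<sigma> \<otimes>\<^bsub>G\<^esub> map \<sigma> (\<phi> \<tau>)) \<and>
        (\<exists>m n b Y h. b \<in> tuples B m \<and> definable_fun L U A (2 * m) n Y h \<and>
           (\<forall>\<sigma> \<in> aut L U A B. b @ map \<sigma> b \<in> Y \<and> \<phi> \<sigma> = h (b @ map \<sigma> b)))}"

definition cohomologous ::
  "('f, 'r) language \<Rightarrow> ('m, 'f, 'r) interp \<Rightarrow> 'm list monoid \<Rightarrow> 'm set \<Rightarrow> 'm set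
     \<Rightarrow> 'm cochain rel" where
  "cohomologous L U G A B =
     {(\<phi>, \<psi>). \<phi> \<in> def_cocycles L U G A B \<and> \<psi> \<in> def_cocycles L U G A B \<and>
        (\<exists>g \<in> points (carrier G) B. \<forall>\<sigma> \<in> aut L U A B.
           \<phi> \<sigma> = inv\<^bsub>G\<^esub> g \<otimes>\<^bsub>G\<^esub> \<psi> \<sigma> \<otimes>\<^bsub>G\<^esub> map \<sigma> g)}"

definition H1def ::
  "('f, 'r) language \<Rightarrow> ('m, 'f, 'r) interp \<Rightarrow> 'm list monoid \<Rightarrow> 'm set \<Rightarrow> 'm set
     \<Rightarrow> 'm cochain set set" where
  "H1def L U G A B = def_cocycles L U G A B // cohomologous L U G A B"

definition H1_pt ::
  "('f, 'r) language \<Rightarrow> ('m, 'f, 'r) interp \<Rightarrow> 'm list monoid \<Rightarrow> 'm set \<Rightarrow> 'm set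
     \<Rightarrow> 'm cochain set" where
  "H1_pt L U G A B = cohomologous L U G A B `` {\<lambda>\<sigma> \<in> aut L U A B. \<one>\<^bsub>G\<^esub>}"

definition inflation ::
  "('f, 'r) language \<Rightarrow> ('m, 'f, 'r) interp \<Rightarrow> 'm set \<Rightarrow> 'm set \<Rightarrow> 'm set
     \<Rightarrow> 'm cochain \<Rightarrow> 'm cochain" where
  "inflation L U A B C \<phi> = (\<lambda>\<sigma> \<in> aut L U A C. \<phi> (restrict_id \<sigma> B))"

text \<open>The inflations of the members of a class \<open>c\<close> all lie in one class, which is the image below.\<close>

definition H1_trans ::
  "('f, 'r) language \<Rightarrow> ('m, 'f, 'r) interp \<Rightarrow> 'm list monoid \<Rightarrow> 'm set \<Rightarrow> 'm set \<Rightarrow> 'm set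
     \<Rightarrow> 'm cochain set \<Rightarrow> 'm cochain set" where
  "H1_trans L U G A B C c = cohomologous L U G A C `` (inflation L U A B C ` c)"


section \<open>Direct limits of pointed sets\<close>

definition directed_family :: "'i set set \<Rightarrow> bool" where
  "directed_family I \<longleftrightarrow> I \<noteq> {} \<and> (\<forall>B \<in> I. \<forall>C \<in> I. \<exists>D \<in> I. B \<subseteq> D \<and> C \<subseteq> D)"

text \<open>The direct limit of the sets \<open>S B\<close>, for \<open>B\<close> in a family \<open>I\<close> directed under inclusion, along the
  maps \<open>t B C\<close> for \<open>B \<subseteq> C\<close>.\<close>

definition dirlim_rel ::
  "'i set set \<Rightarrow> ('i set \<Rightarrow> 'x set) \<Rightarrow> ('i set \<Rightarrow> 'i set \<Rightarrow> 'x \<Rightarrow> 'x) \<Rightarrow> ('i set \<times> 'x) rel" where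
  "dirlim_rel I S t =
     {((B, x), (C, y)). B \<in> I \<and> x \<in> S B \<and> C \<in> I \<and> y \<in> S C \<and>
        (\<exists>D \<in> I. B \<subseteq> D \<and> C \<subseteq> D \<and> t B D x = t C D y)}"

definition dirlim ::
  "'i set set \<Rightarrow> ('i set \<Rightarrow> 'x set) \<Rightarrow> ('i set \<Rightarrow> 'i set \<Rightarrow> 'x \<Rightarrow> 'x) \<Rightarrow> ('i set \<times> 'x) set set" where
  "dirlim I S t = Sigma I S // dirlim_rel I S t"

text \<open>The base points \<open>pt B\<close> all represent the same element of the direct limit, which is the image
  below.\<close>

definition dirlim_pt ::
  "'i set set \<Rightarrow> ('i set \<Rightarrow> 'x set) \<Rightarrow> ('i set \<Rightarrow> 'i set \<Rightarrow> 'x \<Rightarrow> 'x) \<Rightarrow> ('i set \<Rightarrow> 'x)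
     \<Rightarrow> ('i set \<times> 'x) set" where
  "dirlim_pt I S t pt = dirlim_rel I S t `` {(B, pt B) | B. B \<in> I}"

definition pointed_iso :: "'a set \<times> 'a \<Rightarrow> 'b set \<times> 'b \<Rightarrow> bool" where
  "pointed_iso P Q \<longleftrightarrow> snd P \<in> fst P \<and> snd Q \<in> fst Q \<and>
     (\<exists>f. bij_betw f (fst P) (fst Q) \<and> f (snd P) = snd Q)"

end

theory Submission
  imports Defs
begin

text \<open>The prime model \<open>M\<close> is atomic over \<open>A\<close>. If a formula with parameters in \<open>X\<close> split the isolated
  type over \<open>A\<close> of a tuple of \<open>M\<close>, then it would do so with parameters in \<open>X(M) = X(A)\<close>, which is
  absurd; hence all types of tuples of \<open>M\<close> are weakly orthogonal to \<open>X\<close>, and only strong internality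
  matters. By compactness it is witnessed by one formula over a finite set, so that it is preserved by
  conjugation in \<open>M\<close> and by enlarging the base. This makes the iterated extensions of finite type
  directed, with union \<open>N\<close> (\<open>XDG_inf\<close>), and \<open>N\<close> normal.

  For the same reason \<open>G(M) = G(A)\<close>, so definable cocycles are homomorphisms into \<open>G(A)\<close> whose values
  depend only on the image of a finite tuple. Inflation to \<open>N\<close> is therefore injective on cohomology and
  jointly surjective, provided that automorphisms of a normal subset of \<open>N\<close> agree on each finite tuple
  with an automorphism of \<open>N\<close>. These are constructed by extending elementary maps one internal tuple
  \<open>c\<close> at a time, which is possible because the type of \<open>c\<close> over every subset of \<open>M\<close> containing its base
  is isolated. This replaces the descending chain condition for the definable automorphism
  group of \<open>c\<close>, and uses that the conjugates of \<open>c\<close> in \<open>M\<close> are all definable over \<open>c\<close>.\<close>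


section \<open>Definable predicates\<close>

text \<open>Homogeneity of \<open>M\<close> over \<open>A\<close> concerns finite tuples only.
  \<open>M\<close> is atomic over \<open>A\<close> and over finite extensions of \<open>A\<close>,
  but over an infinite set \<open>D\<close> with \<open>A \<subseteq> D \<subseteq> M\<close> it may
  realize types that are not isolated (an infinite, coinfinite subset of a pure set is an example),
  and an elementary map defined on such a \<open>D\<close> could then fail to extend inside
  \<open>M\<close>. The cohomology argument asks for little: a definable cocycle sees only the image
  of its defining tuple, so an automorphism need only be prescribed on \<open>A\<close> and one
  finite tuple. But its construction passes through infinite domains on the way to \<open>N\<close>,
  and there isolation over arbitrary intermediate sets is indispensable. It is available for
  internal tuples, and the stages of \<open>XDG\<close> reach all of \<open>N\<close> through them.
  The range is treated by applying the same maximality argument to the converse relation.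

  Definability is expressed by predicates on tuples (\<open>def_pred\<close>) instead of formulas,
  which confines de Bruijn indices to a few basic lemmas.\<close>

primrec ren_trm :: "(nat \<Rightarrow> nat) \<Rightarrow> 'f trm \<Rightarrow> 'f trm" where
  "ren_trm r (Var i) = Var (r i)"
| "ren_trm r (Fn f ts) = Fn f (map (ren_trm r) ts)"

primrec ren_form :: "(nat \<Rightarrow> nat) \<Rightarrow> ('f, 'r) form \<Rightarrow> ('f, 'r) form" where
  "ren_form r (Eq s t) = Eq (ren_trm r s) (ren_trm r t)"
| "ren_form r (Rel R ts) = Rel R (map (ren_trm r) ts)"
| "ren_form r (Neg \<phi>) = Neg (ren_form r \<phi>)"
| "ren_form r (Conj \<phi> \<psi>) = Conj (ren_form r \<phi>) (ren_form r \<psi>)"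
| "ren_form r (Ex \<phi>) = Ex (ren_form (case_nat 0 (\<lambda>j. Suc (r j))) \<phi>)"

lemma wf_ren_trm:
  "wf_trm L n t \<Longrightarrow> (\<And>i. i < n \<Longrightarrow> r i < n') \<Longrightarrow> wf_trm L n' (ren_trm r t)"
  by (induction t) (auto simp: list_all_iff)

lemma wf_ren_form:
  "wf_form L n \<phi> \<Longrightarrow> (\<And>i. i < n \<Longrightarrow> r i < n') \<Longrightarrow> wf_form L n' (ren_form r \<phi>)"
proof (induction \<phi> arbitrary: n n' r)
  case (Ex \<phi>)
  show ?case using Ex.prems
    by (auto intro!: Ex.IH[of "Suc n"] split: nat.split)
qed (auto simp: list_all_iff wf_ren_trm)

lemma trm_val_ren:
  "wf_trm L n t \<Longrightarrow> trm_val S e (ren_trm r t) = trm_val S (map (\<lambda>i. e ! r i) [0..<n]) t"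
  by (induction t) (auto simp: list_all_iff cong: map_cong)

lemma trm_val_ren_list:
  "list_all (wf_trm L n) ts \<Longrightarrow>
    map (trm_val S e \<circ> ren_trm r) ts = map (trm_val S (map (\<lambda>i. e ! r i) [0..<n])) ts"
  by (auto simp: list_all_iff trm_val_ren)

text \<open>A well-formed formula reads only the first \<open>n\<close> entries of its environment,
  so the renamed environment can be cut to length \<open>n\<close>.\<close>

lemma sat_ren:
  "wf_form L n \<phi> \<Longrightarrow> sat S (ren_form r \<phi>) e \<longleftrightarrow> sat S \<phi> (map (\<lambda>i. e ! r i) [0..<n])"
proof (induction \<phi> arbitrary: n r e)
  case (Ex \<phi>)
  have *: "map (\<lambda>i. (a # e) ! case_nat 0 (\<lambda>j. Suc (r j)) i) [0..<Suc n] =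
      a # map (\<lambda>i. e ! r i) [0..<n]" for a
    by (rule nth_equalityI) (auto simp: nth_Cons simp del: upt_Suc split: nat.split)
  show ?case using Ex.prems Ex.IH[of "Suc n"] by (simp add: * del: upt_Suc)
qed (auto simp: trm_val_ren trm_val_ren_list)

lemma tuples_mono: "B \<subseteq> C \<Longrightarrow> x \<in> tuples B n \<Longrightarrow> x \<in> tuples C n"
  by (auto simp: tuples_def)

lemma tuples_length: "x \<in> tuples B n \<Longrightarrow> length x = n"
  by (simp add: tuples_def)

lemma tuples_append: "x \<in> tuples B m \<Longrightarrow> y \<in> tuples B n \<Longrightarrow> x @ y \<in> tuples B (m + n)"
  by (simp add: tuples_def)

lemma tuples_take: "x \<in> tuples B n \<Longrightarrow> m \<le> n \<Longrightarrow> take m x \<in> tuples B m"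
  by (auto simp: tuples_def dest: in_set_takeD)

lemma tuples_drop: "x \<in> tuples B n \<Longrightarrow> k = n - m \<Longrightarrow> drop m x \<in> tuples B k"
  by (auto simp: tuples_def dest: in_set_dropD)

lemma tuples_append_split:
  "z \<in> tuples B (m + n) \<Longrightarrow> \<exists>x \<in> tuples B m. \<exists>y \<in> tuples B n. z = x @ y"
  by (metis append_take_drop_id le_add1 tuples_drop tuples_take add_diff_cancel_left')

locale fo_struct =
  fixes L :: "('f, 'r) language" and U :: "('m, 'f, 'r) interp"
  assumes struct: "is_struct L U"
begin

abbreviation tup :: "nat \<Rightarrow> 'm list set" where "tup \<equiv> tuples (univ U)"

text \<open>Only the values of \<open>P\<close> on \<open>tup n\<close> matter. Its behaviour on
  other lists is unconstrained, so \<open>take\<close>, \<open>drop\<close> and \<open>!\<close> may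
  occur in predicates without side conditions on lengths.\<close>

definition def_pred :: "'m set \<Rightarrow> nat \<Rightarrow> ('m list \<Rightarrow> bool) \<Rightarrow> bool" where
  "def_pred B n P \<longleftrightarrow> (\<exists>\<theta> \<in> param_forms L B n. \<forall>x \<in> tup n. P x \<longleftrightarrow> psat U \<theta> x)"

lemma def_predI:
  "set c \<subseteq> B \<Longrightarrow> wf_form L (n + length c) \<phi> \<Longrightarrow> (\<And>x. x \<in> tup n \<Longrightarrow> P x \<longleftrightarrow> sat U \<phi> (x @ c))
    \<Longrightarrow> def_pred B n P"
  unfolding def_pred_def by (rule bexI[of _ "(\<phi>, c)"]) (auto simp: psat_def param_forms_def)

lemma def_predE:
  assumes "def_pred B n P"
  obtains \<phi> c where "set c \<subseteq> B" "wf_form L (n + length c) \<phi>"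
    "\<And>x. x \<in> tup n \<Longrightarrow> P x \<longleftrightarrow> sat U \<phi> (x @ c)"
  using assms unfolding def_pred_def by (auto simp: psat_def param_forms_def)

lemma def_pred_psat: "\<theta> \<in> param_forms L B n \<Longrightarrow> def_pred B n (psat U \<theta>)"
  unfolding def_pred_def by auto

lemma definable_iff_def_pred:
  "definable L U B n Y \<longleftrightarrow> Y \<subseteq> tup n \<and> def_pred B n (\<lambda>x. x \<in> Y)"
  unfolding definable_def def_pred_def def_set_def by fastforce

lemma def_pred_mono: "def_pred B n P \<Longrightarrow> B \<subseteq> C \<Longrightarrow> def_pred C n P"
  unfolding def_pred_def param_forms_def by fastforce

lemma def_pred_cong:
  "def_pred B n P \<Longrightarrow> (\<And>x. x \<in> tup n \<Longrightarrow> P x \<longleftrightarrow> Q x) \<Longrightarrow> def_pred B n Q"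
  unfolding def_pred_def by fastforce

lemma def_pred_not [intro]: "def_pred B n P \<Longrightarrow> def_pred B n (\<lambda>x. \<not> P x)"
  by (erule def_predE, rule_tac c = c and \<phi> = "Neg \<phi>" in def_predI) auto

text \<open>Selections, which stand in for substitution of variables and parameters.\<close>

definition sel :: "'m set \<Rightarrow> nat \<Rightarrow> nat \<Rightarrow> ('m list \<Rightarrow> 'm list) \<Rightarrow> bool" where
  "sel B n k g \<longleftrightarrow> (\<exists>c is. set c \<subseteq> B \<and> length is = k \<and> set is \<subseteq> {..<n + length c} \<and>
     (\<forall>z \<in> tup n. g z = map ((!) (z @ c)) is))"

lemma selI:
  "set c \<subseteq> B \<Longrightarrow> length is = k \<Longrightarrow> set is \<subseteq> {..<n + length c} \<Longrightarrow>
    (\<And>z. z \<in> tup n \<Longrightarrow> g z = map ((!) (z @ c)) is) \<Longrightarrow> sel B n k g"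
  unfolding sel_def by blast

lemma sel_id: "sel B n n (\<lambda>z. z)"
  by (rule selI[of "[]" _ "[0..<n]"]) (auto simp: tuples_def intro: nth_equalityI)

lemma sel_const: "set c \<subseteq> B \<Longrightarrow> k = length c \<Longrightarrow> sel B n k (\<lambda>_. c)"
  by (rule selI[of c _ "[n..<n + length c]"])
     (auto simp: tuples_def nth_append intro: nth_equalityI)

lemma sel_take: "sel B n k g \<Longrightarrow> m \<le> k \<Longrightarrow> sel B n m (\<lambda>z. take m (g z))"
  unfolding sel_def
  by (elim exE conjE, rule_tac x = c in exI, rule_tac x = "take m is" in exI)
     (auto simp: take_map dest: in_set_takeD)

lemma sel_drop: "sel B n k g \<Longrightarrow> m = k - j \<Longrightarrow> sel B n m (\<lambda>z. drop j (g z))"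
  unfolding sel_def
  by (elim exE conjE, rule_tac x = c in exI, rule_tac x = "drop j is" in exI)
     (auto simp: drop_map dest: in_set_dropD)

lemma sel_nth: "sel B n k g \<Longrightarrow> i < k \<Longrightarrow> sel B n 1 (\<lambda>z. [g z ! i])"
  unfolding sel_def
  by (elim exE conjE, rule_tac x = c in exI, rule_tac x = "[is ! i]" in exI)
     (auto simp: subset_iff)

lemma sel_append:
  assumes "sel B n k1 g1" "sel B n k2 g2" "k = k1 + k2"
  shows "sel B n k (\<lambda>z. g1 z @ g2 z)"
proof -
  from assms(1) obtain c1 is1 where 1: "set c1 \<subseteq> B" "length is1 = k1" "set is1 \<subseteq> {..<n + length c1}"
    "\<And>z. z \<in> tup n \<Longrightarrow> g1 z = map ((!) (z @ c1)) is1" unfolding sel_def by blast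
  from assms(2) obtain c2 is2 where 2: "set c2 \<subseteq> B" "length is2 = k2" "set is2 \<subseteq> {..<n + length c2}"
    "\<And>z. z \<in> tup n \<Longrightarrow> g2 z = map ((!) (z @ c2)) is2" unfolding sel_def by blast
  \<comment> \<open>In \<open>z @ c1 @ c2\<close> the parameters of the second selection sit behind
    \<open>c1\<close>.\<close>
  let ?f = "\<lambda>i. if i < n then i else i + length c1"
  show ?thesis
  proof (rule selI[of "c1 @ c2" _ "is1 @ map ?f is2"])
    fix z assume z: "z \<in> tup n"
    have "map ((!) (z @ c1)) is1 = map ((!) (z @ c1 @ c2)) is1"
      using 1(3) tuples_length[OF z] by (auto simp: nth_append)
    moreover have "map ((!) (z @ c2)) is2 = map ((!) (z @ c1 @ c2)) (map ?f is2)"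
      using 2(3) tuples_length[OF z] by (auto simp: nth_append)
    ultimately show "g1 z @ g2 z = map ((!) (z @ c1 @ c2)) (is1 @ map ?f is2)"
      using 1(4)[OF z] 2(4)[OF z] by simp
  qed (use 1 2 assms(3) in fastforce)+
qed

lemma sel_tup: "sel B n k g \<Longrightarrow> B \<subseteq> univ U \<Longrightarrow> z \<in> tup n \<Longrightarrow> g z \<in> tup k"
  unfolding sel_def by (fastforce simp: tuples_def nth_append)

lemma sel_pick:
  "set is \<subseteq> {..<n} \<Longrightarrow> k = length is \<Longrightarrow> sel B n k (\<lambda>z. map ((!) z) is)"
  by (rule selI[of "[]" _ "is"]) auto

lemma sel_prefix: "m \<le> n \<Longrightarrow> sel B n m (take m)"
  using sel_take[OF sel_id] .

lemma sel_suffix: "sel B n (n - j) (drop j)"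
  using sel_drop[OF sel_id refl] .

lemma sel_slice: "m \<le> n - j \<Longrightarrow> sel B n m (\<lambda>z. take m (drop j z))"
  using sel_take[OF sel_suffix] .

lemmas sel_intros = sel_append sel_take sel_drop sel_id sel_const

text \<open>The substitution lemma: renaming variables along \<open>is\<close> does to the formula
  what \<open>g\<close> does to tuples. The parameters \<open>c\<close> are appended to the
  selection first, so that a single renaming places them as well.\<close>

lemma def_pred_sel:
  assumes P: "def_pred B k P" and g: "sel B n k g" and B: "B \<subseteq> univ U"
  shows "def_pred B n (\<lambda>z. P (g z))"
proof -
  obtain \<phi> c where c: "set c \<subseteq> B" and wf: "wf_form L (k + length c) \<phi>"
    and P: "\<And>x. x \<in> tup k \<Longrightarrow> P x \<longleftrightarrow> sat U \<phi> (x @ c)" using P by (rule def_predE) auto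
  have "sel B n (k + length c) (\<lambda>z. g z @ c)"
    using g c by (intro sel_append sel_const) auto
  then obtain d "is" where d: "set d \<subseteq> B" "length is = k + length c" "set is \<subseteq> {..<n + length d}"
    "\<And>z. z \<in> tup n \<Longrightarrow> g z @ c = map ((!) (z @ d)) is" unfolding sel_def by blast
  show ?thesis
  proof (rule def_predI[of d])
    show "wf_form L (n + length d) (ren_form (\<lambda>i. is ! i) \<phi>)"
      using d(2,3) by (intro wf_ren_form[OF wf]) (auto simp: subset_iff)
    fix z assume z: "z \<in> tup n"
    have "map (\<lambda>i. (z @ d) ! (is ! i)) [0..<k + length c] = map ((!) (z @ d)) is"
      using d(2) by (intro nth_equalityI) auto
    then show "P (g z) \<longleftrightarrow> sat U (ren_form (\<lambda>i. is ! i) \<phi>) (z @ d)"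
      using P[OF sel_tup[OF g B z]] sat_ren[OF wf, of U "\<lambda>i. is ! i" "z @ d"] d(4)[OF z] by simp
  qed fact
qed

section \<open>Closure of definable predicates under connectives, quantifiers and equality\<close>

lemma def_pred_conj [intro]:
  assumes "def_pred B n P" "def_pred B n Q"
  shows "def_pred B n (\<lambda>x. P x \<and> Q x)"
proof -
  obtain \<phi> c where 1: "set c \<subseteq> B" "wf_form L (n + length c) \<phi>"
    "\<And>x. x \<in> tup n \<Longrightarrow> P x \<longleftrightarrow> sat U \<phi> (x @ c)" using assms(1) by (rule def_predE) auto
  obtain \<psi> d where 2: "set d \<subseteq> B" "wf_form L (n + length d) \<psi>"
    "\<And>x. x \<in> tup n \<Longrightarrow> Q x \<longleftrightarrow> sat U \<psi> (x @ d)" using assms(2) by (rule def_predE) auto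
  let ?r = "\<lambda>i. if i < n then i else i + length c"
  show ?thesis
  proof (rule def_predI[of "c @ d"])
    show "wf_form L (n + length (c @ d)) (Conj (ren_form id \<phi>) (ren_form ?r \<psi>))"
      by (auto intro: wf_ren_form[OF 1(2)] wf_ren_form[OF 2(2)])
    fix x assume x: "x \<in> tup n"
    have "map (\<lambda>i. (x @ c @ d) ! id i) [0..<n + length c] = x @ c"
      using tuples_length[OF x] by (intro nth_equalityI) (auto simp: nth_append)
    moreover have "map (\<lambda>i. (x @ c @ d) ! ?r i) [0..<n + length d] = x @ d"
      using tuples_length[OF x] by (intro nth_equalityI) (auto simp: nth_append)
    ultimately show "P x \<and> Q x \<longleftrightarrow> sat U (Conj (ren_form id \<phi>) (ren_form ?r \<psi>)) (x @ c @ d)"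
      using 1(3)[OF x] 2(3)[OF x] sat_ren[OF 1(2), of U id "x @ c @ d"]
        sat_ren[OF 2(2), of U ?r "x @ c @ d"] by simp
  qed (use 1 2 in auto)
qed

lemma def_pred_disj [intro]:
  "def_pred B n P \<Longrightarrow> def_pred B n Q \<Longrightarrow> def_pred B n (\<lambda>x. P x \<or> Q x)"
  using def_pred_not[OF def_pred_conj[OF def_pred_not def_pred_not]] by fastforce

lemma def_pred_imp [intro]:
  "def_pred B n P \<Longrightarrow> def_pred B n Q \<Longrightarrow> def_pred B n (\<lambda>x. P x \<longrightarrow> Q x)"
  using def_pred_disj[OF def_pred_not] by fastforce

lemma def_pred_ex1:
  assumes "def_pred B (Suc n) P"
  shows "def_pred B n (\<lambda>x. \<exists>a \<in> univ U. P (a # x))"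
proof -
  obtain \<phi> c where 1: "set c \<subseteq> B" "wf_form L (Suc n + length c) \<phi>"
    "\<And>x. x \<in> tup (Suc n) \<Longrightarrow> P x \<longleftrightarrow> sat U \<phi> (x @ c)" using assms by (rule def_predE) auto
  show ?thesis
    by (rule def_predI[of c _ _ "Ex \<phi>"]) (use 1 in \<open>auto simp: tuples_def\<close>)
qed

lemma def_pred_eq: "i < n \<Longrightarrow> j < n \<Longrightarrow> def_pred B n (\<lambda>x. x ! i = x ! j)"
  by (rule def_predI[of "[]" _ _ "Eq (Var i) (Var j)"]) (auto simp: tuples_def)

text \<open>For \<open>n = 0\<close> there is no free variable to write an equation with, so truth
  is an existential sentence, which holds because the universe is nonempty.\<close>

lemma def_pred_True: "def_pred B n (\<lambda>x. True)"
  by (rule def_predI[of "[]" _ _ "Ex (Eq (Var 0) (Var 0))"])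
     (use struct in \<open>auto simp: is_struct_def\<close>)

lemma def_pred_const: "def_pred B n (\<lambda>x. b)"
  using def_pred_True def_pred_not[OF def_pred_True] by (cases b) auto

text \<open>The quantified block stands in front because \<open>Ex\<close> binds variable
  \<open>0\<close>. Applications therefore present the bound tuple as \<open>take m z\<close> and
  the free one as \<open>drop m z\<close>.\<close>

lemma def_pred_ex:
  assumes "B \<subseteq> univ U"
  shows "def_pred B (m + n) (\<lambda>z. P (take m z) (drop m z)) \<Longrightarrow>
    def_pred B n (\<lambda>x. \<exists>y \<in> tup m. P y x)"
proof (induction m arbitrary: P)
  case 0
  then show ?case by (simp add: tuples_def)
next
  case (Suc m)
  have "def_pred B (Suc (m + n)) (\<lambda>z. P (hd z # take m (tl z)) (drop m (tl z)))"
    using Suc.prems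
    by (rule def_pred_cong[OF subst[of _ _ "\<lambda>k. def_pred B k _"], rotated])
       (auto simp: tuples_def length_Suc_conv)
  from def_pred_ex1[OF this]
  have "def_pred B (m + n) (\<lambda>z. \<exists>a \<in> univ U. P (a # take m z) (drop m z))" by simp
  from Suc.IH[OF this] have "def_pred B n (\<lambda>x. \<exists>y \<in> tup m. \<exists>a \<in> univ U. P (a # y) x)" .
  moreover have "(\<exists>y \<in> tup m. \<exists>a \<in> univ U. P (a # y) x) \<longleftrightarrow> (\<exists>y \<in> tup (Suc m). P y x)" for x
  proof
    assume "\<exists>y \<in> tup m. \<exists>a \<in> univ U. P (a # y) x"
    then show "\<exists>y \<in> tup (Suc m). P y x"
      by (elim bexE, rule_tac x = "a # y" in bexI) (auto simp: tuples_def)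
  next
    assume "\<exists>y \<in> tup (Suc m). P y x"
    then obtain y where "y \<in> tup (Suc m)" "P y x" by blast
    then show "\<exists>y \<in> tup m. \<exists>a \<in> univ U. P (a # y) x"
      by (cases y) (auto simp: tuples_def intro!: bexI[of _ "tl y"] bexI[of _ "hd y"])
  qed
  ultimately show ?case by simp
qed

lemma def_pred_all:
  assumes "B \<subseteq> univ U" "def_pred B (m + n) (\<lambda>z. P (take m z) (drop m z))"
  shows "def_pred B n (\<lambda>x. \<forall>y \<in> tup m. P y x)"
  using def_pred_not[OF def_pred_ex[OF assms(1) def_pred_not[OF assms(2)]]] by simp

lemma def_pred_finite_all:
  "finite I \<Longrightarrow> (\<And>i. i \<in> I \<Longrightarrow> def_pred B n (P i)) \<Longrightarrow> def_pred B n (\<lambda>x. \<forall>i \<in> I. P i x)"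
  by (induction rule: finite_induct) (auto simp: def_pred_True)

lemma def_pred_finite_ex:
  "finite I \<Longrightarrow> (\<And>i. i \<in> I \<Longrightarrow> def_pred B n (P i)) \<Longrightarrow> def_pred B n (\<lambda>x. \<exists>i \<in> I. P i x)"
  using def_pred_not[OF def_pred_finite_all[of I B n "\<lambda>i x. \<not> P i x"]] by auto

lemma def_pred_sel_eq:
  assumes "sel B n k f" "sel B n k g" "B \<subseteq> univ U"
  shows "def_pred B n (\<lambda>x. f x = g x)"
proof -
  have "def_pred B (k + k) (\<lambda>z. \<forall>i \<in> {..<k}. z ! i = z ! (k + i))"
    by (intro def_pred_finite_all def_pred_eq) auto
  from def_pred_sel[OF this sel_append[OF assms(1,2) refl] assms(3)] show ?thesis
  proof (rule def_pred_cong)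
    fix z assume "z \<in> tup n"
    then have "length (f z) = k" "length (g z) = k"
      using sel_tup assms tuples_length by blast+
    then show "(\<forall>i \<in> {..<k}. (f z @ g z) ! i = (f z @ g z) ! (k + i)) \<longleftrightarrow> f z = g z"
      by (auto simp: nth_append list_eq_iff_nth_eq)
  qed
qed

text \<open>A formula mentions finitely many parameters, so those outside \<open>B\<close> form a
  finite tuple that can be turned into variables. Statements over large sets are reduced to finite
  tuples in this way throughout.\<close>

lemma def_pred_split_params:
  assumes "def_pred (B \<union> C) n P" "B \<subseteq> univ U"
  obtains Q c where "set c \<subseteq> C" "def_pred B (n + length c) Q"
    "\<And>x. x \<in> tup n \<Longrightarrow> P x \<longleftrightarrow> Q (x @ c)"
proof -
  obtain \<phi> d where 1: "set d \<subseteq> B \<union> C" "wf_form L (n + length d) \<phi>"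
    "\<And>x. x \<in> tup n \<Longrightarrow> P x \<longleftrightarrow> sat U \<phi> (x @ d)" using assms(1) by (rule def_predE) auto
  define b where "b = filter (\<lambda>a. a \<in> B) d"
  define c where "c = filter (\<lambda>a. a \<notin> B) d"
  have "\<exists>j < length (c @ b). (c @ b) ! j = d ! i" if "i < length d" for i
    using that by (subst in_set_conv_nth[symmetric]) (auto simp: b_def c_def)
  then obtain r where r: "\<And>i. i < length d \<Longrightarrow> r i < length (c @ b) \<and> (c @ b) ! r i = d ! i"
    by metis
  \<comment> \<open>Variables stay in place; each parameter in \<open>d\<close> is looked up at the
    position where it reappears in \<open>c @ b\<close>.\<close>
  let ?r = "\<lambda>i. if i < n then i else n + r (i - n)"
  let ?\<psi> = "ren_form ?r \<phi>"
  have wf: "wf_form L (n + length c + length b) ?\<psi>"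
  proof (rule wf_ren_form[OF 1(2)])
    fix i assume "i < n + length d"
    then show "?r i < n + length c + length b" using r[of "i - n"] by auto
  qed
  show ?thesis
  proof (rule that[of c "\<lambda>z. sat U ?\<psi> (z @ b)"])
    show "set c \<subseteq> C" using 1(1) by (auto simp: c_def)
    show "def_pred B (n + length c) (\<lambda>z. sat U ?\<psi> (z @ b))"
      by (rule def_predI[of b, OF _ wf]) (auto simp: b_def)
    fix x assume x: "x \<in> tup n"
    have "map (\<lambda>i. (x @ c @ b) ! ?r i) [0..<n + length d] = x @ d"
      using tuples_length[OF x] r by (intro nth_equalityI) (auto simp: nth_append)
    then show "P x \<longleftrightarrow> sat U ?\<psi> ((x @ c) @ b)"
      using 1(3)[OF x] sat_ren[OF 1(2), of U ?r "x @ c @ b"] by simp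
  qed
qed

lemma def_pred_fix_params:
  "def_pred B (n + k) Q \<Longrightarrow> B \<subseteq> C \<Longrightarrow> set c \<subseteq> C \<Longrightarrow> k = length c \<Longrightarrow> C \<subseteq> univ U \<Longrightarrow>
    def_pred C n (\<lambda>x. Q (x @ c))"
  by (rule def_pred_sel[OF def_pred_mono]) (auto intro!: sel_append sel_id sel_const)

text \<open>Here all of \<open>d\<close> becomes variables, in the given order, rather than some
  unspecified tuple of its entries. This form is needed whenever \<open>d\<close> is to be replaced
  by a conjugate of the same length.\<close>

lemma def_pred_split_list:
  assumes "def_pred (B \<union> set d) n P" "B \<subseteq> univ U" "set d \<subseteq> univ U"
  obtains Q where "def_pred B (n + length d) Q" "\<And>x. x \<in> tup n \<Longrightarrow> P x \<longleftrightarrow> Q (x @ d)"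
proof -
  obtain Q c where c: "set c \<subseteq> set d" "def_pred B (n + length c) Q"
    "\<And>x. x \<in> tup n \<Longrightarrow> P x \<longleftrightarrow> Q (x @ c)" 
    by (rule def_pred_split_params[OF assms(1,2)]) blast
  have "\<exists>i < length d. d ! i = a" if "a \<in> set c" for a
    using that c(1) by (auto simp: subset_iff in_set_conv_nth)
  then obtain f where f: "\<And>a. a \<in> set c \<Longrightarrow> f a < length d \<and> d ! f a = a" by metis
  have eq: "map ((!) d) (map f c) = c" using f by (auto intro: map_idI)
  have "sel B (n + length d) (length c) (\<lambda>z. map ((!) (drop n z)) (map f c))"
    using f by (intro selI[of "[]" _ "map (\<lambda>a. n + f a) c"]) (auto simp: tuples_def)
  then have "sel B (n + length d) (n + length c)
      (\<lambda>z. take n z @ map ((!) (drop n z)) (map f c))"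
    by (intro sel_append[of _ _ n] sel_take[of _ _ "n + length d"] sel_id) auto
  from def_pred_sel[OF c(2) this assms(2)]
  show ?thesis
    by (rule that) (use c(3) eq in \<open>auto simp: tuples_def\<close>)
qed

section \<open>Types\<close>

text \<open>A formula-free version of equality of \<open>tp\<close>, to which
  \<open>tp_eq_iff_eqtp\<close> ties it; closure properties of \<open>def_pred\<close> then
  transport types directly.\<close>

definition eqtp :: "'m set \<Rightarrow> 'm list \<Rightarrow> 'm list \<Rightarrow> bool" where
  "eqtp B x y \<longleftrightarrow> length x = length y \<and> (\<forall>P. def_pred B (length x) P \<longrightarrow> P x = P y)"

lemma eqtp_refl: "eqtp B x x"
  by (simp add: eqtp_def)

lemma eqtp_sym: "eqtp B x y \<Longrightarrow> eqtp B y x"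
  unfolding eqtp_def by metis

lemma eqtp_trans [trans]: "eqtp B x y \<Longrightarrow> eqtp B y z \<Longrightarrow> eqtp B x z"
  unfolding eqtp_def by metis

lemma eqtp_length: "eqtp B x y \<Longrightarrow> length x = length y"
  by (simp add: eqtp_def)

lemma eqtpD: "eqtp B x y \<Longrightarrow> def_pred B (length x) P \<Longrightarrow> P x \<longleftrightarrow> P y"
  by (simp add: eqtp_def)

lemma eqtp_mono: "eqtp C x y \<Longrightarrow> B \<subseteq> C \<Longrightarrow> eqtp B x y"
  using def_pred_mono by (auto simp: eqtp_def)

lemma eqtpI:
  assumes "length x = length y" "\<And>P. def_pred B (length x) P \<Longrightarrow> P x \<Longrightarrow> P y"
  shows "eqtp B x y"
  using assms def_pred_not unfolding eqtp_def by metis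

lemma eqtp_sel:
  assumes "eqtp B x y" "sel B (length x) k g" "B \<subseteq> univ U" "set x \<subseteq> univ U" "set y \<subseteq> univ U"
  shows "eqtp B (g x) (g y)"
proof -
  have "length (g x) = k" "length (g y) = k"
    using sel_tup[OF assms(2,3)] assms eqtp_length[OF assms(1)] by (auto simp: tuples_def)
  then show ?thesis
    using def_pred_sel[OF _ assms(2,3)] assms(1) unfolding eqtp_def by metis
qed

lemma eqtp_params:
  assumes "eqtp B (x @ c) (y @ c)" "B \<subseteq> univ U" "set c \<subseteq> univ U" "set x \<subseteq> univ U"
    "set y \<subseteq> univ U"
  shows "eqtp (B \<union> set c) x y"
proof (rule eqtpI)
  show l: "length x = length y" using eqtp_length[OF assms(1)] by simp
  fix P assume P: "def_pred (B \<union> set c) (length x) P" "P x"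
  obtain Q where "def_pred B (length x + length c) Q"
    "\<And>z. z \<in> tup (length x) \<Longrightarrow> P z \<longleftrightarrow> Q (z @ c)"
    using def_pred_split_list[OF P(1) assms(2,3)] by blast
  then show "P y" using eqtpD[OF assms(1), of Q] P(2) l assms(4,5) by (auto simp: tuples_def)
qed

lemma eqtp_append_params:
  assumes "eqtp C x y" "B \<subseteq> C" "set c \<subseteq> C" "C \<subseteq> univ U"
  shows "eqtp B (x @ c) (y @ c)"
proof (rule eqtpI)
  show "length (x @ c) = length (y @ c)" using eqtp_length[OF assms(1)] by simp
  fix P assume P: "def_pred B (length (x @ c)) P" "P (x @ c)"
  have "def_pred C (length x) (\<lambda>z. P (z @ c))"
    using P(1) assms by (intro def_pred_fix_params[of B]) auto
  from eqtpD[OF assms(1) this] P(2) show "P (y @ c)" by simp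
qed

lemma eqtp_finite_params:
  assumes "\<And>c. set c \<subseteq> C \<Longrightarrow> eqtp B (x @ c) (y @ c)" "B \<subseteq> univ U" "C \<subseteq> univ U"
    "set x \<subseteq> univ U" "set y \<subseteq> univ U"
  shows "eqtp (B \<union> C) x y"
proof (rule eqtpI)
  show l: "length x = length y" using eqtp_length[OF assms(1)[of "[]"]] by simp
  fix P assume P: "def_pred (B \<union> C) (length x) P" "P x"
  obtain Q c where c: "set c \<subseteq> C" "def_pred B (length x + length c) Q"
    "\<And>z. z \<in> tup (length x) \<Longrightarrow> P z \<longleftrightarrow> Q (z @ c)"
    by (rule def_pred_split_params[OF P(1) assms(2)]) blast
  show "P y"
    using eqtpD[OF assms(1)[OF c(1)], of Q] P(2) l assms(4,5) c(2) c(3)[of x] c(3)[of y]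
    by (simp add: tuples_def)
qed

lemma tp_eq_iff_eqtp:
  assumes "x \<in> tup n" "y \<in> tup n"
  shows "tp L U B x = tp L U B y \<longleftrightarrow> eqtp B x y"
proof
  have l: "length x = n" "length y = n" using assms by (auto simp: tuples_def)
  show "eqtp B x y" if "tp L U B x = tp L U B y"
  proof (rule eqtpI)
    fix P assume "def_pred B (length x) P" "P x"
    then obtain \<theta> where \<theta>: "\<theta> \<in> param_forms L B n" "\<And>z. z \<in> tup n \<Longrightarrow> P z \<longleftrightarrow> psat U \<theta> z"
      unfolding def_pred_def l by blast
    then have "\<theta> \<in> tp L U B x" using \<open>P x\<close> assms l by (auto simp: tp_def)
    then show "P y" using that \<theta> assms by (auto simp: tp_def)
  qed (simp add: l)
  show "tp L U B x = tp L U B y" if "eqtp B x y"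
    using eqtpD[OF that def_pred_psat] l by (auto simp: tp_def)
qed

section \<open>Isolated types\<close>

definition isol :: "'m set \<Rightarrow> 'm list \<Rightarrow> bool" where
  "isol B x \<longleftrightarrow> (\<exists>P. def_pred B (length x) P \<and> P x \<and> (\<forall>y \<in> tup (length x). P y \<longrightarrow> eqtp B x y))"

lemma isolE:
  assumes "isol B x"
  obtains P where "def_pred B (length x) P" "P x" "\<And>y. y \<in> tup (length x) \<Longrightarrow> P y \<Longrightarrow> eqtp B x y"
  using assms unfolding isol_def by blast

lemma isol_eqtp:
  "isol B x \<Longrightarrow> eqtp B x y \<Longrightarrow> isol B y"
  unfolding isol_def by (metis eqtp_def eqtp_sym eqtp_trans)

text \<open>The image type is isolated by the formula saying that some solution of the formula
  isolating \<open>x\<close> is sent to \<open>y\<close> by \<open>g\<close>.\<close>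

lemma isol_sel:
  assumes "isol B x" "sel B (length x) k g" "B \<subseteq> univ U" "set x \<subseteq> univ U"
  shows "isol B (g x)"
proof -
  let ?n = "length x"
  obtain P where P: "def_pred B ?n P" "P x" "\<And>y. y \<in> tup ?n \<Longrightarrow> P y \<Longrightarrow> eqtp B x y"
    using assms(1) by (rule isolE) blast
  have x: "x \<in> tup ?n" using assms by (simp add: tuples_def)
  have l: "length (g x) = k" using sel_tup[OF assms(2,3) x] by (simp add: tuples_def)
  \<comment> \<open>\<open>g\<close> reads its parameters from behind its \<open>?n\<close>
    arguments; with \<open>k\<close> further arguments present, these positions shift by
    \<open>k\<close>.\<close>
  have sel: "sel B (?n + k) k (\<lambda>z. g (take ?n z))"
  proof -
    obtain c "is" where c: "set c \<subseteq> B" "length is = k" "set is \<subseteq> {..<?n + length c}"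
      "\<And>z. z \<in> tup ?n \<Longrightarrow> g z = map ((!) (z @ c)) is" using assms(2) unfolding sel_def by blast
    show ?thesis
    proof (rule selI[of c _ "map (\<lambda>i. if i < ?n then i else i + k) is"])
      fix z assume z: "z \<in> tup (?n + k)"
      have "g (take ?n z) = map ((!) (take ?n z @ c)) is"
        using c(4) tuples_take[OF z] by simp
      also have "\<dots> = map ((!) (z @ c)) (map (\<lambda>i. if i < ?n then i else i + k) is)"
        using c(3) tuples_length[OF z] by (auto simp: nth_append)
      finally show "g (take ?n z) = \<dots>" .
    qed (use c in auto)
  qed
  let ?Q = "\<lambda>y. \<exists>z \<in> tup ?n. P z \<and> g z = y"
  have "def_pred B k ?Q"
    by (rule def_pred_ex[OF assms(3)], intro def_pred_conj def_pred_sel_eq[OF sel _ assms(3)]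
        def_pred_sel[OF P(1) _ assms(3)]) (auto intro!: sel_intros)
  moreover have "?Q (g x)" using x P(2) by blast
  moreover have "eqtp B (g x) y" if "y \<in> tup k" "?Q y" for y
    using that eqtp_sel[OF P(3) assms(2-4)] by (auto simp: tuples_def)
  ultimately show ?thesis unfolding isol_def l by blast
qed

lemma isol_list_of_params: "set x \<subseteq> B \<Longrightarrow> B \<subseteq> univ U \<Longrightarrow> isol B x"
  unfolding isol_def
  by (rule exI[of _ "\<lambda>y. y = x"]) (auto intro!: def_pred_sel_eq sel_id sel_const eqtp_refl)

end


context fo_struct begin

section \<open>Elementary submodels and definable closure\<close>

lemma elementary_submodel_subset: "elementary_submodel L U M \<Longrightarrow> M \<subseteq> univ U"
  by (simp add: elementary_submodel_def)

text \<open>One half of the Tarski-Vaught criterion. It is the source of all later arguments that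
  replace a solution in the monster model by one in \<open>M\<close>.\<close>

lemma elementary_witness1:
  assumes M: "elementary_submodel L U M" and P: "def_pred M (Suc 0) P" "a \<in> univ U" "P [a]"
  shows "\<exists>a \<in> M. P [a]"
proof -
  obtain \<phi> c where c: "set c \<subseteq> M" "wf_form L (Suc 0 + length c) \<phi>"
    "\<And>x. x \<in> tup (Suc 0) \<Longrightarrow> P x \<longleftrightarrow> sat U \<phi> (x @ c)" using P(1) by (rule def_predE) auto
  have "sat U (Ex \<phi>) c" using c(3)[of "[a]"] P by (auto simp: tuples_def)
  moreover have "wf_form L (length c) (Ex \<phi>)" "c \<in> tuples M (length c)"
    using c by (auto simp: tuples_def)
  ultimately have "sat (U\<lparr>univ := M\<rparr>) (Ex \<phi>) c"
    using M unfolding elementary_submodel_def by blast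
  then obtain b where b: "b \<in> M" "sat (U\<lparr>univ := M\<rparr>) \<phi> (b # c)" by auto
  have "b # c \<in> tuples M (Suc 0 + length c)" using b c by (auto simp: tuples_def)
  then have "sat U \<phi> (b # c)" using b M c(2) unfolding elementary_submodel_def by blast
  moreover have "b \<in> univ U" using b elementary_submodel_subset[OF M] by blast
  ultimately show ?thesis using b c(3)[of "[b]"] by (auto simp: tuples_def)
qed

text \<open>The coordinates are chosen one at a time, each earlier choice becoming a parameter from
  \<open>M\<close>.\<close>

lemma elementary_witness:
  assumes M: "elementary_submodel L U M" and P: "def_pred M n P" "x \<in> tup n" "P x"
  shows "\<exists>y \<in> tuples M n. P y"
  using P
proof (induction n arbitrary: P x)
  case 0
  then show ?case by (auto simp: tuples_def)
next
  case (Suc n)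
  have MU: "M \<subseteq> univ U" using M by (rule elementary_submodel_subset)
  have "def_pred M (n + Suc 0) (\<lambda>z. P (drop n z @ take n z))"
    by (rule def_pred_sel[OF Suc.prems(1) sel_append[OF sel_suffix sel_prefix] MU]) auto
  then have "def_pred M (Suc 0) (\<lambda>z. \<exists>y \<in> tup n. P (z @ y))"
    by (rule def_pred_ex[OF MU])
  moreover have "\<exists>y \<in> tup n. P ([hd x] @ y)" "hd x \<in> univ U"
    using Suc.prems(2,3) by (cases x; auto simp: tuples_def)+
  ultimately obtain a where a: "a \<in> M" "\<exists>y \<in> tup n. P ([a] @ y)"
    using elementary_witness1[OF M, of "\<lambda>z. \<exists>y \<in> tup n. P (z @ y)"] by blast
  have "def_pred M n (\<lambda>y. P ([a] @ y))"
    using a by (intro def_pred_sel[OF Suc.prems(1) sel_append[OF sel_const sel_id] MU]) auto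
  then obtain y where "y \<in> tuples M n" "P ([a] @ y)" using Suc.IH a(2) by blast
  then show ?case using a(1) by (intro bexI[of _ "a # y"]) (auto simp: tuples_def)
qed

text \<open>The Tarski-Vaught test. Closure under function symbols is not a separate hypothesis: it
  is the witness condition for the formula \<open>y = f(x)\<close>.\<close>

lemma elementary_submodelI:
  assumes MU: "M \<subseteq> univ U"
    and wit: "\<And>P a. def_pred M (Suc 0) P \<Longrightarrow> a \<in> univ U \<Longrightarrow> P [a] \<Longrightarrow> \<exists>b \<in> M. P [b]"
  shows "elementary_submodel L U M"
proof -
  have trm: "trm_val (U\<lparr>univ := M\<rparr>) e t = trm_val U e t" for e t
    by (induction t) (auto cong: map_cong)
  have "M \<noteq> {}" using wit[OF def_pred_True] struct by (auto simp: is_struct_def)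
  moreover have "fun_int U f x \<in> M" if f: "(f, n) \<in> funs L" and x: "x \<in> tuples M n" for f n x
  proof -
    have U: "fun_int U f x \<in> univ U"
      using struct f tuples_mono[OF MU x] unfolding is_struct_def by blast
    have *: "map (\<lambda>i. (y @ x) ! i) [Suc 0..<Suc n] = x" if "length y = Suc 0" for y
      using that tuples_length[OF x]
      by (intro nth_equalityI) (auto simp: nth_append simp del: upt_Suc)
    have "def_pred M (Suc 0) (\<lambda>y. y = [fun_int U f x])"
      by (rule def_predI[of x _ _ "Eq (Var 0) (Fn f (map Var [Suc 0..<Suc n]))"])
         (use x f * in \<open>auto simp: tuples_def list_all_iff o_def length_Suc_conv nth_append
           simp del: upt_Suc\<close>)
    from wit[OF this U] show ?thesis by auto
  qed
  ultimately have "is_struct L (U\<lparr>univ := M\<rparr>)" unfolding is_struct_def by auto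
  moreover have "sat (U\<lparr>univ := M\<rparr>) \<phi> x \<longleftrightarrow> sat U \<phi> x"
    if "wf_form L n \<phi>" "x \<in> tuples M n" for n \<phi> x
    using that
  proof (induction \<phi> arbitrary: n x)
    case (Ex \<phi>)
    have IH: "sat (U\<lparr>univ := M\<rparr>) \<phi> (a # x) \<longleftrightarrow> sat U \<phi> (a # x)" if "a \<in> M" for a
      using Ex that by (intro Ex.IH[of "Suc n"]) (auto simp: tuples_def)
    have "def_pred M (Suc 0) (\<lambda>y. sat U \<phi> (y @ x))"
      by (rule def_predI[of x]) (use Ex.prems in \<open>auto simp: tuples_def\<close>)
    from wit[OF this] have "(\<exists>a \<in> univ U. sat U \<phi> (a # x)) \<longleftrightarrow> (\<exists>a \<in> M. sat U \<phi> (a # x))"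
      using MU by auto
    then show ?case using IH by simp
  qed (auto simp: trm cong: map_cong)
  ultimately show ?thesis using MU unfolding elementary_submodel_def by blast
qed

section \<open>Definable closure\<close>

lemma dcl_iff: "a \<in> dcl L U B \<longleftrightarrow> a \<in> univ U \<and> def_pred B (Suc 0) (\<lambda>x. x = [a])"
  unfolding dcl_def by (auto simp: definable_iff_def_pred tuples_def)

lemma dcl_subset_univ: "dcl L U B \<subseteq> univ U"
  by (auto simp: dcl_iff)

lemma dcl_mono: "B \<subseteq> C \<Longrightarrow> dcl L U B \<subseteq> dcl L U C"
  using def_pred_mono by (auto simp: dcl_iff)

lemma subset_dcl: "B \<subseteq> univ U \<Longrightarrow> B \<subseteq> dcl L U B"
  by (auto simp: dcl_iff intro!: def_pred_sel_eq sel_const sel_id[of _ "Suc 0"])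

text \<open>\<open>dcl\<close> is defined for single elements; each coordinate of a definable tuple
  is the projection of the unique solution of its formula.\<close>

lemma dcl_tupleI:
  assumes "B \<subseteq> univ U" "x \<in> tup n" "def_pred B n P" "P x"
    "\<And>y. y \<in> tup n \<Longrightarrow> P y \<Longrightarrow> y = x"
  shows "set x \<subseteq> dcl L U B"
proof
  fix a assume "a \<in> set x"
  then obtain i where i: "i < n" "a = x ! i" using assms(2) by (auto simp: tuples_def in_set_conv_nth)
  have "def_pred B (Suc 0) (\<lambda>z. \<exists>y \<in> tup n. P y \<and> [y ! i] = z)"
  proof (rule def_pred_ex[OF assms(1)], rule def_pred_conj)
    show "def_pred B (n + Suc 0) (\<lambda>z. P (take n z))"
      by (rule def_pred_sel[OF assms(3) sel_prefix assms(1)]) simp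
    have "sel B (n + Suc 0) n (take n)" by (rule sel_prefix) simp
    from sel_nth[OF this i(1)] sel_suffix[of B "n + Suc 0" n]
    show "def_pred B (n + Suc 0) (\<lambda>z. [take n z ! i] = drop n z)"
      by (intro def_pred_sel_eq[OF _ _ assms(1)]) auto
  qed
  then have "def_pred B (Suc 0) (\<lambda>z. z = [a])"
    by (rule def_pred_cong) (use assms(2,4) i in \<open>auto dest: assms(5)\<close>)
  then show "a \<in> dcl L U B" using i assms(2) by (auto simp: dcl_iff tuples_def)
qed

lemma dcl_tupleD:
  assumes "B \<subseteq> univ U" "set c \<subseteq> dcl L U B"
  shows "def_pred B (length c) (\<lambda>y. y = c)"
proof -
  have "def_pred B (length c) (\<lambda>y. [y ! i] = [c ! i])" if "i < length c" for i
  proof -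
    have "c ! i \<in> dcl L U B" using assms(2) that by auto
    then have "def_pred B 1 (\<lambda>x. x = [c ! i])" by (simp add: dcl_iff)
    from def_pred_sel[OF this sel_nth[OF sel_id that] assms(1)] show ?thesis .
  qed
  then have "def_pred B (length c) (\<lambda>y. \<forall>i \<in> {..<length c}. [y ! i] = [c ! i])"
    by (intro def_pred_finite_all) auto
  then show ?thesis
    by (rule def_pred_cong) (auto simp: tuples_def list_eq_iff_nth_eq)
qed

text \<open>Parameters from the closure are quantified away: the tuple \<open>c\<close> of them is
  the only solution of a formula over \<open>B\<close>.\<close>

lemma def_pred_dcl:
  assumes "B \<subseteq> univ U" "def_pred (dcl L U B) n P"
  shows "def_pred B n P"
proof -
  have "def_pred ({} \<union> dcl L U B) n P" using assms by simp
  then obtain Q c where c: "set c \<subseteq> dcl L U B" "def_pred {} (n + length c) Q"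
    "\<And>x. x \<in> tup n \<Longrightarrow> P x \<longleftrightarrow> Q (x @ c)"
    by (rule def_pred_split_params) auto
  let ?m = "length c"
  have "def_pred B n (\<lambda>x. \<exists>y \<in> tup ?m. y = c \<and> Q (x @ y))"
  proof (rule def_pred_ex[OF assms(1)], rule def_pred_conj)
    show "def_pred B (?m + n) (\<lambda>z. take ?m z = c)"
      by (rule def_pred_sel[OF dcl_tupleD[OF assms(1) c(1)] sel_prefix assms(1)]) simp
    show "def_pred B (?m + n) (\<lambda>z. Q (drop ?m z @ take ?m z))"
      by (rule def_pred_sel[OF def_pred_mono[OF c(2)] sel_append[OF sel_suffix sel_prefix] assms(1)])
         auto
  qed
  then show ?thesis
    by (rule def_pred_cong) (use c dcl_subset_univ[of B] in \<open>auto simp: tuples_def\<close>)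
qed

lemma dcl_dcl: "B \<subseteq> univ U \<Longrightarrow> dcl L U (dcl L U B) = dcl L U B"
  using def_pred_dcl def_pred_mono[OF _ subset_dcl] by (auto simp: dcl_iff)

lemma dcl_finite:
  assumes "a \<in> dcl L U (B \<union> C)" "B \<subseteq> univ U" "C \<subseteq> univ U"
  obtains c where "set c \<subseteq> C" "a \<in> dcl L U (B \<union> set c)"
proof -
  have a: "a \<in> univ U" "def_pred (B \<union> C) (Suc 0) (\<lambda>x. x = [a])"
    using assms(1) by (auto simp: dcl_iff)
  obtain Q c where c: "set c \<subseteq> C" "def_pred B (Suc 0 + length c) Q"
    "\<And>x. x \<in> tup (Suc 0) \<Longrightarrow> x = [a] \<longleftrightarrow> Q (x @ c)"
    by (rule def_pred_split_params[OF a(2) assms(2)]) blast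
  have "def_pred (B \<union> set c) (Suc 0) (\<lambda>x. Q (x @ c))"
    using assms c by (intro def_pred_fix_params[OF c(2)]) auto
  then have "def_pred (B \<union> set c) (Suc 0) (\<lambda>x. x = [a])"
    by (rule def_pred_cong) (use c in auto)
  then show ?thesis using that c a by (auto simp: dcl_iff)
qed

lemma dcl_elementary: "elementary_submodel L U M \<Longrightarrow> dcl L U M = M"
  using elementary_witness1[of M "\<lambda>x. x = [_]"] subset_dcl[of M] elementary_submodel_subset[of M]
  by (fastforce simp: dcl_iff)

text \<open>The type of \<open>u @ c\<close> determines how \<open>u\<close> is defined from \<open>c\<close>, and hence the type of
  \<open>u @ c @ e\<close> relative to that of \<open>c @ e\<close>.\<close>

lemma eqtp_dcl_append:
  assumes B: "B \<subseteq> univ U" and u: "set u \<subseteq> dcl L U (B \<union> set c)"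
    and 1: "eqtp B (u @ c) (u' @ c')" and 2: "eqtp B (c @ e) (c' @ e')"
    and len: "length c = length c'"
    and U: "set (c @ e) \<subseteq> univ U" "set (u' @ c' @ e') \<subseteq> univ U"
  shows "eqtp B (u @ c @ e) (u' @ c' @ e')"
proof (rule eqtpI)
  let ?k = "length u" and ?n = "length c" and ?m = "length e"
  have len': "length u' = ?k" "length e' = ?m"
    using eqtp_length[OF 1] eqtp_length[OF 2] len by auto
  then show "length (u @ c @ e) = length (u' @ c' @ e')" using len by simp
  have uU: "set u \<subseteq> univ U" using u dcl_subset_univ by blast
  fix P assume P: "def_pred B (length (u @ c @ e)) P" "P (u @ c @ e)"
  have "def_pred (B \<union> set c) ?k (\<lambda>y. y = u)"
    using U B by (intro dcl_tupleD[OF _ u]) auto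
  then obtain Q where Q: "def_pred B (?k + ?n) Q" "\<And>y. y \<in> tup ?k \<Longrightarrow> y = u \<longleftrightarrow> Q (y @ c)"
    using U B by (elim def_pred_split_list) auto
  have "Q (u @ c)" using Q(2)[of u] uU by (simp add: tuples_def)
  then have Q': "Q (u' @ c')" using eqtpD[OF 1, of Q] Q(1) by simp
  \<comment> \<open>Since \<open>u\<close> is the only solution of \<open>Q\<close> over
    \<open>c\<close>, the property \<open>P (u @ c @ e)\<close> follows from, and amounts to, a
    universal statement about \<open>c @ e\<close> alone, which the type of \<open>c @ e\<close>
    carries over.\<close>
  let ?R = "\<lambda>z. \<forall>y \<in> tup ?k. Q (y @ take ?n z) \<longrightarrow> P (y @ z)"
  have "def_pred B (?n + ?m) ?R"
  proof (rule def_pred_all[OF B], rule def_pred_imp)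
    show "def_pred B (?k + (?n + ?m)) (\<lambda>z. Q (take ?k z @ take ?n (drop ?k z)))"
      by (rule def_pred_sel[OF Q(1) sel_append[OF sel_prefix sel_slice] B]) auto
    show "def_pred B (?k + (?n + ?m)) (\<lambda>z. P (take ?k z @ drop ?k z))"
      using P(1) by (simp add: add.assoc)
  qed
  moreover have "?R (c @ e)" using Q(2) P(2) by auto
  ultimately have "?R (c' @ e')" using eqtpD[OF 2, of ?R] by simp
  then show "P (u' @ c' @ e')" using Q' len len' U by (simp add: tuples_def)
qed

end


context fo_struct begin

section \<open>Isolated types and atomic models\<close>

lemma eqtp_sublist:
  assumes "eqtp B x y" "length x = length y" "\<And>i. i \<in> set is \<Longrightarrow> i < length x" "B \<subseteq> univ U"
    "set x \<subseteq> univ U" "set y \<subseteq> univ U"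
  shows "eqtp B (map ((!) x) is) (map ((!) y) is)"
  using assms by (intro eqtp_sel[of B x y "length is" "\<lambda>z. map ((!) z) is"] sel_pick) auto

lemma sublist_indices:
  assumes "set x \<subseteq> set y"
  obtains "is" where "x = map ((!) y) is" "\<And>i. i \<in> set is \<Longrightarrow> i < length y"
proof -
  have "\<exists>i < length y. y ! i = a" if "a \<in> set x" for a
    using that assms by (auto simp: subset_iff in_set_conv_nth)
  then obtain f where f: "\<And>a. a \<in> set x \<Longrightarrow> f a < length y \<and> y ! f a = a" by metis
  show ?thesis
    by (rule that[of "map f x"]) (use f in \<open>auto intro!: map_idI[symmetric]\<close>)
qed

lemma isol_sublist:
  assumes "isol B y" "set x \<subseteq> set y" "B \<subseteq> univ U" "set y \<subseteq> univ U"
  shows "isol B x"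
proof -
  obtain "is" where "x = map ((!) y) is" "\<And>i. i \<in> set is \<Longrightarrow> i < length y"
    using sublist_indices[OF assms(2)] by blast
  then show ?thesis
    using isol_sel[OF assms(1) sel_pick[of "is" "length y" _ B] assms(3,4)] by auto
qed

text \<open>The isolating formula has finitely many parameters, and it still isolates over any base
  between these and \<open>C\<close>. The freedom to enlarge \<open>c\<close> is used in
  \<open>atomic_insert\<close>.\<close>

lemma isol_finite_base:
  assumes "isol (B \<union> C) x" "B \<subseteq> univ U" "C \<subseteq> univ U" "set x \<subseteq> univ U"
  obtains c where "set c \<subseteq> C" "\<And>c'. set c \<subseteq> set c' \<Longrightarrow> set c' \<subseteq> C \<Longrightarrow> isol (B \<union> set c') x"
proof -
  obtain P where P: "def_pred (B \<union> C) (length x) P" "P x"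
    "\<And>y. y \<in> tup (length x) \<Longrightarrow> P y \<Longrightarrow> eqtp (B \<union> C) x y" using assms(1) by (rule isolE) blast
  obtain Q c where c: "set c \<subseteq> C" "def_pred B (length x + length c) Q"
    "\<And>y. y \<in> tup (length x) \<Longrightarrow> P y \<longleftrightarrow> Q (y @ c)"
    by (rule def_pred_split_params[OF P(1) assms(2)]) blast
  show ?thesis
  proof (rule that[OF c(1)])
    fix c' assume c': "set c \<subseteq> set c'" "set c' \<subseteq> C"
    have "def_pred (B \<union> set c') (length x) (\<lambda>y. Q (y @ c))"
      using assms c c' by (intro def_pred_fix_params[OF c(2)]) auto
    moreover have "Q (x @ c)" using c(3)[of x] P(2) assms(4) by (auto simp: tuples_def)
    moreover have "eqtp (B \<union> set c') x y" if "y \<in> tup (length x)" "Q (y @ c)" for y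
      using eqtp_mono[OF P(3)[OF that(1)], of "B \<union> set c'"] c(3)[OF that(1)] that(2) c'(2) by auto
    ultimately show "isol (B \<union> set c') x" unfolding isol_def by blast
  qed
qed

text \<open>Transitivity of isolation. The conjunction of the two isolating formulas works: for a
  solution \<open>y1 @ y2\<close>, the part \<open>y2\<close> has the type of \<open>c\<close>, and
  it is a property of \<open>c\<close> alone that the first formula implies any given formula true
  of \<open>x @ c\<close>.\<close>

lemma isol_append:
  assumes x: "isol (B \<union> set c) x" and c: "isol B c"
    and U: "B \<subseteq> univ U" "set c \<subseteq> univ U" "set x \<subseteq> univ U"
  shows "isol B (x @ c)"
proof -
  let ?n = "length x" and ?m = "length c"
  obtain P where P: "def_pred (B \<union> set c) ?n P" "P x"
    "\<And>y. y \<in> tup ?n \<Longrightarrow> P y \<Longrightarrow> eqtp (B \<union> set c) x y" using x by (rule isolE) blast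
  obtain P' where P': "def_pred B (?n + ?m) P'" "\<And>y. y \<in> tup ?n \<Longrightarrow> P y \<longleftrightarrow> P' (y @ c)"
    by (rule def_pred_split_list[OF P(1) U(1,2)]) blast
  obtain Q where Q: "def_pred B ?m Q" "Q c" "\<And>z. z \<in> tup ?m \<Longrightarrow> Q z \<Longrightarrow> eqtp B c z"
    using c by (rule isolE) blast
  let ?R = "\<lambda>z. P' z \<and> Q (drop ?n z)"
  have "def_pred B (length (x @ c)) ?R"
    using P'(1) by (auto intro!: def_pred_sel[OF Q(1) sel_suffix[of _ "?n + ?m" ?n, simplified] U(1)])
  moreover have "?R (x @ c)" using P'(2)[of x] P(2) Q(2) U by (auto simp: tuples_def)
  moreover have "eqtp B (x @ c) y" if y: "y \<in> tup (length (x @ c))" "?R y" for y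
  proof -
    from y(1) obtain y1 y2 where y12: "y = y1 @ y2" "y1 \<in> tup ?n" "y2 \<in> tup ?m"
      using tuples_append_split[of y "univ U" ?n ?m] by auto
    have R: "P' (y1 @ y2)" "Q y2" using y(2) y12 by (auto simp: tuples_def)
    have eq: "eqtp B c y2" using Q(3) R y12 by blast
    show ?thesis
    proof (rule eqtpI)
      show "length (x @ c) = length y" using y by (auto simp: tuples_def)
      fix S assume S: "def_pred B (length (x @ c)) S" "S (x @ c)"
      let ?T = "\<lambda>z. \<forall>u \<in> tup ?n. P' (u @ z) \<longrightarrow> S (u @ z)"
      have "def_pred B ?m ?T"
        using P'(1) S(1) by (intro def_pred_all[OF U(1)] def_pred_imp) auto
      moreover have "?T c"
      proof (intro ballI impI)
        fix u assume u: "u \<in> tup ?n" "P' (u @ c)"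
        then have "eqtp (B \<union> set c) x u" using P P' by blast
        then have "eqtp B (x @ c) (u @ c)" using U by (intro eqtp_append_params[of "B \<union> set c"]) auto
        from eqtpD[OF this S(1)] S(2) show "S (u @ c)" by simp
      qed
      ultimately have "?T y2" using eqtpD[OF eq, of ?T] by simp
      then show "S y" using R y12 by blast
    qed
  qed
  ultimately show ?thesis unfolding isol_def by blast
qed

text \<open>Otherwise every nonempty \<open>C\<close>-definable subset of \<open>P\<close> contains
  a point of non-isolated type and hence splits into two such subsets; iterating produces the
  forbidden binary tree.\<close>

lemma isol_dense:
  assumes tt: "totally_transcendental L U" and C: "C \<subseteq> univ U"
    and P: "def_pred C n P" "x \<in> tup n" "P x"
  shows "\<exists>y \<in> tup n. P y \<and> isol C y"
proof (rule ccontr)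
  assume no: "\<not> ?thesis"
  define good where "good Y \<longleftrightarrow> Y \<subseteq> tup n \<and> def_pred C n (\<lambda>x. x \<in> Y) \<and> Y \<noteq> {} \<and> (\<forall>x \<in> Y. P x)"
    for Y
  have split: "\<exists>Y1 Y2. good Y1 \<and> good Y2 \<and> Y1 \<subseteq> Y \<and> Y2 \<subseteq> Y \<and> Y1 \<inter> Y2 = {}" if Y: "good Y" for Y
  proof -
    obtain y where y: "y \<in> Y" using Y by (auto simp: good_def)
    then have yn: "y \<in> tup n" "P y" using Y by (auto simp: good_def)
    then have "\<not> isol C y" using no by blast
    moreover have "length y = n" "def_pred C n (\<lambda>x. x \<in> Y)"
      using yn Y by (auto simp: good_def tuples_length)
    ultimately obtain z where z: "z \<in> tup n" "z \<in> Y" "\<not> eqtp C y z"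
      using y unfolding isol_def by blast
    then obtain R where R: "def_pred C n R" "R y" "\<not> R z"
      using eqtpI[of y z C] yn by (auto simp: tuples_def)
    have "good {u \<in> Y. S u}" if "def_pred C n S" "\<exists>u \<in> Y. S u" for S
      using Y that unfolding good_def mem_Collect_eq by (intro conjI def_pred_conj) auto
    from this[of R] this[of "\<lambda>u. \<not> R u"]
    have "good {u \<in> Y. R u}" "good {u \<in> Y. \<not> R u}"
      using R y z(2) by blast+
    then show ?thesis by blast
  qed
  then obtain f g where fg: "\<And>Y. good Y \<Longrightarrow> good (f Y) \<and> good (g Y) \<and> f Y \<subseteq> Y \<and> g Y \<subseteq> Y \<and>
    f Y \<inter> g Y = {}" by metis
  define D where "D s = foldl (\<lambda>Y b. if b then f Y else g Y) {x \<in> tup n. P x} s" for s :: "bool list"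
  have good0: "good {x \<in> tup n. P x}"
    using P def_pred_cong[OF P(1), of "\<lambda>x. x \<in> {x \<in> tup n. P x}"] by (auto simp: good_def)
  have good: "good (D s)" for s
    by (induction s rule: rev_induct) (use good0 fg in \<open>auto simp: D_def\<close>)
  have "definable L U (univ U) n (D s) \<and> D s \<noteq> {} \<and> D (s @ [False]) \<subseteq> D s \<and> D (s @ [True]) \<subseteq> D s \<and>
    D (s @ [False]) \<inter> D (s @ [True]) = {}" for s
  proof -
    have "definable L U (univ U) n (D s)" "D s \<noteq> {}"
      using good[of s] def_pred_mono[OF _ C] by (auto simp: good_def definable_iff_def_pred)
    moreover have "D (s @ [False]) = g (D s)" "D (s @ [True]) = f (D s)" by (simp_all add: D_def)
    ultimately show ?thesis using fg[OF good[of s]] by blast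
  qed
  then show False using tt unfolding totally_transcendental_def by blast
qed

text \<open>\<open>C\<close> may be any set, not only a model, so that the notion can be carried
  along the maximality argument in \<open>atomic_model_exists\<close>.\<close>

definition atomic :: "'m set \<Rightarrow> 'm set \<Rightarrow> bool" where
  "atomic B C \<longleftrightarrow> (\<forall>x. set x \<subseteq> C \<longrightarrow> isol B x)"

lemma atomicD: "atomic B C \<Longrightarrow> set x \<subseteq> C \<Longrightarrow> isol B x"
  by (simp add: atomic_def)

lemma atomic_insert:
  assumes C: "atomic B C" and e: "isol C [e]" and U: "B \<subseteq> C" "C \<subseteq> univ U" "e \<in> univ U"
  shows "atomic B (insert e C)"
  unfolding atomic_def
proof (intro allI impI)
  fix x assume x: "set x \<subseteq> insert e C"
  have BC: "B \<union> C = C" and BU: "B \<subseteq> univ U" using U by auto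
  have "isol (B \<union> C) [e]" "set [e] \<subseteq> univ U" using e U(3) by (simp_all add: BC)
  then obtain c where c: "set c \<subseteq> C"
    "\<And>c'. set c \<subseteq> set c' \<Longrightarrow> set c' \<subseteq> C \<Longrightarrow> isol (B \<union> set c') [e]"
    by (rule isol_finite_base[OF _ BU U(2)]) blast
  \<comment> \<open>With the other entries of \<open>x\<close> added to the base of
    \<open>e\<close>, all entries of \<open>x\<close> occur in \<open>[e] @ ?c\<close>, whose type
    is isolated by transitivity.\<close>
  let ?c = "c @ filter (\<lambda>a. a \<noteq> e) x"
  have sub: "set ?c \<subseteq> C" using c(1) x by auto
  have "isol B ([e] @ ?c)"
    using U sub by (intro isol_append c(2) atomicD[OF C]) auto
  then show "isol B x"
    by (rule isol_sublist) (use x U sub in auto)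
qed

text \<open>A maximal atomic set passes the Tarski-Vaught test: a consistent formula over it has a
  solution of isolated type, and adjoining this solution keeps the set atomic.\<close>

lemma atomic_model_exists:
  assumes tt: "totally_transcendental L U" and B: "B \<subseteq> univ U"
  shows "\<exists>C. elementary_submodel L U C \<and> B \<subseteq> C \<and> atomic B C"
proof -
  let ?S = "{C. B \<subseteq> C \<and> C \<subseteq> univ U \<and> atomic B C}"
  have "\<exists>C \<in> ?S. \<forall>D \<in> ?S. C \<subseteq> D \<longrightarrow> D = C"
  proof (rule subset_Zorn_nonempty)
    show "?S \<noteq> {}" using B isol_list_of_params[of _ B] by (auto simp: atomic_def)
    fix \<C> assume ch: "\<C> \<noteq> {}" "subset.chain ?S \<C>"
    have "isol B x" if x: "set x \<subseteq> \<Union>\<C>" for x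
    proof -
      obtain C where "C \<in> \<C>" "set x \<subseteq> C"
        using finite_subset_Union_chain[OF finite_set x ch] by blast
      then show ?thesis using ch(2) by (auto simp: subset.chain_def dest: atomicD)
    qed
    then have "atomic B (\<Union>\<C>)" by (simp add: atomic_def)
    moreover have "B \<subseteq> C \<and> C \<subseteq> univ U" if "C \<in> \<C>" for C
      using that ch(2) by (auto simp: subset.chain_def)
    ultimately show "\<Union>\<C> \<in> ?S" using ch(1) by blast
  qed
  then obtain C where "C \<in> ?S" and max: "\<forall>D \<in> ?S. C \<subseteq> D \<longrightarrow> D = C" by (rule bexE)
  then have C: "B \<subseteq> C" "C \<subseteq> univ U" "atomic B C" by simp_all
  have "elementary_submodel L U C"
  proof (rule elementary_submodelI[OF C(2)])
    fix P a assume P: "def_pred C (Suc 0) P" "a \<in> univ U" "P [a]"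
    have "[a] \<in> tup (Suc 0)" using P(2) by (simp add: tuples_def)
    from isol_dense[OF tt C(2) P(1) this P(3)]
    obtain y where y: "y \<in> tup (Suc 0)" "P y" "isol C y" by blast
    then obtain e where e: "y = [e]" "e \<in> univ U" by (auto simp: tuples_def length_Suc_conv)
    have "insert e C \<in> ?S" using atomic_insert[OF C(3)] y e C(1,2) by auto
    then have "e \<in> C" using max by blast
    then show "\<exists>b \<in> C. P [b]" using y e by blast
  qed
  then show ?thesis using C by blast
qed

lemma elementary_map_eqtp:
  assumes "elementary_map L U B f" "set x \<subseteq> B" "B \<subseteq> univ U" "C \<subseteq> B" "\<And>a. a \<in> C \<Longrightarrow> f a = a"
  shows "eqtp C x (map f x)"
proof (rule eqtpI)
  fix P assume P: "def_pred C (length x) P" "P x"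
  obtain \<phi> c where c: "set c \<subseteq> C" "wf_form L (length x + length c) \<phi>"
    "\<And>z. z \<in> tup (length x) \<Longrightarrow> P z \<longleftrightarrow> sat U \<phi> (z @ c)" using P(1) by (rule def_predE) auto
  have "map f c = c" using c(1) assms(5) by (auto intro: map_idI)
  moreover have "x @ c \<in> tuples B (length x + length c)"
    using c(1) assms by (auto simp: tuples_def)
  ultimately have "sat U \<phi> (x @ c) \<longleftrightarrow> sat U \<phi> (map f x @ c)"
    using assms(1) c(2) unfolding elementary_map_def by (metis map_append)
  moreover have "x \<in> tup (length x)" "map f x \<in> tup (length x)"
    using assms(1-3) unfolding elementary_map_def by (auto simp: tuples_def)
  ultimately show "P (map f x)" using c(3) P(2) by blast
qed simp

text \<open>The prime model embeds over \<open>B\<close> into an atomic model, and a tuple has the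
  same type over \<open>B\<close> as its image.\<close>

lemma prime_model_atomic:
  assumes tt: "totally_transcendental L U" and M: "prime_model_over L U B M"
  shows "atomic B M"
  unfolding atomic_def
proof (intro allI impI)
  fix x assume x: "set x \<subseteq> M"
  have MU: "M \<subseteq> univ U" "B \<subseteq> M"
    using M elementary_submodel_subset by (auto simp: prime_model_over_def)
  then have BU: "B \<subseteq> univ U" by blast
  obtain C where C: "elementary_submodel L U C" "B \<subseteq> C" "atomic B C"
    using atomic_model_exists[OF tt BU] by blast
  then obtain f where f: "elementary_map L U M f" "f ` M \<subseteq> C" "\<forall>a \<in> B. f a = a"
    using M unfolding prime_model_over_def by blast
  have "eqtp B x (map f x)" using elementary_map_eqtp[OF f(1) x] MU f(3) by blast
  moreover have "isol B (map f x)" using f(2) x by (intro atomicD[OF C(3)]) auto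
  ultimately show "isol B x" using isol_eqtp eqtp_sym by blast
qed

lemma elementary_map_inj_on:
  assumes "elementary_map L U B f"
  shows "inj_on f B"
proof (rule inj_onI)
  fix a b assume ab: "a \<in> B" "b \<in> B" "f a = f b"
  have "wf_form L 2 (Eq (Var 0) (Var 1))" "[a, b] \<in> tuples B 2" using ab by (auto simp: tuples_def)
  then have "sat U (Eq (Var 0) (Var 1)) [a, b] \<longleftrightarrow> sat U (Eq (Var 0) (Var 1)) (map f [a, b])"
    using assms unfolding elementary_map_def by blast
  then show "a = b" using ab(3) by simp
qed

text \<open>The formula isolating \<open>x @ d\<close> over \<open>B\<close> isolates
  \<open>x\<close> once \<open>d\<close> is named. For infinite extensions of the base this fails in
  general; \<open>isol_over_subset\<close> is the substitute.\<close>

lemma atomic_finite_base: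
  assumes "atomic B M" "set d \<subseteq> M" "B \<subseteq> univ U" "M \<subseteq> univ U"
  shows "atomic (B \<union> set d) M"
  unfolding atomic_def
proof (intro allI impI)
  fix x assume x: "set x \<subseteq> M"
  let ?n = "length x" and ?m = "length d"
  have "isol B (x @ d)" using assms x by (intro atomicD[OF assms(1)]) auto
  then obtain P where P: "def_pred B (?n + ?m) P" "P (x @ d)"
    "\<And>y. y \<in> tup (?n + ?m) \<Longrightarrow> P y \<Longrightarrow> eqtp B (x @ d) y" by (rule isolE) auto
  have "def_pred (B \<union> set d) ?n (\<lambda>y. P (y @ d))"
    using assms by (intro def_pred_fix_params[OF P(1)]) auto
  moreover have "eqtp (B \<union> set d) x y" if "y \<in> tup ?n" "P (y @ d)" for y
    using that assms x by (intro eqtp_params P(3)) (auto simp: tuples_def)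
  ultimately show "isol (B \<union> set d) x" using P(2) unfolding isol_def by blast
qed

text \<open>Inclusion and disjointness of the nodes need only be checked on points of
  \<open>M\<close>: a failure elsewhere would be a solution of a formula over \<open>M\<close>,
  which then has a solution in \<open>M\<close>.\<close>

lemma no_tree_in_elementary_submodel:
  assumes tt: "totally_transcendental L U" and M: "elementary_submodel L U M"
    and P: "\<And>s :: bool list. def_pred M n (P s)"
    and ne: "\<And>s. \<exists>x \<in> tuples M n. P s x"
    and sub: "\<And>s b x. x \<in> tuples M n \<Longrightarrow> P (s @ [b]) x \<Longrightarrow> P s x"
    and disj: "\<And>s x. x \<in> tuples M n \<Longrightarrow> P (s @ [False]) x \<Longrightarrow> \<not> P (s @ [True]) x"
  shows False
proof -
  define D where "D s = {x \<in> tup n. P s x}" for s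
  have MU: "M \<subseteq> univ U" using M by (rule elementary_submodel_subset)
  have 1: "definable L U (univ U) n (D s)" for s
    using def_pred_cong[OF def_pred_mono[OF P[of s] MU], of "\<lambda>x. x \<in> D s"]
    by (auto simp: definable_iff_def_pred D_def)
  have 2: "D s \<noteq> {}" for s using ne[of s] tuples_mono[OF MU] unfolding D_def by blast
  have 3: "D (s @ [b]) \<subseteq> D s" for s b
  proof (rule ccontr)
    assume "\<not> D (s @ [b]) \<subseteq> D s"
    then obtain x where "x \<in> tup n" "P (s @ [b]) x \<and> \<not> P s x" unfolding D_def by blast
    with elementary_witness[OF M def_pred_conj[OF P def_pred_not[OF P]] this] sub
    show False by blast
  qed
  have 4: "D (s @ [False]) \<inter> D (s @ [True]) = {}" for s
  proof (rule ccontr)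
    assume "\<not> ?thesis"
    then obtain x where "x \<in> tup n" "P (s @ [False]) x \<and> P (s @ [True]) x" unfolding D_def by blast
    with elementary_witness[OF M def_pred_conj[OF P P] this] disj
    show False by blast
  qed
  show False
    using tt unfolding totally_transcendental_def by (metis 1 2 3 4)
qed

section \<open>The Loewenheim--Skolem theorem\<close>

end

lemma card_of_lists_ordLeq:
  assumes "infinite K" "|B| \<le>o |K|"
  shows "|lists B| \<le>o |K|"
proof -
  have "|{xs \<in> lists B. length xs = n}| \<le>o |K|" for n
  proof (induction n)
    case 0
    have "{xs \<in> lists B. length xs = 0} = {[]}" by auto
    then show ?case
      using assms(1) by (metis card_of_singl_ordLeq finite.emptyI)
  next
    case (Suc n)
    let ?P = "B \<times> {xs \<in> lists B. length xs = n}"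
    have "{xs \<in> lists B. length xs = Suc n} \<subseteq> (\<lambda>(x, xs). x # xs) ` ?P"
      by (force simp: length_Suc_conv)
    then have "|{xs \<in> lists B. length xs = Suc n}| \<le>o |?P|" by (rule surj_imp_ordLeq)
    moreover have "|?P| \<le>o |K|" using assms Suc by (intro card_of_Sigma_ordLeq_infinite) auto
    ultimately show ?case by (rule ordLeq_transitive)
  qed
  then have "|\<Union>n. {xs \<in> lists B. length xs = n}| \<le>o |K|"
    using assms(1) infinite_iff_card_of_nat[of K] by (intro card_of_UNION_ordLeq_infinite) auto
  moreover have "(\<Union>n. {xs \<in> lists B. length xs = n}) = lists B" by auto
  ultimately show ?thesis by simp
qed

lemma infinite_forms: "infinite {\<phi>. \<exists>n. wf_form L n \<phi>}"
proof
  assume "finite {\<phi>. \<exists>n. wf_form L n \<phi>}"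
  moreover have "range (\<lambda>i. Eq (Var i) (Var i)) \<subseteq> {\<phi>. \<exists>n. wf_form L n \<phi>}"
    by (auto intro: exI[of _ "Suc _"])
  ultimately have "finite (range (\<lambda>i. Eq (Var i) (Var i) :: ('a, 'b) form))"
    by (rule finite_subset[rotated])
  moreover have "inj (\<lambda>i. Eq (Var i) (Var i) :: ('a, 'b) form)" by (auto intro: injI)
  ultimately show False using finite_imageD infinite_UNIV_nat by blast
qed

context fo_struct begin

lemma lowenheim_skolem:
  assumes \<kappa>: "Card_order \<kappa>" "small \<kappa> {\<phi>. \<exists>n. wf_form L n \<phi>}" and B: "B \<subseteq> univ U" "small \<kappa> B"
  shows "\<exists>C. elementary_submodel L U C \<and> B \<subseteq> C \<and> small \<kappa> C"
proof -
  define F where "F = {\<phi>. \<exists>n. wf_form L n \<phi>}"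
  \<comment> \<open>\<open>K\<close> is infinite and dominates both the starting set and the set of
    formulas, so it dominates every stage and their countable union.\<close>
  define K where "K = B <+> F"
  have F: "infinite F" "|F| <o \<kappa>" using infinite_forms[of L] \<kappa>(2) by (auto simp: F_def small_def)
  have "infinite (Field \<kappa>)"
  proof
    assume "finite (Field \<kappa>)"
    then show False
      using F \<kappa>(1) card_of_ordLeq_finite ordLess_imp_ordLeq card_of_Field_ordIso
        ordLess_ordIso_trans ordIso_symmetric by metis
  qed
  then have K\<kappa>: "|K| <o \<kappa>"
    using card_of_Plus_ordLess_infinite_Field \<kappa>(1) B(2) F(2) by (auto simp: K_def small_def)
  have K: "infinite K" "|B| \<le>o |K|" "|F| \<le>o |K|"
    using F(1) by (auto simp: K_def card_of_Plus1 card_of_Plus2)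
  define w where "w = (\<lambda>(\<phi>, c). SOME a. a \<in> univ U \<and> sat U \<phi> (a # c))"
  \<comment> \<open>The intersection with the universe discards the arbitrary values of
    \<open>w\<close> at formulas that have no witness.\<close>
  define step where "step D = D \<union> (w ` (F \<times> lists D) \<inter> univ U)" for D
  define H where "H n = (step ^^ n) B" for n
  have H0: "H 0 = B" and HS: "H (Suc n) = step (H n)" for n by (auto simp: H_def)
  have HU: "H n \<subseteq> univ U" for n by (induction n) (use B in \<open>auto simp: H0 HS step_def\<close>)
  have mono: "mono H"
    using lift_Suc_mono_le[of H] by (intro monoI) (auto simp: HS step_def)
  have card: "|H n| \<le>o |K|" for n
  proof (induction n)
    case 0
    then show ?case using K by (simp add: H0)
  next
    case (Suc n)
    have "|F \<times> lists (H n)| \<le>o |K|"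
      using K(1,3) card_of_lists_ordLeq[OF K(1) Suc] by (intro card_of_Sigma_ordLeq_infinite) auto
    then have "|w ` (F \<times> lists (H n))| \<le>o |K|" using card_of_image ordLeq_transitive by blast
    then have "|w ` (F \<times> lists (H n)) \<inter> univ U| \<le>o |K|"
      using card_of_mono1[OF Int_lower1] ordLeq_transitive by blast
    then show ?case unfolding HS step_def
      using K(1) Suc by (intro card_of_Un_ordLeq_infinite_Field) (auto simp: card_of_card_order_on Field_card_of)
  qed
  have "elementary_submodel L U (\<Union>n. H n)"
  proof (rule elementary_submodelI)
    show "(\<Union>n. H n) \<subseteq> univ U" using HU by blast
    fix P a assume P: "def_pred (\<Union>n. H n) (Suc 0) P" "a \<in> univ U" "P [a]"
    obtain \<phi> c where c: "set c \<subseteq> (\<Union>n. H n)" "wf_form L (Suc 0 + length c) \<phi>"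
      "\<And>x. x \<in> tup (Suc 0) \<Longrightarrow> P x \<longleftrightarrow> sat U \<phi> (x @ c)" using P(1) by (rule def_predE) auto
    obtain n where n: "set c \<subseteq> H n"
    proof (rule finite_subset_Union_chain[OF finite_set c(1)])
      have "H m \<subseteq> H n \<or> H n \<subseteq> H m" for m n using linear[of m n] monoD[OF mono] by blast
      then show "subset.chain UNIV (range H)" unfolding subset.chain_def by blast
    qed auto
    have ex: "\<exists>a. a \<in> univ U \<and> sat U \<phi> (a # c)"
      using c(3)[of "[a]"] P(2,3) by (auto simp: tuples_def)
    have "w (\<phi>, c) \<in> univ U" "sat U \<phi> (w (\<phi>, c) # c)"
      using someI_ex[OF ex] by (auto simp: w_def)
    moreover have "w (\<phi>, c) \<in> H (Suc n)"
      using n c(2) \<open>w (\<phi>, c) \<in> univ U\<close> by (auto simp: HS step_def F_def in_lists_conv_set)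
    ultimately show "\<exists>b \<in> (\<Union>n. H n). P [b]"
      using c(3)[of "[w (\<phi>, c)]"] by (auto simp: tuples_def)
  qed
  moreover have "|\<Union>n. H n| \<le>o |K|"
    using K(1) infinite_iff_card_of_nat[of K] card by (intro card_of_UNION_ordLeq_infinite) auto
  then have "small \<kappa> (\<Union>n. H n)" using K\<kappa> ordLeq_ordLess_trans by (auto simp: small_def)
  ultimately show ?thesis using H0 by (intro exI[of _ "\<Union>n. H n"]) auto
qed

lemma small_mono: "small \<kappa> C \<Longrightarrow> B \<subseteq> C \<Longrightarrow> small \<kappa> B"
  unfolding small_def using card_of_mono1 ordLeq_ordLess_trans by blast

text \<open>A prime model embeds into the small model supplied by Loewenheim-Skolem. Smallness is
  what makes saturation of the monster model applicable over subsets of \<open>M\<close>.\<close>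

lemma prime_model_small:
  assumes "monster L T \<kappa> U" "small \<kappa> B" "prime_model_over L U B M"
  shows "small \<kappa> M"
proof -
  have M: "M \<subseteq> univ U" "B \<subseteq> M"
    using assms(3) elementary_submodel_subset by (auto simp: prime_model_over_def)
  then obtain C where C: "elementary_submodel L U C" "B \<subseteq> C" "small \<kappa> C"
    using lowenheim_skolem[of \<kappa> B] assms by (auto simp: monster_def)
  then obtain f where f: "elementary_map L U M f" "f ` M \<subseteq> C"
    using assms(3) unfolding prime_model_over_def by blast
  have "|M| \<le>o |C|" using elementary_map_inj_on[OF f(1)] f(2) card_of_ordLeq by blast
  then show ?thesis using C(3) ordLeq_ordLess_trans by (auto simp: small_def)
qed

end


section \<open>Homogeneity of atomic models\<close>

context fo_struct begin

text \<open>The formula isolating \<open>x @ e\<close>, with \<open>e\<close> quantified away,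
  belongs to the type of \<open>x\<close> and hence holds of \<open>x'\<close>; a witness for it can
  be taken in \<open>M\<close>.\<close>

lemma atomic_extend:
  assumes M: "elementary_submodel L U M" and at: "atomic B M" and B: "B \<subseteq> M"
    and x: "set (x @ e) \<subseteq> M" "set x' \<subseteq> M" "eqtp B x x'"
  obtains e' where "e' \<in> tuples M (length e)" "eqtp B (x @ e) (x' @ e')"
proof -
  let ?n = "length x" and ?m = "length e"
  have MU: "M \<subseteq> univ U" using M by (rule elementary_submodel_subset)
  then have BU: "B \<subseteq> univ U" using B by blast
  obtain P where P: "def_pred B (?n + ?m) P" "P (x @ e)"
    "\<And>y. y \<in> tup (?n + ?m) \<Longrightarrow> P y \<Longrightarrow> eqtp B (x @ e) y"
    using atomicD[OF at x(1)] by (rule isolE) auto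
  have "def_pred B (?m + ?n) (\<lambda>z. P (drop ?m z @ take ?m z))"
    by (rule def_pred_sel[OF P(1) sel_append[OF sel_suffix sel_prefix] BU]) auto
  then have "def_pred B ?n (\<lambda>z. \<exists>y \<in> tup ?m. P (z @ y))"
    by (rule def_pred_ex[OF BU])
  moreover have "\<exists>y \<in> tup ?m. P (x @ y)" using P(2) x MU by (intro bexI[of _ e]) (auto simp: tuples_def)
  ultimately have "\<exists>y \<in> tup ?m. P (x' @ y)" using eqtpD[OF x(3), of "\<lambda>z. \<exists>y \<in> tup ?m. P (z @ y)"] by blast
  then obtain y where y: "y \<in> tup ?m" "P (x' @ y)" by blast
  have len: "length x' = ?n" using eqtp_length[OF x(3)] by simp
  have "def_pred M ?m (\<lambda>y. P (x' @ y))"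
    by (rule def_pred_sel[OF def_pred_mono[OF P(1) B] sel_append[OF sel_const sel_id] MU])
       (use x len in auto)
  from elementary_witness[OF M this y] obtain e' where e': "e' \<in> tuples M ?m" "P (x' @ e')" by blast
  have "x' @ e' \<in> tup (?n + ?m)" using e' x MU len by (auto simp: tuples_def)
  then show ?thesis using that e' P(3) by blast
qed

text \<open>That a formula \<open>Q\<close> defines \<open>w\<close> from \<open>c\<close> is itself
  part of the type of \<open>c @ w\<close>.\<close>

lemma eqtp_dcl_transfer:
  assumes B: "B \<subseteq> univ U" and eq: "eqtp B (c @ w) (c' @ w')" and len: "length c = length c'"
    and w: "set w \<subseteq> dcl L U (B \<union> set c)" and U: "set c \<subseteq> univ U" "set c' \<subseteq> univ U" "set w' \<subseteq> univ U"
  shows "set w' \<subseteq> dcl L U (B \<union> set c')"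
proof -
  let ?n = "length c" and ?m = "length w"
  have wU: "set w \<subseteq> univ U" using w dcl_subset_univ by blast
  have len': "length w' = ?m" using eqtp_length[OF eq] len by simp
  have "def_pred (B \<union> set c) ?m (\<lambda>y. y = w)" using U B by (intro dcl_tupleD[OF _ w]) auto
  then obtain Q where Q: "def_pred B (?m + ?n) Q" "\<And>y. y \<in> tup ?m \<Longrightarrow> y = w \<longleftrightarrow> Q (y @ c)"
    using U B by (elim def_pred_split_list) auto
  let ?S = "\<lambda>z. Q (drop ?n z @ take ?n z) \<and>
    (\<forall>y \<in> tup ?m. Q (y @ take ?n z) \<longrightarrow> y = drop ?n z)"
  have "def_pred B (?n + ?m) ?S"
  proof (intro def_pred_conj def_pred_all[OF B] def_pred_imp)
    show "def_pred B (?n + ?m) (\<lambda>z. Q (drop ?n z @ take ?n z))"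
      by (rule def_pred_sel[OF Q(1) sel_append[OF sel_suffix sel_prefix] B]) auto
    show "def_pred B (?m + (?n + ?m)) (\<lambda>z. Q (take ?m z @ take ?n (drop ?m z)))"
      by (rule def_pred_sel[OF Q(1) sel_append[OF sel_prefix sel_slice] B]) auto
    show "def_pred B (?m + (?n + ?m)) (\<lambda>z. take ?m z = drop ?n (drop ?m z))"
      by (rule def_pred_sel_eq[OF sel_prefix sel_drop[OF sel_suffix] B]) auto
  qed
  moreover have "?S (c @ w)" using Q(2) wU by (auto simp: tuples_def)
  ultimately have "?S (c' @ w')" using eqtpD[OF eq, of ?S] by simp
  then have S': "Q (w' @ c')" "\<And>y. y \<in> tup ?m \<Longrightarrow> Q (y @ c') \<Longrightarrow> y = w'" using len by auto
  have "def_pred (B \<union> set c') ?m (\<lambda>y. Q (y @ c'))"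
    using B U len by (intro def_pred_fix_params[OF Q(1)]) auto
  from dcl_tupleI[OF _ _ this S'(1)] S'(2) B U len' show ?thesis by (simp add: tuples_def)
qed

section \<open>Isolation over subsets of an atomic model\<close>

text \<open>If all conjugates of \<open>c\<close> in \<open>M\<close> are definable over \<open>c\<close>, then having the same type over \<open>B\<close>
  and \<open>e\<close> is, up to moving \<open>e\<close>, a \<open>B\<close>-definable equivalence relation on the conjugates of \<open>c\<close>; a type
  over \<open>D\<close> that is not isolated makes these relations strictly finer infinitely often, and the
  classes form a binary tree.\<close>

lemma isol_over_subset:
  assumes tt: "totally_transcendental L U" and M: "elementary_submodel L U M"
    and at: "atomic B M" and BD: "B \<subseteq> D" "D \<subseteq> M" and c: "c \<in> tuples M n"
    and conj: "\<And>c'. c' \<in> tuples M n \<Longrightarrow> eqtp B c c' \<Longrightarrow> set c' \<subseteq> dcl L U (B \<union> set c)"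
  shows "isol D c"
proof (rule ccontr)
  assume not: "\<not> isol D c"
  have MU: "M \<subseteq> univ U" using M by (rule elementary_submodel_subset)
  have DU: "D \<subseteq> univ U" and BU: "B \<subseteq> univ U" and BM: "B \<subseteq> M" using BD MU by blast+
  have cM: "set c \<subseteq> M" "length c = n" and cU: "set c \<subseteq> univ U"
    using c MU by (auto simp: tuples_def)
  \<comment> \<open>The hypothesis concerns definability over \<open>c\<close> itself; homogeneity
    of \<open>M\<close> moves it to any two conjugates of \<open>c\<close>.\<close>
  have conj': "set w \<subseteq> dcl L U (B \<union> set y)"
    if y: "y \<in> tuples M n" "eqtp B c y" and w: "w \<in> tuples M n" "eqtp B c w" for y w
  proof -
    have "eqtp B y c" using y(2) by (rule eqtp_sym)
    then obtain w' where w': "w' \<in> tuples M (length w)" "eqtp B (y @ w) (c @ w')"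
      using atomic_extend[OF M at BM, of y w c] y(1) w(1) cM by (auto simp: tuples_def)
    have wn: "w' \<in> tuples M n" using w'(1) w(1) by (simp add: tuples_def)
    have "eqtp B (drop n (y @ w)) (drop n (c @ w'))"
      using y w wn cM MU by (intro eqtp_sel[OF w'(2) sel_suffix BU]) (auto simp: tuples_def)
    then have "eqtp B w w'" using y cM by (simp add: tuples_def)
    with w(2) have "eqtp B c w'" by (rule eqtp_trans)
    from conj[OF wn this] have "set w' \<subseteq> dcl L U (B \<union> set c)" .
    from eqtp_dcl_transfer[OF BU eqtp_sym[OF w'(2)] _ this] show ?thesis
      using y w cM MU by (auto simp: tuples_def)
  qed
  \<comment> \<open>The formula isolating \<open>c @ e\<close> over \<open>B\<close> does not
    isolate the type of \<open>c\<close> over \<open>D\<close>, so it has a solution that some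
    further \<open>e'\<close> from \<open>D\<close> tells apart from \<open>c\<close>. One formula
    \<open>S\<close> witnesses the difference, so that the solution may be moved into
    \<open>M\<close>.\<close>
  have step: "\<exists>e' z. set e' \<subseteq> D \<and> z \<in> tuples M n \<and> eqtp B (c @ e) (z @ e) \<and>
      \<not> eqtp B (c @ e @ e') (z @ e @ e')" if e: "set e \<subseteq> D" for e
  proof -
    let ?k = "length e"
    have "isol B (c @ e)" using e cM BD by (intro atomicD[OF at]) auto
    then obtain P where P: "def_pred B (n + ?k) P" "P (c @ e)"
      "\<And>y. y \<in> tup (n + ?k) \<Longrightarrow> P y \<Longrightarrow> eqtp B (c @ e) y" by (rule isolE) (auto simp: cM)
    have Pe: "def_pred D n (\<lambda>y. P (y @ e))"
      using e BD DU by (intro def_pred_fix_params[OF P(1)]) auto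
    then obtain y where y: "y \<in> tup n" "P (y @ e)" "\<not> eqtp D c y"
      using not P(2) unfolding isol_def cM(2) by blast
    obtain e' where e': "set e' \<subseteq> D" "\<not> eqtp B (c @ e') (y @ e')"
    proof (rule ccontr)
      assume "\<not> thesis"
      then have "eqtp (B \<union> D) c y"
        using that y(1) cM MU BU DU by (intro eqtp_finite_params) (auto simp: tuples_def)
      then show False using y(3) BD by (simp add: Un_absorb1)
    qed
    have "\<not> eqtp B (c @ e @ e') (y @ e @ e')"
    proof
      assume eq: "eqtp B (c @ e @ e') (y @ e @ e')"
      have "sel B (n + (?k + length e')) (n + length e') (\<lambda>z. take n z @ drop ?k (drop n z))"
        by (rule sel_append[OF sel_prefix sel_drop[OF sel_suffix refl]]) auto
      then have "sel B (length (c @ e @ e')) (n + length e') (\<lambda>z. take n z @ drop ?k (drop n z))"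
        by (simp add: cM)
      moreover have "set c \<subseteq> univ U" "set e \<subseteq> univ U" "set e' \<subseteq> univ U"
        using e e'(1) DU cM MU by blast+
      ultimately have "eqtp B (c @ e') (y @ e')"
        using eqtp_sel[OF eq _ BU] y(1) cM by (fastforce simp: tuples_def)
      then show False using e' by simp
    qed
    then obtain S where S: "def_pred B (n + length (e @ e')) S" "S (c @ e @ e')" "\<not> S (y @ e @ e')"
      using eqtpI[of "c @ e @ e'" "y @ e @ e'" B] y(1) cM by (auto simp: tuples_def)
    have "def_pred M n (\<lambda>y. S (y @ e @ e'))"
      using e e' BD MU by (intro def_pred_fix_params[OF S(1)]) auto
    then have "def_pred M n (\<lambda>y. P (y @ e) \<and> \<not> S (y @ e @ e'))"
      by (intro def_pred_conj def_pred_not def_pred_mono[OF Pe BD(2)])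
    from elementary_witness[OF M this y(1)] y(2) S(3)
    obtain z where z: "z \<in> tuples M n" "P (z @ e)" "\<not> S (z @ e @ e')" by blast
    have "z @ e \<in> tup (n + ?k)" using z e DU MU by (auto simp: tuples_def)
    then have "eqtp B (c @ e) (z @ e)" using P(3) z by blast
    moreover have "\<not> eqtp B (c @ e @ e') (z @ e @ e')"
      using eqtpD[of B "c @ e @ e'" "z @ e @ e'" S] S z(3) cM by auto
    ultimately show ?thesis using e' z(1) by blast
  qed
  then obtain E Z where EZ: "\<And>e. set e \<subseteq> D \<Longrightarrow> set (E e) \<subseteq> D \<and> Z e \<in> tuples M n \<and>
      eqtp B (c @ e) (Z e @ e) \<and> \<not> eqtp B (c @ e @ E e) (Z e @ e @ E e)" by metis
  \<comment> \<open>The tuples \<open>e i\<close> grow inside \<open>D\<close>, and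
    \<open>z i\<close> has the type of \<open>c\<close> over \<open>e i\<close> but no longer over
    \<open>e (Suc i)\<close>.\<close>
  define e where "e i = ((\<lambda>e. e @ E e) ^^ i) []" for i
  have e_Suc: "e (Suc i) = e i @ E (e i)" for i by (simp add: e_def)
  have eD: "set (e i) \<subseteq> D" for i
    by (induction i) (use EZ in \<open>auto simp: e_Suc\<close>, simp add: e_def)
  define z where "z i = Z (e i)" for i
  have z: "z i \<in> tuples M n" "eqtp B (c @ e i) (z i @ e i)"
    "\<not> eqtp B (c @ e (Suc i)) (z i @ e (Suc i))" for i
    using EZ[OF eD[of i]] by (simp_all add: z_def e_Suc)
  have eU: "set (e i) \<subseteq> univ U" for i using eD DU by blast
  have prefix: "eqtp B x y" if "eqtp B (x @ u) (y @ v)" "length x = length y"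
    "set (x @ u) \<subseteq> univ U" "set (y @ v) \<subseteq> univ U" for x y u v
    using eqtp_sel[OF that(1) sel_prefix[of "length x"] BU that(3,4)] that(2) by simp
  have cz: "eqtp B c (z i)" for i
  proof -
    have "set (z i) \<subseteq> univ U" "length (z i) = n" using z(1)[of i] MU by (auto simp: tuples_def)
    then show ?thesis using prefix[OF z(2)[of i]] cM cU eU by auto
  qed
  \<comment> \<open>Quantifying over a common conjugate \<open>u\<close> of \<open>e i\<close> makes
    the relation definable over \<open>B\<close> alone, so that it can be transported to the other
    conjugates of \<open>c\<close>.\<close>
  define EQ where "EQ i x y \<longleftrightarrow> (\<exists>u \<in> tup (length (e i)). eqtp B (c @ e i) (x @ u) \<and>
    eqtp B (c @ e i) (y @ u))" for i x y
  have EQ_sym: "EQ i y x" if "EQ i x y" for i x y using that by (auto simp: EQ_def)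
  \<comment> \<open>This makes \<open>EQ\<close> transitive: two witnesses \<open>u\<close> and
    \<open>v\<close> are conjugate over the middle point \<open>y\<close>, hence also over every
    \<open>w\<close> definable from \<open>y\<close>.\<close>
  have move: "eqtp B (w @ u) (w @ v)"
    if "eqtp B (y @ u) (y @ v)" "set w \<subseteq> dcl L U (B \<union> set y)"
      "set (y @ u @ v) \<subseteq> univ U" for w y u v
  proof -
    have wU: "set w \<subseteq> univ U" using that(2) dcl_subset_univ by blast
    have 1: "eqtp B (w @ y @ u) (w @ y @ v)"
      using that wU by (intro eqtp_dcl_append[OF BU that(2) eqtp_refl that(1)]) auto
    have 2: "sel B (length (w @ y @ u)) (length (w @ u))
        (\<lambda>z. take (length w) z @ drop (length y) (drop (length w) z))"
      by (rule sel_append[OF sel_prefix sel_drop[OF sel_suffix refl]]) auto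
    show ?thesis using eqtp_sel[OF 1 2 BU] that(3) wU by simp
  qed
  have EQ_trans: "EQ i x w" if xy: "EQ i x y" and yw: "EQ i y w"
    and M': "y \<in> tuples M n" "w \<in> tuples M n" for i x y w
  proof -
    obtain u where u: "u \<in> tup (length (e i))" "eqtp B (c @ e i) (x @ u)" "eqtp B (c @ e i) (y @ u)"
      using xy by (auto simp: EQ_def)
    obtain v where v: "v \<in> tup (length (e i))" "eqtp B (c @ e i) (y @ v)" "eqtp B (c @ e i) (w @ v)"
      using yw by (auto simp: EQ_def)
    have "eqtp B c y" "eqtp B c w"
      using prefix[OF u(3)] prefix[OF v(3)] tuples_mono[OF MU M'(1)] tuples_mono[OF MU M'(2)]
        u(1) v(1) cM cU eU by (auto simp: tuples_def)
    then have "set w \<subseteq> dcl L U (B \<union> set y)" using conj'[OF M'(1) _ M'(2)] by simp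
    moreover have "set (y @ u @ v) \<subseteq> univ U"
      using u(1) v(1) tuples_mono[OF MU M'(1)] by (simp add: tuples_def)
    ultimately have "eqtp B (w @ u) (w @ v)"
      by (rule move[OF eqtp_trans[OF eqtp_sym[OF u(3)] v(2)]])
    then have "eqtp B (c @ e i) (w @ u)" using eqtp_trans[OF v(3) eqtp_sym] by blast
    then show ?thesis using u by (auto simp: EQ_def)
  qed
  have EQ_mono: "EQ i x y" if S: "EQ (Suc i) x y" "x \<in> tuples M n" "y \<in> tuples M n" for i x y
  proof -
    obtain u where u: "u \<in> tup (length (e (Suc i)))" "eqtp B (c @ e (Suc i)) (x @ u)"
      "eqtp B (c @ e (Suc i)) (y @ u)" using S(1) by (auto simp: EQ_def)
    let ?u = "take (length (e i)) u" and ?u' = "drop (length (e i)) u"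
    have "eqtp B (c @ e i) (x @ ?u)" if "eqtp B (c @ e (Suc i)) (x @ u)" "x \<in> tuples M n" for x
    proof (rule prefix)
      show "eqtp B ((c @ e i) @ E (e i)) ((x @ ?u) @ ?u')" using that(1) by (simp add: e_Suc)
    qed (use that u(1) cM MU eU[of "Suc i"] in
        \<open>auto simp: tuples_def e_Suc dest: in_set_takeD in_set_dropD\<close>)
    moreover have "?u \<in> tup (length (e i))" using u(1) by (intro tuples_take) (auto simp: e_Suc)
    ultimately show ?thesis using u S(2,3) by (auto simp: EQ_def)
  qed
  have EQ_def_pred: "def_pred B (n + n) (\<lambda>y. EQ i (take n y) (drop n y))" for i
  proof -
    let ?k = "length (e i)"
    have "isol B (c @ e i)" using eD[of i] cM BD by (intro atomicD[OF at]) auto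
    then obtain P where P: "def_pred B (n + ?k) P" "P (c @ e i)"
      "\<And>y. y \<in> tup (n + ?k) \<Longrightarrow> P y \<Longrightarrow> eqtp B (c @ e i) y" by (rule isolE) (auto simp: cM)
    have iff: "eqtp B (c @ e i) y \<longleftrightarrow> P y" if "y \<in> tup (n + ?k)" for y
      using P that eqtpD[of B "c @ e i" y P] cM by auto
    have "def_pred B (n + n) (\<lambda>y. \<exists>u \<in> tup ?k. P (take n y @ u) \<and> P (drop n y @ u))"
    proof (rule def_pred_ex[OF BU], rule def_pred_conj)
      show "def_pred B (?k + (n + n)) (\<lambda>y. P (take n (drop ?k y) @ take ?k y))"
        by (rule def_pred_sel[OF P(1) sel_append[OF sel_slice sel_prefix] BU]) auto
      show "def_pred B (?k + (n + n)) (\<lambda>y. P (drop n (drop ?k y) @ take ?k y))"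
        by (rule def_pred_sel[OF P(1) sel_append[OF sel_drop[OF sel_suffix refl] sel_prefix] BU]) auto
    qed
    then show ?thesis
    proof (rule def_pred_cong)
      fix y assume y: "y \<in> tup (n + n)"
      then have "take n y @ u \<in> tup (n + ?k)" "drop n y @ u \<in> tup (n + ?k)" if "u \<in> tup ?k" for u
        using that by (auto simp: tuples_def dest: in_set_takeD in_set_dropD)
      then show "(\<exists>u \<in> tup ?k. P (take n y @ u) \<and> P (drop n y @ u)) \<longleftrightarrow> EQ i (take n y) (drop n y)"
        unfolding EQ_def using iff by blast
    qed
  qed
  have EQ_transfer: "EQ i x y \<longleftrightarrow> EQ i x' y'"
    if "eqtp B (x @ y) (x' @ y')" "length x = n" "length y = n" "length x' = n" for i x y x' y'
    using eqtpD[OF that(1), of "\<lambda>y. EQ i (take n y) (drop n y)"] EQ_def_pred that by auto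
  have EQ_z: "EQ i c (z i)" for i
    using z(2)[of i] eU[of i] eqtp_refl by (auto simp: EQ_def tuples_def intro!: bexI[of _ "e i"])
  \<comment> \<open>A witness \<open>u\<close> would be conjugate to \<open>e (Suc i)\<close> over
    \<open>c\<close>, hence over \<open>z i\<close>, against the choice of
    \<open>z i\<close>.\<close>
  have not_EQ_z: "\<not> EQ (Suc i) c (z i)" for i
  proof
    assume "EQ (Suc i) c (z i)"
    then obtain u where u: "u \<in> tup (length (e (Suc i)))" "eqtp B (c @ e (Suc i)) (c @ u)"
      "eqtp B (c @ e (Suc i)) (z i @ u)" by (auto simp: EQ_def)
    have "set (z i) \<subseteq> dcl L U (B \<union> set c)" using conj z(1) cz by blast
    then have "eqtp B (z i @ e (Suc i)) (z i @ u)"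
      using u(1) eU[of "Suc i"] cM MU by (intro move[OF u(2)]) (auto simp: tuples_def)
    then show False using z(3) eqtp_trans[OF u(3) eqtp_sym] by blast
  qed
  \<comment> \<open>A bit \<open>False\<close> keeps the point \<open>y\<close>; a bit
    \<open>True\<close> replaces it by a \<open>w\<close> that stands to \<open>y\<close> as
    \<open>z i\<close> stands to \<open>c\<close>, where \<open>i\<close> is the depth. The
    recursion adds bits in front, whereas the tree appends them, whence the \<open>rev\<close>
    below.\<close>
  define node where "node = rec_list c (\<lambda>b s y. if b then
    (SOME w. w \<in> tuples M n \<and> eqtp B (c @ z (length s)) (y @ w)) else y)"
  have node_Nil: "node [] = c" and node_False: "node (False # s) = node s" for s
    by (simp_all add: node_def)
  have ext: "\<exists>w. w \<in> tuples M n \<and> eqtp B (c @ v) (y @ w)"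
    if y: "y \<in> tuples M n" "eqtp B c y" and v: "v \<in> tuples M n" for v y
  proof -
    have "set (c @ v) \<subseteq> M" "set y \<subseteq> M" "length v = n" using v y cM by (auto simp: tuples_def)
    then show ?thesis using atomic_extend[OF M at BM _ _ y(2), of v] by metis
  qed
  have node_True: "node (True # s) \<in> tuples M n \<and> eqtp B (c @ z (length s)) (node s @ node (True # s))"
    if "node s \<in> tuples M n" "eqtp B c (node s)" for s
    using someI_ex[OF ext[OF that z(1)]] by (simp add: node_def)
  have node: "node s \<in> tuples M n \<and> eqtp B c (node s)" for s
  proof (induction s)
    case (Cons b s)
    show ?case
    proof (cases b)
      case True
      have w: "node (True # s) \<in> tuples M n" "eqtp B (c @ z (length s)) (node s @ node (True # s))"
        using node_True Cons by auto
      have "eqtp B (z (length s)) (node (True # s))"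
      proof -
        have "eqtp B (drop n (c @ z (length s))) (drop n (node s @ node (True # s)))"
          using w(1) Cons z(1)[of "length s"] cM MU
          by (intro eqtp_sel[OF w(2) sel_suffix BU]) (auto simp: tuples_def)
        then show ?thesis using Cons cM by (simp add: tuples_def)
      qed
      from eqtp_trans[OF cz this] show ?thesis using w(1) True by simp
    qed (use Cons in \<open>simp add: node_False\<close>)
  qed (use c eqtp_refl in \<open>simp add: node_Nil\<close>)
  \<comment> \<open>The tree consists of the classes of these points, with the relation getting
    finer by one step at each level.\<close>
  define P where "P s y \<longleftrightarrow> EQ (length s) (node (rev s)) y" for s y
  show False
  proof (rule no_tree_in_elementary_submodel[OF tt M, of n P])
    fix s
    have "def_pred M n (\<lambda>y. EQ (length s) (take n (node (rev s) @ y)) (drop n (node (rev s) @ y)))"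
      using node[of "rev s"] BM
      by (intro def_pred_sel[OF def_pred_mono[OF EQ_def_pred] sel_append[OF sel_const sel_id] MU])
         (auto simp: tuples_def)
    moreover have "length (node (rev s)) = n" using node[of "rev s"] by (simp add: tuples_def)
    ultimately show "def_pred M n (P s)" by (simp add: P_def[abs_def])
    have "set (c @ e (length s)) \<subseteq> M" "set (node (rev s)) \<subseteq> M"
      using node[of "rev s"] cM eD[of "length s"] BD by (auto simp: tuples_def)
    then obtain u where "u \<in> tuples M (length (e (length s)))"
      "eqtp B (c @ e (length s)) (node (rev s) @ u)"
      using atomic_extend[OF M at BM] node[of "rev s"] by metis
    then have "EQ (length s) (node (rev s)) (node (rev s))"
      using tuples_mono[OF MU] by (auto simp: EQ_def)
    then show "\<exists>x \<in> tuples M n. P s x" using node by (auto simp: P_def)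
  next
    fix s b x assume x: "x \<in> tuples M n" "P (s @ [b]) x"
    have "EQ (length s) (node (rev s)) (node (b # rev s))"
    proof (cases b)
      case True
      have "eqtp B (c @ z (length s)) (node (rev s) @ node (True # rev s))"
        using node_True[of "rev s"] node[of "rev s"] by simp
      from EQ_transfer[OF this, of "length s"] EQ_z[of "length s"] True z(1) cM node[of "rev s"]
      show ?thesis by (auto simp: tuples_def)
    next
      case False
      \<comment> \<open>\<open>EQ\<close> is reflexive only at conjugates of \<open>c\<close>; at
        this point reflexivity is obtained from symmetry and transitivity through
        \<open>x\<close>.\<close>
      have "EQ (length s) (node (rev s)) x" "EQ (length s) x (node (rev s))"
      proof -
        have "EQ (Suc (length s)) (node (rev s)) x" using x(2) False by (simp add: P_def node_False)
        then show "EQ (length s) (node (rev s)) x" using EQ_mono[OF _ _ x(1)] node by blast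
        then show "EQ (length s) x (node (rev s))" by (rule EQ_sym)
      qed
      from EQ_trans[OF this x(1)] show ?thesis using node[of "rev s"] False by (simp add: node_False)
    qed
    moreover have "EQ (length s) (node (b # rev s)) x"
    proof (rule EQ_mono[OF _ _ x(1)])
      show "EQ (Suc (length s)) (node (b # rev s)) x" using x(2) by (simp add: P_def)
    qed (use node in blast)
    ultimately show "P s x"
      unfolding P_def by (rule EQ_trans[OF _ _ _ x(1)]) (use node in blast)
  next
    fix s x assume x: "x \<in> tuples M n" "P (s @ [False]) x"
    \<comment> \<open>A common point would relate \<open>node (rev s)\<close> to its
      \<open>True\<close> child at level \<open>Suc (length s)\<close>; by transfer \<open>c\<close>
      and \<open>z (length s)\<close> would be related there as well.\<close>
    show "\<not> P (s @ [True]) x"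
    proof
      assume "P (s @ [True]) x"
      then have "EQ (Suc (length s)) x (node (True # rev s))" by (simp add: P_def EQ_sym)
      moreover have "EQ (Suc (length s)) (node (rev s)) x" using x(2) by (simp add: P_def node_False)
      ultimately have "EQ (Suc (length s)) (node (rev s)) (node (True # rev s))"
        using EQ_trans[OF _ _ x(1)] node[of "True # rev s"] by simp
      moreover have "eqtp B (c @ z (length s)) (node (rev s) @ node (True # rev s))"
        using node_True[of "rev s"] node[of "rev s"] by simp
      ultimately show False
        using EQ_transfer[of c "z (length s)" "node (rev s)" "node (True # rev s)" "Suc (length s)"]
          not_EQ_z[of "length s"] z(1)[of "length s"] cM node[of "rev s"] by (auto simp: tuples_def)
    qed
  qed
qed

end


section \<open>Complete types and compactness\<close>

context fo_struct begin

lemma realizes_tp_iff: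
  assumes "b \<in> tup n"
  shows "realizes U n b' (tp L U B b) \<longleftrightarrow> b' \<in> tup n \<and> eqtp B b b'"
proof
  have l: "length b = n" using assms by (simp add: tuples_def)
  {
    assume r: "realizes U n b' (tp L U B b)"
    then have b': "b' \<in> tup n" by (simp add: realizes_def)
    have "eqtp B b b'"
    proof (rule eqtpI)
      show "length b = length b'" using assms b' by (simp add: tuples_def)
      fix P assume P: "def_pred B (length b) P" "P b"
      then obtain \<theta> where \<theta>: "\<theta> \<in> param_forms L B n" "\<And>x. x \<in> tup n \<Longrightarrow> P x \<longleftrightarrow> psat U \<theta> x"
        unfolding def_pred_def l by blast
      then have "\<theta> \<in> tp L U B b" using assms P(2) l by (simp add: tp_def)
      then show "P b'" using r \<theta> b' by (simp add: realizes_def)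
    qed
    then show "b' \<in> tup n \<and> eqtp B b b'" using b' by simp
  }
  {
    assume "b' \<in> tup n \<and> eqtp B b b'"
    then show "realizes U n b' (tp L U B b)"
      using eqtpD[OF _ def_pred_psat] l by (auto simp: realizes_def tp_def)
  }
qed

lemma complete_type_tp:
  assumes "b \<in> tup n"
  shows "complete_type L U B n (tp L U B b)"
  unfolding complete_type_def
proof (intro conjI allI impI)
  have l: "length b = n" using assms by (simp add: tuples_def)
  show "tp L U B b \<subseteq> param_forms L B n" using l by (auto simp: tp_def)
  show "\<exists>b. realizes U n b q" if "q \<subseteq> tp L U B b" for q
    using that assms by (intro exI[of _ b]) (auto simp: realizes_def tp_def)
  show "\<forall>(\<phi>, c) \<in> param_forms L B n. (\<phi>, c) \<in> tp L U B b \<or> (Neg \<phi>, c) \<in> tp L U B b"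
    by (auto simp: tp_def psat_def param_forms_def l)
qed

lemma complete_type_pair:
  assumes "complete_type L U B n p" "\<theta> \<in> p" "\<theta>' \<in> p"
  obtains b where "b \<in> tup n" "psat U \<theta> b" "psat U \<theta>' b"
proof -
  have "{\<theta>, \<theta>'} \<subseteq> p" "finite {\<theta>, \<theta>'}" using assms by auto
  then obtain b where "realizes U n b {\<theta>, \<theta>'}"
    using assms(1) unfolding complete_type_def by blast
  then show ?thesis using that by (auto simp: realizes_def)
qed

lemma complete_type_cases:
  assumes "complete_type L U B n p" "(\<phi>, c) \<in> param_forms L B n"
  shows "(\<phi>, c) \<in> p \<or> (Neg \<phi>, c) \<in> p"
  using assms unfolding complete_type_def by auto

lemma complete_type_antisym:
  assumes "complete_type L U B n p" "complete_type L U B n q" "p \<subseteq> q"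
  shows "p = q"
proof (rule ccontr)
  assume "p \<noteq> q"
  then obtain \<phi> c where \<phi>: "(\<phi>, c) \<in> q" "(\<phi>, c) \<notin> p" using assms(3) by auto
  then have "(\<phi>, c) \<in> param_forms L B n" using assms(2) by (auto simp: complete_type_def)
  then have "(Neg \<phi>, c) \<in> q" using complete_type_cases[OF assms(1)] \<phi>(2) assms(3) by blast
  then show False using complete_type_pair[OF assms(2) \<phi>(1), of "(Neg \<phi>, c)"]
    by (auto simp: psat_def)
qed

lemma complete_type_realized:
  assumes "complete_type L U B n p" "realizes U n b p"
  shows "p = tp L U B b"
proof (rule complete_type_antisym[OF assms(1)])
  have b: "b \<in> tup n" using assms(2) by (simp add: realizes_def)
  then show "complete_type L U B n (tp L U B b)" by (rule complete_type_tp)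
  show "p \<subseteq> tp L U B b"
    using assms b by (auto simp: complete_type_def realizes_def tp_def tuples_def)
qed

text \<open>The Lindenbaum argument for finitely realizable sets: if neither a formula nor its
  negation could be added to a maximal such set, the two finite obstructions together would have no
  realization.\<close>

lemma complete_type_extends:
  assumes p0: "p0 \<subseteq> param_forms L B n" "\<And>q. q \<subseteq> p0 \<Longrightarrow> finite q \<Longrightarrow> \<exists>b. realizes U n b q"
  shows "\<exists>p. complete_type L U B n p \<and> p0 \<subseteq> p"
proof -
  let ?S = "{p. p0 \<subseteq> p \<and> p \<subseteq> param_forms L B n \<and> (\<forall>q \<subseteq> p. finite q \<longrightarrow> (\<exists>b. realizes U n b q))}"
  have "\<exists>p \<in> ?S. \<forall>p' \<in> ?S. p \<subseteq> p' \<longrightarrow> p' = p"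
  proof (rule subset_Zorn_nonempty)
    show "?S \<noteq> {}" using p0 by blast
    fix \<C> assume ch: "\<C> \<noteq> {}" "subset.chain ?S \<C>"
    have C: "p0 \<subseteq> p \<and> p \<subseteq> param_forms L B n \<and> (\<forall>q \<subseteq> p. finite q \<longrightarrow> (\<exists>b. realizes U n b q))"
      if "p \<in> \<C>" for p using that ch(2) by (auto simp: subset.chain_def)
    have "\<exists>b. realizes U n b q" if q: "q \<subseteq> \<Union>\<C>" "finite q" for q
    proof -
      obtain p where "p \<in> \<C>" "q \<subseteq> p"
        using finite_subset_Union_chain[OF q(2,1) ch] by blast
      then show ?thesis using C q(2) by blast
    qed
    then show "\<Union>\<C> \<in> ?S" using C ch(1) by blast
  qed
  then obtain p where "p \<in> ?S" and max: "\<forall>p' \<in> ?S. p \<subseteq> p' \<longrightarrow> p' = p" by (rule bexE)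
  then have p: "p0 \<subseteq> p" "p \<subseteq> param_forms L B n"
    "\<And>q. q \<subseteq> p \<Longrightarrow> finite q \<Longrightarrow> \<exists>b. realizes U n b q" by auto
  have ext: "\<exists>q \<subseteq> p. finite q \<and> (\<forall>b. \<not> realizes U n b (insert \<theta> q))"
    if \<theta>: "\<theta> \<in> param_forms L B n" "\<theta> \<notin> p" for \<theta>
  proof (rule ccontr)
    assume no: "\<not> ?thesis"
    have "\<exists>b. realizes U n b q" if q: "q \<subseteq> insert \<theta> p" "finite q" for q
    proof -
      have "q - {\<theta>} \<subseteq> p" "finite (q - {\<theta>})" using q by auto
      then obtain b where "realizes U n b (insert \<theta> (q - {\<theta>}))" using no by blast
      then show ?thesis by (auto simp: realizes_def)
    qed
    then have "insert \<theta> p \<in> ?S" using \<theta>(1) p(1,2) by (simp add: subset_insertI2)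
    from bspec[OF max this] show False using \<theta>(2) by blast
  qed
  have "(\<phi>, c) \<in> p \<or> (Neg \<phi>, c) \<in> p" if \<phi>: "(\<phi>, c) \<in> param_forms L B n" for \<phi> c
  proof (rule ccontr)
    assume no: "\<not> ?thesis"
    have "(Neg \<phi>, c) \<in> param_forms L B n" using \<phi> by (auto simp: param_forms_def)
    from ext[OF this] obtain q2 where q2: "q2 \<subseteq> p" "finite q2"
      "\<forall>b. \<not> realizes U n b (insert (Neg \<phi>, c) q2)" using no by blast
    from ext[OF \<phi>] obtain q1 where q1: "q1 \<subseteq> p" "finite q1"
      "\<forall>b. \<not> realizes U n b (insert (\<phi>, c) q1)" using no by blast
    obtain b where b: "realizes U n b (q1 \<union> q2)" using p(3)[of "q1 \<union> q2"] q1 q2 by blast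
    show False
    proof (cases "psat U (\<phi>, c) b")
      case True
      then have "realizes U n b (insert (\<phi>, c) q1)" using b by (auto simp: realizes_def)
      then show False using q1(3) by blast
    next
      case False
      then have "realizes U n b (insert (Neg \<phi>, c) q2)"
        using b by (auto simp: realizes_def psat_def)
      then show False using q2(3) by blast
    qed
  qed
  then have "complete_type L U B n p" using p unfolding complete_type_def by blast
  then show ?thesis using p(1) by blast
qed

text \<open>The formulas implied by some member of the family are finitely realizable because the
  family is directed; a completion of them is realized by saturation over the small set
  \<open>D\<close>.\<close>

lemma compactness:
  assumes mon: "monster L T \<kappa> U" and D: "D \<subseteq> univ U" "small \<kappa> D"
    and F: "\<F> \<noteq> {}" "\<And>P. P \<in> \<F> \<Longrightarrow> def_pred D n P"
    and dir: "\<And>P Q. P \<in> \<F> \<Longrightarrow> Q \<in> \<F> \<Longrightarrow> \<exists>R \<in> \<F>. \<forall>x \<in> tup n. R x \<longrightarrow> P x \<and> Q x"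
    and ne: "\<And>P. P \<in> \<F> \<Longrightarrow> \<exists>x \<in> tup n. P x"
  shows "\<exists>x \<in> tup n. \<forall>P \<in> \<F>. P x"
proof -
  let ?p0 = "{\<theta> \<in> param_forms L D n. \<exists>P \<in> \<F>. \<forall>x \<in> tup n. P x \<longrightarrow> psat U \<theta> x}"
  have fin: "\<exists>P \<in> \<F>. \<forall>x \<in> tup n. P x \<longrightarrow> (\<forall>\<theta> \<in> q. psat U \<theta> x)" if "finite q" "q \<subseteq> ?p0" for q
    using that
  proof (induction rule: finite_induct)
    case empty
    then show ?case using F(1) by auto
  next
    case (insert \<theta> q)
    then obtain P Q where PQ: "P \<in> \<F>" "\<forall>x \<in> tup n. P x \<longrightarrow> (\<forall>\<theta> \<in> q. psat U \<theta> x)"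
      "Q \<in> \<F>" "\<forall>x \<in> tup n. Q x \<longrightarrow> psat U \<theta> x" by auto
    obtain R where "R \<in> \<F>" "\<forall>x \<in> tup n. R x \<longrightarrow> P x \<and> Q x" using dir[OF PQ(1,3)] by blast
    then show ?case using PQ by (intro bexI[of _ R]) auto
  qed
  have "\<exists>p. complete_type L U D n p \<and> ?p0 \<subseteq> p"
  proof (rule complete_type_extends)
    fix q assume q: "q \<subseteq> ?p0" "finite q"
    obtain P where P: "P \<in> \<F>" "\<forall>x \<in> tup n. P x \<longrightarrow> (\<forall>\<theta> \<in> q. psat U \<theta> x)"
      using fin[OF q(2,1)] by (rule bexE)
    obtain x where "x \<in> tup n" "P x" using ne[OF P(1)] by (rule bexE)
    then have "realizes U n x q" using P(2) by (simp add: realizes_def)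
    then show "\<exists>b. realizes U n b q" ..
  qed auto
  then obtain p where p: "complete_type L U D n p" "?p0 \<subseteq> p" by blast
  obtain b where b: "realizes U n b p"
    using mon[unfolded monster_def, THEN conjunct2, THEN conjunct2, THEN conjunct2, THEN conjunct1,
        rule_format, OF D p(1)] by (rule exE)
  have "P b" if P: "P \<in> \<F>" for P
  proof -
    obtain \<theta> where \<theta>: "\<theta> \<in> param_forms L D n" "\<forall>x \<in> tup n. P x \<longleftrightarrow> psat U \<theta> x"
      using F(2)[OF P] unfolding def_pred_def by blast
    then have "\<theta> \<in> p" using P p(2) by blast
    then show ?thesis using b \<theta>(2) by (auto simp: realizes_def)
  qed
  then show ?thesis using b by (auto simp: realizes_def)
qed

end

section \<open>Internality over an atomic model with no new points of X\<close>

text \<open>Only the set \<open>coords X\<close> of coordinates of points of \<open>X\<close> matters: it is a definable set of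
  elements, and \<open>X(M) = X(A)\<close> says that it meets \<open>M\<close> inside \<open>A\<close>.\<close>

locale prime_setting = fo_struct L U
  for L :: "('f, 'r) language" and U :: "('m, 'f, 'r) interp" +
  fixes A M :: "'m set" and X :: "'m list set"
  assumes tt: "totally_transcendental L U"
    and M: "elementary_submodel L U M"
    and AM: "A \<subseteq> M"
    and atomic: "atomic A M"
    and dcl_A: "dcl L U A = A"
    and coords_univ: "coords X \<subseteq> univ U"
    and coords_definable: "def_pred A (Suc 0) (\<lambda>x. x ! 0 \<in> coords X)"
    and coords_M: "coords X \<inter> M \<subseteq> A"
    and compact: "\<And>D n \<F>. D \<subseteq> M \<Longrightarrow> \<F> \<noteq> {} \<Longrightarrow> (\<And>P. P \<in> \<F> \<Longrightarrow> def_pred D n P) \<Longrightarrow>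
      (\<And>P Q. P \<in> \<F> \<Longrightarrow> Q \<in> \<F> \<Longrightarrow> \<exists>R \<in> \<F>. \<forall>x \<in> tuples (univ U) n. R x \<longrightarrow> P x \<and> Q x) \<Longrightarrow>
      (\<And>P. P \<in> \<F> \<Longrightarrow> \<exists>x \<in> tuples (univ U) n. P x) \<Longrightarrow> \<exists>x \<in> tuples (univ U) n. \<forall>P \<in> \<F>. P x"
begin

section \<open>Orthogonality to X of tuples from M\<close>

abbreviation V :: "'m set" where "V \<equiv> coords X"

lemma M_univ: "M \<subseteq> univ U"
  using M by (rule elementary_submodel_subset)

lemma A_univ: "A \<subseteq> univ U"
  using AM M_univ by blast

lemma def_pred_V: "def_pred A n (\<lambda>z. set z \<subseteq> V)"
proof -
  have "def_pred A n (\<lambda>z. \<forall>i \<in> {..<n}. [z ! i] ! 0 \<in> V)"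
    using def_pred_sel[OF coords_definable _ A_univ] sel_nth[OF sel_id, of _ n A]
    by (intro def_pred_finite_all) (auto simp del: nth_Cons_0)
  then show ?thesis
    by (rule def_pred_cong) (auto simp: tuples_def subset_iff in_set_conv_nth)
qed

text \<open>That some tuple \<open>v\<close> of \<open>V\<close> makes \<open>u\<close> the only
  solution of \<open>Q\<close> is a statement over \<open>M\<close>. It therefore has a witness in
  \<open>M\<close>, and such a witness has its entries in \<open>A\<close>.\<close>

lemma dcl_V_M:
  assumes u: "u \<in> M" "u \<in> dcl L U (B \<union> V)" and B: "A \<subseteq> B" "B \<subseteq> M"
  shows "u \<in> dcl L U B"
proof -
  have BU: "B \<subseteq> univ U" using B M_univ by blast
  obtain v where v: "set v \<subseteq> V" "u \<in> dcl L U (B \<union> set v)"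
    by (rule dcl_finite[OF u(2) BU coords_univ]) blast
  have vU: "set v \<subseteq> univ U" using v(1) coords_univ by blast
  have d: "def_pred (B \<union> set v) (Suc 0) (\<lambda>x. x = [u])" using v(2) by (simp add: dcl_iff)
  obtain Q where Q: "def_pred B (Suc 0 + length v) Q" "\<And>x. x \<in> tup (Suc 0) \<Longrightarrow> x = [u] \<longleftrightarrow> Q (x @ v)"
    by (rule def_pred_split_list[OF d BU vU]) blast
  have QM: "def_pred M (Suc 0 + length v) Q" using Q(1) B(2) by (rule def_pred_mono)
  let ?R = "\<lambda>z. set z \<subseteq> V \<and> Q ([u] @ z) \<and> (\<forall>x \<in> tup (Suc 0). Q (x @ z) \<longrightarrow> x = [u])"
  have "def_pred M (length v) ?R"
  proof (intro def_pred_conj def_pred_all[OF M_univ] def_pred_imp)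
    show "def_pred M (length v) (\<lambda>z. set z \<subseteq> V)" using def_pred_V AM by (rule def_pred_mono)
    show "def_pred M (length v) (\<lambda>z. Q ([u] @ z))"
      using u(1) by (intro def_pred_sel[OF QM sel_append[OF sel_const sel_id] M_univ]) auto
    show "def_pred M (Suc 0 + length v) (\<lambda>z. Q (take (Suc 0) z @ drop (Suc 0) z))"
      using QM by simp
    show "def_pred M (Suc 0 + length v) (\<lambda>z. take (Suc 0) z = [u])"
      using u(1) by (intro def_pred_sel_eq[OF sel_prefix sel_const M_univ]) auto
  qed
  moreover have "?R v"
    using v(1) Q(2) Q(2)[of "[u]"] u(1) M_univ by (auto simp: tuples_def)
  moreover have "v \<in> tup (length v)" using vU by (simp add: tuples_def)
  ultimately obtain v' where v': "v' \<in> tuples M (length v)" "?R v'"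
    using elementary_witness[OF M, of "length v" ?R v] by blast
  have v'A: "set v' \<subseteq> A" using v' coords_M by (auto simp: tuples_def)
  have "def_pred B (Suc 0) (\<lambda>x. Q (x @ v'))"
    using v'(1) v'A B(1) BU by (intro def_pred_fix_params[OF Q(1)]) (auto simp: tuples_def)
  then have "def_pred B (Suc 0) (\<lambda>x. x = [u])"
    by (rule def_pred_cong) (use v'(2) in auto)
  then show ?thesis using u(1) M_univ by (auto simp: dcl_iff)
qed

text \<open>A formula with parameters in \<open>V\<close> that splits an isolated type over \<open>A\<close> would do so already in
  \<open>M\<close>, hence with parameters in \<open>A\<close>.\<close>

lemma eqtp_V:
  assumes b: "set b \<subseteq> M" and b': "set b' \<subseteq> univ U" "eqtp A b b'"
  shows "eqtp (A \<union> V) b b'"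
proof (rule ccontr)
  assume no: "\<not> ?thesis"
  let ?n = "length b"
  have l: "length b' = ?n" using eqtp_length[OF b'(2)] by simp
  then obtain Q where Q: "def_pred (A \<union> V) ?n Q" "Q b" "\<not> Q b'"
    using eqtpI[of b b' "A \<union> V"] no by auto
  obtain Q' v where v: "set v \<subseteq> V" "def_pred A (?n + length v) Q'"
    "\<And>x. x \<in> tup ?n \<Longrightarrow> Q x \<longleftrightarrow> Q' (x @ v)"
    by (rule def_pred_split_params[OF Q(1) A_univ]) blast
  obtain P where P: "def_pred A ?n P" "P b" "\<And>y. y \<in> tup ?n \<Longrightarrow> P y \<Longrightarrow> eqtp A b y"
    using atomicD[OF atomic b] by (rule isolE) blast
  let ?m = "length v"
  \<comment> \<open>The variables are a conjugate of \<open>b\<close> together with a tuple of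
    \<open>V\<close> that tells it apart from \<open>b\<close>. As \<open>b\<close> is in
    \<open>M\<close>, a solution can be sought there, where the tuple of \<open>V\<close> falls into
    \<open>A\<close>.\<close>
  let ?S = "\<lambda>z. set (drop ?n z) \<subseteq> V \<and> P (take ?n z) \<and> Q' (b @ drop ?n z) \<and>
      \<not> Q' (take ?n z @ drop ?n z)"
  have "def_pred M (?n + ?m) ?S"
  proof (intro def_pred_conj def_pred_not)
    show "def_pred M (?n + ?m) (\<lambda>z. set (drop ?n z) \<subseteq> V)"
      using def_pred_sel[OF def_pred_mono[OF def_pred_V AM] sel_suffix M_univ] .
    show "def_pred M (?n + ?m) (\<lambda>z. P (take ?n z))"
      by (rule def_pred_sel[OF def_pred_mono[OF P(1) AM] sel_prefix M_univ]) simp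
    show "def_pred M (?n + ?m) (\<lambda>z. Q' (b @ drop ?n z))"
      using b by (intro def_pred_sel[OF def_pred_mono[OF v(2) AM] sel_append[OF sel_const sel_suffix]
          M_univ]) auto
    show "def_pred M (?n + ?m) (\<lambda>z. Q' (take ?n z @ drop ?n z))"
      using def_pred_mono[OF v(2) AM] by simp
  qed
  moreover have "b' @ v \<in> tup (?n + ?m)" using b' l v(1) coords_univ by (auto simp: tuples_def)
  moreover have "?S (b' @ v)"
  proof -
    have "b \<in> tup ?n" "b' \<in> tup ?n" using b b'(1) l M_univ by (auto simp: tuples_def)
    then show ?thesis using v Q(2,3) P(2) eqtpD[OF b'(2) P(1)] l by simp
  qed
  ultimately obtain z where z: "z \<in> tuples M (?n + ?m)" "?S z"
    using elementary_witness[OF M, of "?n + ?m" ?S "b' @ v"] by blast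
  obtain y w where yw: "z = y @ w" "y \<in> tuples M ?n" "w \<in> tuples M ?m"
    using tuples_append_split[OF z(1)] by blast
  have S: "set w \<subseteq> V" "P y" "Q' (b @ w)" "\<not> Q' (y @ w)"
    using z(2) yw by (auto simp: tuples_def)
  have w: "set w \<subseteq> A" using S(1) yw(3) coords_M by (auto simp: tuples_def)
  have "eqtp A b y" using P(3) S(2) tuples_mono[OF M_univ yw(2)] by blast
  moreover have "def_pred A ?n (\<lambda>x. Q' (x @ w))"
    using w yw(3) A_univ by (intro def_pred_fix_params[OF v(2)]) (auto simp: tuples_def)
  ultimately show False using eqtpD[of A b y] S(3,4) by blast
qed

text \<open>A type \<open>q\<close> over the large set need not be realized, so it is compared with
  the type of \<open>b\<close> formula by formula. Each formula of \<open>q\<close> is satisfied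
  jointly with the one isolating \<open>b @ d\<close> over \<open>A\<close>, where \<open>d\<close>
  collects its parameters from \<open>D\<close>; by \<open>eqtp_V\<close> the common solution cannot
  be told apart from \<open>b\<close>.\<close>

lemma weakly_orthogonal_tp:
  assumes b: "b \<in> tuples M n" and D: "A \<subseteq> D" "D \<subseteq> M"
  shows "weakly_orthogonal L U X D n (tp L U D b)"
  unfolding weakly_orthogonal_def
proof (rule ex1I[of _ "tp L U (dcl L U (D \<union> V)) b"], intro conjI)
  let ?E = "dcl L U (D \<union> V)"
  have DU: "D \<subseteq> univ U" using D M_univ by blast
  have EU: "D \<union> V \<subseteq> univ U" using DU coords_univ by blast
  have bU: "b \<in> tup n" using tuples_mono[OF M_univ b] .
  have bl: "length b = n" and bM: "set b \<subseteq> M" using b by (auto simp: tuples_def)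
  show E: "complete_type L U ?E n (tp L U ?E b)" using complete_type_tp[OF bU] .
  show "tp L U D b \<subseteq> tp L U ?E b"
    using subset_dcl[OF EU] by (auto simp: tp_def param_forms_def)
  fix q assume q: "complete_type L U ?E n q \<and> tp L U D b \<subseteq> q"
  show "q = tp L U ?E b"
  proof (rule complete_type_antisym[OF _ E])
    show "q \<subseteq> tp L U ?E b"
    proof
      fix \<theta> assume \<theta>: "\<theta> \<in> q"
      then have \<theta>p: "\<theta> \<in> param_forms L ?E n" using q by (auto simp: complete_type_def)
      have "def_pred (D \<union> V) n (psat U \<theta>)"
        using def_pred_dcl[OF EU def_pred_psat[OF \<theta>p]] .
      moreover have "D \<union> V = (A \<union> V) \<union> D" using D by blast
      ultimately have dp: "def_pred ((A \<union> V) \<union> D) n (psat U \<theta>)" by simp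
      have AVU: "A \<union> V \<subseteq> univ U" using A_univ coords_univ by blast
      obtain Q d where Q: "set d \<subseteq> D" "def_pred (A \<union> V) (n + length d) Q"
        "\<And>x. x \<in> tup n \<Longrightarrow> psat U \<theta> x \<longleftrightarrow> Q (x @ d)"
        by (rule def_pred_split_params[OF dp AVU]) blast
      have "isol A (b @ d)" using bM Q(1) D by (intro atomicD[OF atomic]) auto
      then obtain P where P: "def_pred A (n + length d) P" "P (b @ d)"
        "\<And>y. y \<in> tup (n + length d) \<Longrightarrow> P y \<Longrightarrow> eqtp A (b @ d) y"
        by (rule isolE) (auto simp: bl)
      have "def_pred D n (\<lambda>x. P (x @ d))"
        using D Q(1) DU by (intro def_pred_fix_params[OF P(1)]) auto
      then obtain \<chi> where \<chi>: "\<chi> \<in> param_forms L D n" "\<And>x. x \<in> tup n \<Longrightarrow> P (x @ d) \<longleftrightarrow> psat U \<chi> x"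
        unfolding def_pred_def by blast
      have "\<chi> \<in> tp L U D b" using \<chi> P(2) bU bl by (simp add: tp_def)
      then have "\<chi> \<in> q" using q by blast
      then obtain y where y: "y \<in> tup n" "psat U \<chi> y" "psat U \<theta> y"
        using complete_type_pair q \<theta> by metis
      have yd: "y @ d \<in> tup (n + length d)" using y Q(1) DU by (auto simp: tuples_def)
      then have "eqtp A (b @ d) (y @ d)" using P(3) \<chi>(2) y by blast
      then have "eqtp (A \<union> V) (b @ d) (y @ d)"
        using yd bM Q(1) D by (intro eqtp_V) (auto simp: tuples_def)
      moreover have "Q (y @ d)" using Q(3) y by blast
      ultimately have "Q (b @ d)" using eqtpD[of "A \<union> V" "b @ d" "y @ d" Q] Q(2) bl by simp
      then show "\<theta> \<in> tp L U ?E b" using Q(3) bU \<theta>p bl by (simp add: tp_def)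
    qed
  qed (use q in simp)
qed

subsection \<open>Strong internality over finite sets\<close>

text \<open>A uniform reason for \<open>u\<close> to be definable over \<open>y\<close>,
  \<open>z\<close> and points of \<open>V\<close>. The typical instance says that for some tuple
  \<open>v\<close> of \<open>V\<close>, a fixed formula in \<open>y\<close>, \<open>z\<close>,
  \<open>v\<close> has \<open>u\<close> as its only solution.\<close>

definition X_dcl_rel :: "nat \<Rightarrow> nat \<Rightarrow> ('m list \<Rightarrow> bool) \<Rightarrow> bool" where
  "X_dcl_rel n k R \<longleftrightarrow> def_pred A (Suc (n + k)) R \<and>
     (\<forall>u \<in> univ U. \<forall>y \<in> tup n. \<forall>z \<in> tup k. R (u # y @ z) \<longrightarrow> u \<in> dcl L U (A \<union> V \<union> set y \<union> set z))"

lemma X_dcl_rel_exists: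
  assumes u: "u \<in> dcl L U (A \<union> V \<union> set y \<union> D)" and y: "y \<in> tup n" and D: "D \<subseteq> univ U"
  obtains d R where "set d \<subseteq> D" "X_dcl_rel n (length d) R" "R (u # y @ d)"
proof -
  have yU: "set y \<subseteq> univ U" "length y = n" using y by (auto simp: tuples_def)
  have AyU: "A \<union> set y \<subseteq> univ U" using yU A_univ by blast
  have AyDU: "A \<union> set y \<union> D \<subseteq> univ U" using AyU D by blast
  have "u \<in> dcl L U ((A \<union> set y \<union> D) \<union> V)" using u by (simp add: ac_simps)
  then obtain v where v: "set v \<subseteq> V" "u \<in> dcl L U (A \<union> set y \<union> D \<union> set v)"
    by (rule dcl_finite[OF _ AyDU coords_univ]) blast
  have vU: "set v \<subseteq> univ U" using v(1) coords_univ by blast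
  have "u \<in> dcl L U ((A \<union> set y \<union> set v) \<union> D)" using v(2) by (simp add: ac_simps)
  then obtain d where d: "set d \<subseteq> D" "u \<in> dcl L U (A \<union> set y \<union> set v \<union> set d)"
    by (rule dcl_finite) (use AyU vU D in auto)
  have dU: "set d \<subseteq> univ U" using d(1) D by blast
  have "u \<in> dcl L U (A \<union> set (y @ d @ v))" using d(2) by (simp add: ac_simps)
  then have uU: "u \<in> univ U" and dp: "def_pred (A \<union> set (y @ d @ v)) (Suc 0) (\<lambda>x. x = [u])"
    by (auto simp: dcl_iff)
  let ?k = "length d" and ?m = "length v"
  obtain F where F: "def_pred A (Suc 0 + (n + (?k + ?m))) F"
    "\<And>x. x \<in> tup (Suc 0) \<Longrightarrow> x = [u] \<longleftrightarrow> F (x @ y @ d @ v)"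
    using def_pred_split_list[OF dp A_univ] yU dU vU by auto
  \<comment> \<open>The first entry of \<open>w\<close> is the element to be defined, the remaining
    ones are the data defining it; uniqueness is included in \<open>R\<close>, so that it holds for
    all arguments and not just for \<open>u\<close>, \<open>y\<close>, \<open>d\<close>.\<close>
  define R where "R w \<longleftrightarrow> (\<exists>v \<in> tup ?m. set v \<subseteq> V \<and> F (w @ v) \<and>
    (\<forall>x \<in> tup (Suc 0). F (x @ drop (Suc 0) w @ v) \<longrightarrow> x = take (Suc 0) w))" for w
  let ?N = "Suc (n + ?k)"
  have "def_pred A ?N R"
    unfolding R_def
  proof (intro def_pred_ex[OF A_univ] def_pred_conj def_pred_all[OF A_univ] def_pred_imp)
    show "def_pred A (?m + ?N) (\<lambda>z. set (take ?m z) \<subseteq> V)"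
      by (rule def_pred_sel[OF def_pred_V sel_prefix A_univ]) simp
    show "def_pred A (?m + ?N) (\<lambda>z. F (drop ?m z @ take ?m z))"
      by (rule def_pred_sel[OF F(1) sel_append[OF sel_suffix sel_prefix] A_univ]) auto
    show "def_pred A (Suc 0 + (?m + ?N)) (\<lambda>z. F (take (Suc 0) z @
        drop (Suc 0) (drop ?m (drop (Suc 0) z)) @ take ?m (drop (Suc 0) z)))"
      by (rule def_pred_sel[OF F(1) sel_append[OF sel_prefix sel_append[OF
          sel_drop[OF sel_drop[OF sel_suffix refl] refl] sel_slice refl]] A_univ]) auto
    show "def_pred A (Suc 0 + (?m + ?N)) (\<lambda>z. take (Suc 0) z =
        take (Suc 0) (drop ?m (drop (Suc 0) z)))"
      by (rule def_pred_sel_eq[OF sel_prefix sel_take[OF sel_drop[OF sel_suffix refl]] A_univ]) auto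
  qed
  moreover have "u' \<in> dcl L U (A \<union> V \<union> set y' \<union> set d')"
    if u': "u' \<in> univ U" and y': "y' \<in> tup n" and d': "d' \<in> tup ?k" and R': "R (u' # y' @ d')"
    for u' y' d'
  proof -
    obtain v' where v': "v' \<in> tup ?m" "set v' \<subseteq> V" "F ([u'] @ y' @ d' @ v')"
      "\<And>x. x \<in> tup (Suc 0) \<Longrightarrow> F (x @ y' @ d' @ v') \<Longrightarrow> x = [u']"
      using R' unfolding R_def by auto
    let ?C = "A \<union> V \<union> set y' \<union> set d'"
    have CU: "?C \<subseteq> univ U" using A_univ coords_univ y' d' by (auto simp: tuples_def)
    have "def_pred ?C (Suc 0) (\<lambda>x. F (x @ y' @ d' @ v'))"
      using v' y' d' CU by (intro def_pred_fix_params[OF F(1)]) (auto simp: tuples_def)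
    from dcl_tupleI[OF CU _ this v'(3)] v'(4) u' show ?thesis by (auto simp: tuples_def)
  qed
  ultimately have "X_dcl_rel n ?k R" by (simp add: X_dcl_rel_def)
  moreover have "R (u # y @ d)"
    unfolding R_def using v(1) vU F(2) F(2)[of "[u]"] uU by (intro bexI[of _ v]) (auto simp: tuples_def)
  ultimately show ?thesis using that d(1) by blast
qed

text \<open>Disjunction merges finitely many such relations into one, over the concatenated
  parameters. This provides the directedness needed for compactness.\<close>

lemma X_dcl_rel_disj:
  assumes "X_dcl_rel n k R" "X_dcl_rel n m S"
  shows "X_dcl_rel n (k + m) (\<lambda>w. R (take (Suc (n + k)) w) \<or>
    S (take (Suc n) w @ drop (Suc (n + k)) w))"
proof -
  have "def_pred A (Suc (n + (k + m))) (\<lambda>w. R (take (Suc (n + k)) w) \<or>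
    S (take (Suc n) w @ drop (Suc (n + k)) w))"
  proof (rule def_pred_disj)
    show "def_pred A (Suc (n + (k + m))) (\<lambda>w. R (take (Suc (n + k)) w))"
      using assms(1) by (intro def_pred_sel[OF _ sel_prefix A_univ]) (auto simp: X_dcl_rel_def)
    have S: "def_pred A (Suc (n + m)) S" using assms(2) by (simp add: X_dcl_rel_def)
    show "def_pred A (Suc (n + (k + m))) (\<lambda>w. S (take (Suc n) w @ drop (Suc (n + k)) w))"
      by (rule def_pred_sel[OF S sel_append[OF sel_prefix sel_suffix] A_univ]) auto
  qed
  moreover have "u \<in> dcl L U (A \<union> V \<union> set y \<union> set z)"
    if u: "u \<in> univ U" and y: "y \<in> tup n" and z: "z \<in> tup (k + m)"
      and RS: "R (take (Suc (n + k)) (u # y @ z)) \<or> S (take (Suc n) (u # y @ z) @ drop (Suc (n + k)) (u # y @ z))"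
    for u y z
  proof -
    obtain z1 z2 where z12: "z = z1 @ z2" "z1 \<in> tup k" "z2 \<in> tup m"
      using tuples_append_split[OF z] by blast
    have "R (u # y @ z1) \<or> S (u # y @ z2)" using RS z12 y by (auto simp: tuples_def)
    then have "u \<in> dcl L U (A \<union> V \<union> set y \<union> set z1) \<or> u \<in> dcl L U (A \<union> V \<union> set y \<union> set z2)"
      using assms u y z12(2,3) unfolding X_dcl_rel_def by blast
    then show ?thesis
      using dcl_mono[of "A \<union> V \<union> set y \<union> set z1" "A \<union> V \<union> set y \<union> set z"]
        dcl_mono[of "A \<union> V \<union> set y \<union> set z2" "A \<union> V \<union> set y \<union> set z"] z12(1) by auto
  qed
  ultimately show ?thesis by (simp add: X_dcl_rel_def)
qed

lemma X_dcl_rel_False: "X_dcl_rel n k (\<lambda>_. False)"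
  by (simp add: X_dcl_rel_def def_pred_const)

text \<open>\<open>internal_over d c\<close>: a formula over \<open>A\<close> and \<open>d\<close> witnesses that the type of \<open>c\<close> over any set
  containing \<open>A\<close> and \<open>d\<close> is strongly internal to \<open>X\<close>.\<close>

definition internal_over :: "'m list \<Rightarrow> 'm list \<Rightarrow> bool" where
  "internal_over d c \<longleftrightarrow> (\<exists>P R. def_pred A (length c + length d) P \<and> P (c @ d) \<and>
     X_dcl_rel (length c) (length d) R \<and>
     (\<forall>c1 \<in> tup (length c). \<forall>c2 \<in> tup (length c). P (c1 @ d) \<longrightarrow> P (c2 @ d) \<longrightarrow>
       (\<forall>i < length c. R ([c2 ! i] @ c1 @ d))))"

lemma internal_over_strongly_internal:
  assumes "internal_over d c" "set c \<subseteq> univ U" "A \<subseteq> D" "set d \<subseteq> D" "D \<subseteq> univ U"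
  shows "strongly_internal L U X D (length c) (tp L U D c)"
  unfolding strongly_internal_def
proof (intro allI impI)
  let ?n = "length c"
  obtain P R where P: "def_pred A (?n + length d) P" "P (c @ d)" and R: "X_dcl_rel ?n (length d) R"
    and PR: "\<And>c1 c2 i. c1 \<in> tup ?n \<Longrightarrow> c2 \<in> tup ?n \<Longrightarrow> P (c1 @ d) \<Longrightarrow> P (c2 @ d) \<Longrightarrow> i < ?n \<Longrightarrow>
      R ([c2 ! i] @ c1 @ d)" using assms(1) unfolding internal_over_def by blast
  have c: "c \<in> tup ?n" using assms(2) by (simp add: tuples_def)
  have Pd: "P (b @ d)" if "eqtp D c b" for b
    using eqtpD[OF eqtp_append_params[OF that assms(3-5)], of P] P by simp
  fix b b' assume "realizes U ?n b (tp L U D c)" "realizes U ?n b' (tp L U D c)"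
  then have b: "b \<in> tup ?n" "eqtp D c b" and b': "b' \<in> tup ?n" "eqtp D c b'"
    using realizes_tp_iff[OF c] by auto
  show "set b' \<subseteq> dcl L U (D \<union> V \<union> set b)"
  proof
    fix u assume "u \<in> set b'"
    then obtain i where i: "i < ?n" "u = b' ! i" using b' by (auto simp: tuples_def in_set_conv_nth)
    then have "R (u # b @ d)" using PR[OF b(1) b'(1)] Pd b b' by simp
    moreover have "u \<in> univ U" "d \<in> tup (length d)"
      using i b'(1) assms(4,5) by (auto simp: tuples_def)
    ultimately have "u \<in> dcl L U (A \<union> V \<union> set b \<union> set d)"
      using R b(1) unfolding X_dcl_rel_def by blast
    moreover have "A \<union> V \<union> set b \<union> set d \<subseteq> D \<union> V \<union> set b" using assms by blast
    ultimately show "u \<in> dcl L U (D \<union> V \<union> set b)" using dcl_mono by blast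
  qed
qed

text \<open>For fixed \<open>P\<close> and \<open>R\<close>, the requirement that solutions of
  \<open>P\<close> be related by \<open>R\<close> is a definable property of \<open>d\<close> over
  \<open>A\<close>, so it passes to conjugates.\<close>

lemma internal_over_eqtp:
  assumes "internal_over d c" "eqtp A (c @ d) (c' @ d')" "length c = length c'"
  shows "internal_over d' c'"
proof -
  let ?n = "length c" and ?k = "length d"
  have k: "length d' = ?k" using eqtp_length[OF assms(2)] assms(3) by simp
  obtain P R where P: "def_pred A (?n + ?k) P" "P (c @ d)" and R: "X_dcl_rel ?n ?k R"
    and PR: "\<forall>c1 \<in> tup ?n. \<forall>c2 \<in> tup ?n. P (c1 @ d) \<longrightarrow> P (c2 @ d) \<longrightarrow>
       (\<forall>i \<in> {..<?n}. R ([c2 ! i] @ c1 @ d))" using assms(1) unfolding internal_over_def by auto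
  let ?S = "\<lambda>w. \<forall>c1 \<in> tup ?n. \<forall>c2 \<in> tup ?n. P (c1 @ drop ?n w) \<longrightarrow> P (c2 @ drop ?n w) \<longrightarrow>
       (\<forall>i \<in> {..<?n}. R ([c2 ! i] @ c1 @ drop ?n w))"
  have R': "def_pred A (Suc (?n + ?k)) R" using R by (simp add: X_dcl_rel_def)
  have "def_pred A (?n + ?k) ?S"
  proof (intro def_pred_all[OF A_univ] def_pred_imp def_pred_finite_all)
    let ?N = "?n + (?n + (?n + ?k))"
    have c2: "sel A ?N ?n (take ?n)" by (rule sel_prefix) simp
    have c1: "sel A ?N ?n (\<lambda>z. take ?n (drop ?n z))" by (rule sel_slice) simp
    have d: "sel A ?N ?k (\<lambda>z. drop ?n (drop ?n (drop ?n z)))"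
      by (intro sel_drop[OF sel_drop[OF sel_suffix refl]]) simp
    show "def_pred A ?N (\<lambda>z. P (take ?n (drop ?n z) @ drop ?n (drop ?n (drop ?n z))))"
      by (rule def_pred_sel[OF P(1) sel_append[OF c1 d refl] A_univ])
    show "def_pred A ?N (\<lambda>z. P (take ?n z @ drop ?n (drop ?n (drop ?n z))))"
      by (rule def_pred_sel[OF P(1) sel_append[OF c2 d refl] A_univ])
    fix i assume "i \<in> {..<?n}"
    then show "def_pred A ?N (\<lambda>z. R ([take ?n z ! i] @ take ?n (drop ?n z) @ drop ?n (drop ?n (drop ?n z))))"
      by (intro def_pred_sel[OF R' sel_append[OF sel_nth[OF c2] sel_append[OF c1 d refl]] A_univ]) auto
  qed simp
  moreover have "?S (c @ d)" using PR by simp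
  ultimately have "?S (c' @ d')" using eqtpD[OF assms(2), of ?S] by simp
  moreover have "P (c' @ d')" using eqtpD[OF assms(2), of P] P by simp
  ultimately show ?thesis
    unfolding internal_over_def using P(1) R k assms(3) by (intro exI[of _ P] exI[of _ R]) auto
qed

text \<open>Internality yields definability with the help of points of \<open>V\<close>, and inside
  \<open>M\<close> these can be dispensed with by \<open>dcl_V_M\<close>. This is the hypothesis of
  \<open>isol_over_subset\<close>.\<close>

lemma internal_over_dcl:
  assumes "internal_over d c" "set d \<subseteq> M" "c \<in> tuples M n" "c' \<in> tuples M n"
    "eqtp (A \<union> set d) c c'"
  shows "set c' \<subseteq> dcl L U ((A \<union> set d) \<union> set c)"
proof -
  let ?D = "A \<union> set d"
  have DM: "?D \<subseteq> M" using AM assms(2) by blast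
  have c: "c \<in> tup n" "length c = n" and c': "c' \<in> tup n"
    using tuples_mono[OF M_univ] assms(3,4) by (auto simp: tuples_def)
  have si: "strongly_internal L U X ?D (length c) (tp L U ?D c)"
    by (rule internal_over_strongly_internal[OF assms(1)]) (use c DM M_univ in \<open>auto simp: tuples_def\<close>)
  have "realizes U n c (tp L U ?D c)" "realizes U n c' (tp L U ?D c)"
    using realizes_tp_iff[OF c(1)] c c' assms(5) eqtp_refl by auto
  then have "set c' \<subseteq> dcl L U (?D \<union> V \<union> set c)"
    using si c(2) unfolding strongly_internal_def by blast
  then have "set c' \<subseteq> dcl L U ((?D \<union> set c) \<union> V)" by (simp add: ac_simps)
  moreover have "set c' \<subseteq> M" "?D \<union> set c \<subseteq> M" using assms(3,4) DM by (auto simp: tuples_def)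
  ultimately show ?thesis using dcl_V_M[of _ "?D \<union> set c"] by blast
qed

text \<open>Suppose every choice of \<open>P\<close> and \<open>R\<close> had a counterexample. By
  compactness a single pair \<open>c1\<close>, \<open>c2\<close> would be a counterexample to all of
  them; both would realize the type of \<open>c\<close>, and strong internality would supply a
  relation \<open>R\<close> that captures \<open>c2\<close> over \<open>c1\<close>.\<close>

lemma strongly_internal_internal_over:
  assumes si: "strongly_internal L U X D n (tp L U D c)" and c: "c \<in> tuples M n"
    and D: "A \<subseteq> D" "D \<subseteq> M"
  obtains d where "set d \<subseteq> D" "internal_over d c"
proof -
  have DU: "D \<subseteq> univ U" using D M_univ by blast
  have cU: "c \<in> tup n" using tuples_mono[OF M_univ c] .
  have cl: "length c = n" using c by (simp add: tuples_def)
  define Good where "Good = {(P, R, d). def_pred D n P \<and> P c \<and> set d \<subseteq> D \<and> X_dcl_rel n (length d) R}"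
  \<comment> \<open>\<open>F (P, R, d)\<close> describes the counterexamples to this choice: two
    solutions of \<open>P\<close>, the second not captured by \<open>R\<close> over the
    first.\<close>
  define F where "F = (\<lambda>(P, R, d :: 'm list) (z :: 'm list). P (take n z) \<and> P (drop n z) \<and>
    \<not> (\<forall>i \<in> {..<n}. R ([drop n z ! i] @ take n z @ d)))"
  have F_def_pred: "def_pred D (n + n) (F g)" if g: "g \<in> Good" for g
  proof -
    obtain P R d where g: "g = (P, R, d)" "def_pred D n P" "set d \<subseteq> D" "X_dcl_rel n (length d) R"
      using g by (auto simp: Good_def)
    have R: "def_pred D (Suc (n + length d)) R"
      using g(4) D(1) by (auto simp: X_dcl_rel_def intro: def_pred_mono)
    show ?thesis
      unfolding g(1) F_def prod.case
    proof (intro def_pred_conj def_pred_not def_pred_finite_all)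
      show "def_pred D (n + n) (\<lambda>z. P (take n z))"
        by (rule def_pred_sel[OF g(2) sel_prefix DU]) simp
      show "def_pred D (n + n) (\<lambda>z. P (drop n z))"
        by (rule def_pred_sel[OF g(2) sel_drop[OF sel_id] DU]) simp
      have c2: "sel D (n + n) n (drop n)" by (rule sel_drop[OF sel_id]) simp
      fix i assume i: "i \<in> {..<n}"
      then show "def_pred D (n + n) (\<lambda>z. R ([drop n z ! i] @ take n z @ d))"
        using g(3) by (intro def_pred_sel[OF R sel_append[OF sel_nth[OF c2] sel_append[OF
            sel_prefix sel_const refl]] DU]) auto
    qed simp
  qed
  have dir: "\<exists>g \<in> Good. \<forall>z \<in> tup (n + n). F g z \<longrightarrow> F g1 z \<and> F g2 z"
    if gs: "g1 \<in> Good" "g2 \<in> Good" for g1 g2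
  proof -
    obtain P1 R1 d1 where g1: "g1 = (P1, R1, d1)" "def_pred D n P1" "P1 c" "set d1 \<subseteq> D"
      "X_dcl_rel n (length d1) R1" using gs(1) by (auto simp: Good_def)
    obtain P2 R2 d2 where g2: "g2 = (P2, R2, d2)" "def_pred D n P2" "P2 c" "set d2 \<subseteq> D"
      "X_dcl_rel n (length d2) R2" using gs(2) by (auto simp: Good_def)
    let ?k = "length d1"
    let ?R = "\<lambda>w. R1 (take (Suc (n + ?k)) w) \<or> R2 (take (Suc n) w @ drop (Suc (n + ?k)) w)"
    let ?g = "(\<lambda>x. P1 x \<and> P2 x, ?R, d1 @ d2)"
    have "X_dcl_rel n (length (d1 @ d2)) ?R" using X_dcl_rel_disj[OF g1(5) g2(5)] by simp
    then have "?g \<in> Good" using g1 g2 by (auto simp: Good_def)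
    moreover have "F ?g z \<longrightarrow> F g1 z \<and> F g2 z" if "z \<in> tup (n + n)" for z
    proof -
      have "length (take n z) = n" using that by (simp add: tuples_def)
      then show ?thesis by (auto simp: F_def g1(1) g2(1))
    qed
    ultimately show ?thesis by blast
  qed
  have g0: "(\<lambda>_. True, \<lambda>_. False, []) \<in> Good"
    using X_dcl_rel_False def_pred_True by (simp add: Good_def)
  have "\<exists>g \<in> Good. \<forall>z \<in> tup (n + n). \<not> F g z"
  proof (rule ccontr)
    assume no: "\<not> ?thesis"
    have "\<exists>z \<in> tup (n + n). \<forall>P \<in> F ` Good. P z"
    proof (rule compact[OF D(2)])
      show "\<exists>R \<in> F ` Good. \<forall>z \<in> tup (n + n). R z \<longrightarrow> P z \<and> Q z" if "P \<in> F ` Good" "Q \<in> F ` Good" for P Q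
        using that dir by blast
    qed (use g0 F_def_pred no in auto)
    then obtain z where z: "z \<in> tup (n + n)" "\<forall>P \<in> F ` Good. P z" by (rule bexE)
    obtain c1 c2 where "c1 \<in> tup n" "c2 \<in> tup n" "z = c1 @ c2"
      using tuples_append_split[OF z(1)] by blast
    then have c12: "c1 \<in> tup n" "c2 \<in> tup n" "\<And>g. g \<in> Good \<Longrightarrow> F g (c1 @ c2)"
      using z(2) by simp_all
    have l: "length c1 = n" "length c2 = n" using c12 by (auto simp: tuples_def)
    have P12: "P c1 \<and> P c2" if "def_pred D n P" "P c" for P
      using c12(3)[of "(P, \<lambda>_. False, [])"] that X_dcl_rel_False l by (auto simp: Good_def F_def)
    have "eqtp D c c1" by (rule eqtpI) (simp_all add: cl l P12)
    moreover have "eqtp D c c2" by (rule eqtpI) (simp_all add: cl l P12)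
    ultimately have "realizes U n c1 (tp L U D c)" "realizes U n c2 (tp L U D c)"
      using realizes_tp_iff[OF cU] c12 by auto
    then have "set c2 \<subseteq> dcl L U (D \<union> V \<union> set c1)"
      using si unfolding strongly_internal_def by blast
    moreover have "D \<union> V \<union> set c1 = A \<union> V \<union> set c1 \<union> D" using D by blast
    ultimately have c2: "set c2 \<subseteq> dcl L U (A \<union> V \<union> set c1 \<union> D)" by simp
    \<comment> \<open>One relation for all coordinates of \<open>c2\<close> is assembled coordinate
      by coordinate, using disjunctions.\<close>
    have "\<exists>R d. set d \<subseteq> D \<and> X_dcl_rel n (length d) R \<and> (\<forall>i < j. R ([c2 ! i] @ c1 @ d))" if "j \<le> n" for j
      using that
    proof (induction j)
      case 0
      then show ?case using X_dcl_rel_False[of n 0] by (intro exI[of _ "\<lambda>_. False"] exI[of _ "[]"]) auto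
    next
      case (Suc j)
      then obtain R1 d1 where 1: "set d1 \<subseteq> D" "X_dcl_rel n (length d1) R1"
        "\<forall>i < j. R1 ([c2 ! i] @ c1 @ d1)" by auto
      have "c2 ! j \<in> dcl L U (A \<union> V \<union> set c1 \<union> D)" using c2 Suc.prems l by auto
      then obtain d2 R2 where 2: "set d2 \<subseteq> D" "X_dcl_rel n (length d2) R2" "R2 (c2 ! j # c1 @ d2)"
        by (rule X_dcl_rel_exists[OF _ c12(1) DU]) blast
      let ?R = "\<lambda>w. R1 (take (Suc (n + length d1)) w) \<or>
        R2 (take (Suc n) w @ drop (Suc (n + length d1)) w)"
      have "X_dcl_rel n (length (d1 @ d2)) ?R" using X_dcl_rel_disj[OF 1(2) 2(2)] by simp
      moreover have "?R ([c2 ! i] @ c1 @ d1 @ d2)" if "i < Suc j" for i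
        using that 1(3) 2(3) l by (cases "i = j") (auto simp: less_Suc_eq)
      ultimately show ?case using 1(1) 2(1) by (intro exI[of _ ?R] exI[of _ "d1 @ d2"]) auto
    qed
    then obtain R d where "set d \<subseteq> D" "X_dcl_rel n (length d) R" "\<forall>i < n. R ([c2 ! i] @ c1 @ d)"
      by blast
    then show False
      using c12(3)[of "(\<lambda>_. True, R, d)"] def_pred_True l by (auto simp: Good_def F_def)
  qed
  then obtain P R d where g: "def_pred D n P" "P c" "set d \<subseteq> D" "X_dcl_rel n (length d) R"
    "\<And>z. z \<in> tup (n + n) \<Longrightarrow> \<not> F (P, R, d) z" by (auto simp: Good_def)
  have "A \<union> D = D" using D by blast
  then obtain P' e where P': "set e \<subseteq> D" "def_pred A (n + length e) P'"
    "\<And>x. x \<in> tup n \<Longrightarrow> P x \<longleftrightarrow> P' (x @ e)"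
    using def_pred_split_params[OF _ A_univ, of D n P] g(1) by metis
  let ?k = "length d" and ?m = "length e"
  \<comment> \<open>\<open>P\<close> may have parameters \<open>e\<close> in \<open>D\<close> other
    than the parameters \<open>d\<close> of \<open>R\<close>; both are rewritten over the common
    tuple \<open>d @ e\<close>.\<close>
  let ?P = "\<lambda>w. P' (take n w @ drop ?k (drop n w))" and ?R = "\<lambda>w. R (take (Suc (n + ?k)) w)"
  show ?thesis
  proof (rule that[of "d @ e"])
    show "set (d @ e) \<subseteq> D" using g P' by simp
    have "def_pred A (n + (?k + ?m)) ?P"
      by (rule def_pred_sel[OF P'(2) sel_append[OF sel_prefix sel_drop[OF sel_suffix refl]] A_univ]) auto
    moreover have "X_dcl_rel n (?k + ?m) ?R"
      using X_dcl_rel_disj[OF g(4) X_dcl_rel_False, of ?m] by simp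
    moreover have "?P (c @ d @ e)" using P'(3)[OF cU] g(2) cl by simp
    moreover have "?R ([c2 ! i] @ c1 @ d @ e)"
      if "c1 \<in> tup n" "c2 \<in> tup n" "?P (c1 @ d @ e)" "?P (c2 @ d @ e)" "i < n" for c1 c2 i
    proof -
      have l: "length c1 = n" "length c2 = n" using that by (auto simp: tuples_def)
      have "P c1" "P c2" using that P'(3) l by auto
      then have "R ([c2 ! i] @ c1 @ d)"
        using g(5)[of "c1 @ c2"] that(1,2,5) l tuples_append[OF that(1,2)] by (auto simp: F_def)
      then show ?thesis using l by simp
    qed
    ultimately show "internal_over (d @ e) c"
      unfolding internal_over_def cl length_append by blast
  qed
qed

lemma isol_internal:
  assumes "internal_over d c" "A \<subseteq> D" "set d \<subseteq> D" "D \<subseteq> M" "set c \<subseteq> M"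
  shows "isol D c"
proof (rule isol_over_subset[OF tt M])
  show "atomic (A \<union> set d) M"
    using assms atomic_finite_base[OF atomic _ A_univ M_univ] by blast
  show "c \<in> tuples M (length c)" using assms by (simp add: tuples_def)
  then show "set c' \<subseteq> dcl L U (A \<union> set d \<union> set c)"
    if "c' \<in> tuples M (length c)" "eqtp (A \<union> set d) c c'" for c'
    using internal_over_dcl[OF assms(1) _ _ that] assms by blast
qed (use assms in auto)

end


section \<open>Extending elementary maps\<close>

context fo_struct begin

lemma eqtp_pairs:
  assumes "eqtp B (map fst qs) (map snd qs)" "set ps \<subseteq> set qs" "B \<subseteq> univ U"
    "set qs \<subseteq> univ U \<times> univ U"
  shows "eqtp B (map fst ps) (map snd ps)"
proof -
  obtain "is" where "is": "ps = map ((!) qs) is" "\<And>i. i \<in> set is \<Longrightarrow> i < length qs"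
    using sublist_indices[OF assms(2)] by blast
  have "eqtp B (map ((!) (map fst qs)) is) (map ((!) (map snd qs)) is)"
    by (rule eqtp_sublist[OF assms(1) _ _ assms(3)]) (use "is"(2) assms(4) in auto)
  moreover have "map ((!) (map fst qs)) is = map fst ps" "map ((!) (map snd qs)) is = map snd ps"
    using "is" by auto
  ultimately show ?thesis by simp
qed

lemma eqtp_zip:
  assumes "eqtp B x y" "set ps \<subseteq> set (zip x y)" "B \<subseteq> univ U" "set x \<subseteq> univ U" "set y \<subseteq> univ U"
  shows "eqtp B (map fst ps) (map snd ps)"
proof (rule eqtp_pairs[OF _ assms(2,3)])
  show "eqtp B (map fst (zip x y)) (map snd (zip x y))" using assms(1) eqtp_length[OF assms(1)] by simp
  show "set (zip x y) \<subseteq> univ U \<times> univ U" using assms(4,5) by (auto dest: set_zip_leftD set_zip_rightD)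
qed

lemma isol_dcl: "u \<in> dcl L U B \<Longrightarrow> isol B [u]"
  unfolding isol_def by (auto simp: dcl_iff eqtp_refl)

text \<open>Partial elementary maps as graphs: the inverse map is the converse, unions of chains
  need no gluing, and single-valuedness and injectivity follow from elementarity.\<close>

definition elem_rel :: "('m \<times> 'm) set \<Rightarrow> bool" where
  "elem_rel R \<longleftrightarrow> R \<subseteq> univ U \<times> univ U \<and> (\<forall>ps. set ps \<subseteq> R \<longrightarrow> eqtp {} (map fst ps) (map snd ps))"

lemma elem_rel_converse:
  assumes "elem_rel R"
  shows "elem_rel (R\<inverse>)"
  unfolding elem_rel_def
proof (intro conjI allI impI)
  show "R\<inverse> \<subseteq> univ U \<times> univ U" using assms by (auto simp: elem_rel_def)
  fix ps assume "set ps \<subseteq> R\<inverse>"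
  then have "set (map (\<lambda>(a, b). (b, a)) ps) \<subseteq> R" by auto
  then have "eqtp {} (map fst (map (\<lambda>(a, b). (b, a)) ps)) (map snd (map (\<lambda>(a, b). (b, a)) ps))"
    using assms by (simp only: elem_rel_def)
  then have "eqtp {} (map snd ps) (map fst ps)" by (simp add: o_def case_prod_beta)
  then show "eqtp {} (map fst ps) (map snd ps)" by (rule eqtp_sym)
qed

lemma elem_rel_functional:
  assumes "elem_rel R" "(a, b) \<in> R" "(a, c) \<in> R"
  shows "b = c"
proof -
  have "set [(a, b), (a, c)] \<subseteq> R" using assms(2,3) by simp
  then have "eqtp {} (map fst [(a, b), (a, c)]) (map snd [(a, b), (a, c)])"
    using assms(1) unfolding elem_rel_def by blast
  from eqtpD[OF this, of "\<lambda>x. x ! 0 = x ! 1"] def_pred_eq[of 0 2 1 "{}"] show ?thesis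
    by (simp add: numeral_2_eq_2)
qed

lemma elem_rel_eqtp:
  assumes "elem_rel R" "Id_on A \<subseteq> R" "set ps \<subseteq> R"
  shows "eqtp A (map fst ps) (map snd ps)"
proof -
  have RU: "R \<subseteq> univ U \<times> univ U" using assms(1) by (simp add: elem_rel_def)
  have "eqtp {} (map fst ps @ c) (map snd ps @ c)" if "set c \<subseteq> A" for c
  proof -
    have "set (ps @ map (\<lambda>a. (a, a)) c) \<subseteq> R" using assms(2,3) that by auto
    then have "eqtp {} (map fst (ps @ map (\<lambda>a. (a, a)) c)) (map snd (ps @ map (\<lambda>a. (a, a)) c))"
      using assms(1) by (simp only: elem_rel_def)
    then show ?thesis by (simp add: o_def)
  qed
  then have "eqtp ({} \<union> A) (map fst ps) (map snd ps)"
    by (rule eqtp_finite_params) (use assms RU in auto)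
  then show ?thesis by simp
qed

text \<open>The formula isolating \<open>c\<close> over the domain is carried along \<open>R\<close>
  and solved in \<open>M\<close>. The domain may be infinite, but any test of elementarity involves
  the finitely many parameters of this formula and finitely many further pairs.\<close>

lemma elem_rel_extend:
  assumes R: "elem_rel R" "R \<subseteq> M \<times> M" and M: "elementary_submodel L U M"
    and c: "c \<in> tuples M n" "isol (Domain R) c"
  shows "\<exists>c' \<in> tuples M n. elem_rel (R \<union> set (zip c c'))"
proof -
  have MU: "M \<subseteq> univ U" using M by (rule elementary_submodel_subset)
  have RU: "R \<subseteq> univ U \<times> univ U" using R(1) by (simp add: elem_rel_def)
  have DU: "Domain R \<subseteq> univ U" using RU by auto
  have cl: "length c = n" and cU: "c \<in> tup n" using c(1) tuples_mono[OF MU] by (auto simp: tuples_def)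
  obtain P where P: "def_pred (Domain R) n P" "P c"
    "\<And>y. y \<in> tup n \<Longrightarrow> P y \<Longrightarrow> eqtp (Domain R) c y" using c(2) cl by (auto elim: isolE)
  then have P1: "def_pred ({} \<union> Domain R) n P" by simp
  obtain P0 e where e: "set e \<subseteq> Domain R" "def_pred {} (n + length e) P0"
    "\<And>x. x \<in> tup n \<Longrightarrow> P x \<longleftrightarrow> P0 (x @ e)" by (rule def_pred_split_params[OF P1]) auto
  obtain ps where ps: "set ps \<subseteq> R" "map fst ps = e"
  proof -
    have "\<exists>b. (a, b) \<in> R" if "a \<in> set e" for a using that e(1) by auto
    then obtain f where "\<And>a. a \<in> set e \<Longrightarrow> (a, f a) \<in> R" by metis
    then have "set (map (\<lambda>a. (a, f a)) e) \<subseteq> R" "map fst (map (\<lambda>a. (a, f a)) e) = e"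
      by (auto simp: o_def)
    then show ?thesis using that by blast
  qed
  let ?k = "length e" and ?e' = "map snd ps"
  have el: "length ?e' = ?k" using ps(2) by (metis length_map)
  have eM: "set ?e' \<subseteq> M" using ps(1) R(2) by auto
  have ee': "eqtp {} e ?e'" using R(1) ps unfolding elem_rel_def by blast
  let ?T = "\<lambda>z. \<exists>y \<in> tup n. P0 (y @ z)"
  have "def_pred {} ?k ?T"
    using e(2) by (intro def_pred_ex) auto
  moreover have "?T e" using e(3)[OF cU] P(2) cU by blast
  ultimately have "?T ?e'" using eqtpD[OF ee', of ?T] by blast
  then obtain y where y: "y \<in> tup n" "P0 (y @ ?e')" by (rule bexE)
  have "def_pred M n (\<lambda>y. P0 (y @ ?e'))"
    using eM el MU by (intro def_pred_fix_params[OF e(2)]) auto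
  from elementary_witness[OF M this y] obtain c' where c': "c' \<in> tuples M n" "P0 (c' @ ?e')" by (rule bexE)
  have cl': "length c' = n" using c'(1) by (simp add: tuples_def)
  have ZU: "set (zip c c') \<subseteq> univ U \<times> univ U"
    using cU tuples_mono[OF MU c'(1)] by (auto simp: tuples_def dest: set_zip_leftD set_zip_rightD)
  have "elem_rel (R \<union> set (zip c c'))"
    unfolding elem_rel_def
  proof (intro conjI allI impI)
    show "R \<union> set (zip c c') \<subseteq> univ U \<times> univ U" using RU ZU by blast
    fix qs assume qs: "set qs \<subseteq> R \<union> set (zip c c')"
    \<comment> \<open>\<open>ps\<close> comes first, so that the parameters of the isolating formula
      and their images are the first \<open>?k\<close> entries of the two projections.\<close>
    define rs where "rs = ps @ filter (\<lambda>p. p \<in> R) qs"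
    have rs: "set rs \<subseteq> R" using ps(1) by (auto simp: rs_def)
    let ?x = "map fst rs" and ?x' = "map snd rs"
    have xx': "eqtp {} ?x ?x'" using R(1) rs unfolding elem_rel_def by blast
    have tx: "take ?k ?x = e" "take ?k ?x' = ?e'" using ps(2) el by (auto simp: rs_def)
    have k: "?k \<le> length ?x" using ps(2) by (auto simp: rs_def)
    have xD: "set ?x \<subseteq> Domain R" using rs by force
    have "eqtp {} (c @ ?x) (c' @ ?x')"
    proof (rule eqtpI)
      show "length (c @ ?x) = length (c' @ ?x')" by (simp add: cl cl')
      fix W assume W: "def_pred {} (length (c @ ?x)) W" "W (c @ ?x)"
      \<comment> \<open>That the isolating formula implies \<open>W\<close> is a property of
        \<open>?x\<close> alone, hence passes to \<open>?x'\<close> along \<open>R\<close>.\<close>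
      let ?S = "\<lambda>z. \<forall>y \<in> tup n. P0 (y @ take ?k z) \<longrightarrow> W (y @ z)"
      have "def_pred {} (length ?x) ?S"
      proof (rule def_pred_all, simp, rule def_pred_imp)
        have "?k \<le> n + length ?x - n" using k by simp
        then show "def_pred {} (n + length ?x) (\<lambda>z. P0 (take n z @ take ?k (drop n z)))"
          by (intro def_pred_sel[OF e(2) sel_append[OF sel_prefix sel_slice refl]]) auto
        show "def_pred {} (n + length ?x) (\<lambda>z. W (take n z @ drop n z))"
          using W(1) by (simp add: cl)
      qed
      moreover have "?S ?x"
      proof (intro ballI impI)
        fix y assume y: "y \<in> tup n" "P0 (y @ take ?k ?x)"
        then have "eqtp (Domain R) c y" using P(3) e(3) tx by simp
        then have "eqtp {} (c @ ?x) (y @ ?x)" by (rule eqtp_append_params) (use xD DU in auto)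
        from eqtpD[OF this W(1)] W(2) show "W (y @ ?x)" by simp
      qed
      ultimately have "?S ?x'" using eqtpD[OF xx', of ?S] by blast
      then show "W (c' @ ?x')" using c'(2) tx(2) tuples_mono[OF MU c'(1)] by simp
    qed
    then have "eqtp {} (map fst (zip c c' @ rs)) (map snd (zip c c' @ rs))"
      using cl cl' by simp
    moreover have "set qs \<subseteq> set (zip c c' @ rs)" using qs by (auto simp: rs_def)
    moreover have "set (zip c c' @ rs) \<subseteq> univ U \<times> univ U" using ZU rs RU by auto
    ultimately show "eqtp {} (map fst qs) (map snd qs)" by (rule eqtp_pairs[OF _ _ empty_subsetI])
  qed
  then show ?thesis using c'(1) by blast
qed

end

section \<open>Iterated definable Galois extensions\<close>

context prime_setting begin

lemma dcl_subset_M: "B \<subseteq> M \<Longrightarrow> dcl L U B \<subseteq> M"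
  using dcl_mono[of B M] dcl_elementary[OF M] by blast

text \<open>Replaces extensions inside \<open>M\<close> by \<open>internal_over\<close>, which
  concerns finite tuples and can be conjugated or carried to larger bases;
  \<open>galois_ext_ftI\<close> leads back.\<close>

lemma galois_ext_ftD:
  assumes E: "galois_ext_ft L U X D E" "E \<subseteq> M" and D: "A \<subseteq> D" "D \<subseteq> M"
  obtains c d where "set c \<subseteq> M" "set d \<subseteq> D" "internal_over d c" "E = dcl L U (D \<union> set c)"
proof -
  have DU: "D \<subseteq> univ U" using D M_univ by blast
  obtain n p b where p: "complete_type L U D n p" "strongly_internal L U X D n p"
    "realizes U n b p" "E = dcl L U (D \<union> set b)" using E(1) unfolding galois_ext_ft_def by blast
  have b: "b \<in> tup n" using p(3) by (simp add: realizes_def)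
  then have "set b \<subseteq> E" using subset_dcl[of "D \<union> set b"] DU p(4) by (auto simp: tuples_def)
  then have bM: "b \<in> tuples M n" using b E(2) by (auto simp: tuples_def)
  have "strongly_internal L U X D n (tp L U D b)"
    using complete_type_realized[OF p(1,3)] p(2) by simp
  then obtain d where "set d \<subseteq> D" "internal_over d b"
    by (rule strongly_internal_internal_over[OF _ bM D]) blast
  then show ?thesis using that p(4) bM by (auto simp: tuples_def)
qed

lemma galois_ext_ftI:
  assumes "set c \<subseteq> M" "set d \<subseteq> D" "internal_over d c" and D: "A \<subseteq> D" "D \<subseteq> M"
  shows "galois_ext_ft L U X D (dcl L U (D \<union> set c))"
proof -
  have c: "c \<in> tuples M (length c)" "set c \<subseteq> univ U" "c \<in> tup (length c)"
    using assms(1) M_univ by (auto simp: tuples_def)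
  have "complete_type L U D (length c) (tp L U D c)" using c by (intro complete_type_tp)
  moreover have "strongly_internal L U X D (length c) (tp L U D c)"
    using assms c M_univ by (intro internal_over_strongly_internal) auto
  moreover have "weakly_orthogonal L U X D (length c) (tp L U D c)"
    by (rule weakly_orthogonal_tp[OF c(1) D])
  moreover have "realizes U (length c) c (tp L U D c)"
    using realizes_tp_iff[OF c(3)] c eqtp_refl by blast
  ultimately show ?thesis unfolding galois_ext_ft_def by blast
qed

text \<open>The trivial extension, by which the stages of the tower increase.\<close>

lemma internal_over_Nil: "internal_over [] []"
  unfolding internal_over_def using X_dcl_rel_False def_pred_True
  by (intro exI[of _ "\<lambda>_. True"] exI[of _ "\<lambda>_. False"]) auto

section \<open>The stages of the tower and their normality\<close>

abbreviation GX :: "nat \<Rightarrow> 'm set" where "GX \<equiv> XDG L U X M A"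

text \<open>The bounds are assumed here because their inductive proof in \<open>GX_bounds\<close>
  uses this description of the next stage.\<close>

lemma GX_Suc_aux:
  assumes "A \<subseteq> GX n" "GX n \<subseteq> M"
  shows "u \<in> GX (Suc n) \<longleftrightarrow> (\<exists>c d. set c \<subseteq> M \<and> set d \<subseteq> GX n \<and> internal_over d c \<and>
    u \<in> dcl L U (GX n \<union> set c))"
proof
  assume "u \<in> GX (Suc n)"
  then obtain F where F: "galois_ext_ft L U X (GX n) F" "F \<subseteq> M" "u \<in> F"
    by (auto simp: galois_ext_def)
  then show "\<exists>c d. set c \<subseteq> M \<and> set d \<subseteq> GX n \<and> internal_over d c \<and> u \<in> dcl L U (GX n \<union> set c)"
    using galois_ext_ftD[OF F(1,2) assms] by metis
next
  assume "\<exists>c d. set c \<subseteq> M \<and> set d \<subseteq> GX n \<and> internal_over d c \<and> u \<in> dcl L U (GX n \<union> set c)"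
  then obtain c d where c: "set c \<subseteq> M" "set d \<subseteq> GX n" "internal_over d c"
    "u \<in> dcl L U (GX n \<union> set c)" by blast
  let ?E = "dcl L U (GX n \<union> set c)"
  have "galois_ext_ft L U X (GX n) ?E" using galois_ext_ftI[OF c(1-3) assms] .
  moreover have "?E \<subseteq> M" using dcl_subset_M c(1) assms by auto
  ultimately have "galois_ext L U X M (GX n) ?E"
    unfolding galois_ext_def by (intro exI[of _ "{?E}"]) auto
  then show "u \<in> GX (Suc n)" using c(4) by auto
qed

lemma GX_bounds: "A \<subseteq> GX n \<and> GX n \<subseteq> M"
proof (induction n)
  case (Suc n)
  have "u \<in> GX (Suc n)" if "u \<in> GX n" for u
    using GX_Suc_aux[of n u] Suc internal_over_Nil that subset_dcl[of "GX n"] M_univ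
    by (intro iffD2[OF GX_Suc_aux] exI[of _ "[]"]) auto
  moreover have "u \<in> M" if "u \<in> GX (Suc n)" for u
  proof -
    obtain c where "set c \<subseteq> M" "u \<in> dcl L U (GX n \<union> set c)"
      using GX_Suc_aux[of n u] Suc \<open>u \<in> GX (Suc n)\<close> by blast
    then show ?thesis using dcl_subset_M[of "GX n \<union> set c"] Suc by blast
  qed
  ultimately show ?case using Suc by blast
qed (simp add: AM)

lemma GX_Suc: "u \<in> GX (Suc n) \<longleftrightarrow> (\<exists>c d. set c \<subseteq> M \<and> set d \<subseteq> GX n \<and> internal_over d c \<and>
    u \<in> dcl L U (GX n \<union> set c))"
  using GX_Suc_aux GX_bounds by blast

lemma GX_univ: "GX n \<subseteq> univ U"
  using GX_bounds M_univ by blast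

lemma GX_subset_Suc: "GX n \<subseteq> GX (Suc n)"
proof
  fix u assume "u \<in> GX n"
  then have "u \<in> dcl L U (GX n \<union> set [])" using subset_dcl[OF GX_univ] by auto
  then show "u \<in> GX (Suc n)"
    using internal_over_Nil by (intro iffD2[OF GX_Suc] exI[of _ "[]"]) simp
qed

abbreviation N :: "'m set" where "N \<equiv> XDG_inf L U X M A"

text \<open>The union in \<open>XDG_inf\<close> starts at stage 1; stage 0 is absorbed by
  it.\<close>

lemma N_eq: "N = (\<Union>n. GX n)"
  using GX_subset_Suc[of 0] unfolding XDG_inf_def by (auto; metis XDG.simps(1) atLeast_iff
      le_0_eq nat_le_linear subsetD not_less_eq_eq One_nat_def)

lemma N_bounds: "A \<subseteq> N" "N \<subseteq> M"
  using GX_bounds by (auto simp: N_eq)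

lemma normal_set_iff:
  "normal_set L U A M B \<longleftrightarrow> A \<subseteq> B \<and> B \<subseteq> M \<and> (\<forall>b \<in> B. \<forall>b' \<in> M. eqtp A [b] [b'] \<longrightarrow> b' \<in> B)"
proof -
  have "tp L U A [b] = tp L U A [b'] \<longleftrightarrow> eqtp A [b] [b']" if "b \<in> M" "b' \<in> M" for b b'
    using that M_univ by (intro tp_eq_iff_eqtp[of _ "Suc 0"]) (auto simp: tuples_def)
  then show ?thesis unfolding normal_set_def by blast
qed

lemma normal_set_tuple:
  assumes "normal_set L U A M B" "set x \<subseteq> B" "set x' \<subseteq> M" "eqtp A x x'"
  shows "set x' \<subseteq> B"
proof
  have BM: "B \<subseteq> M" using assms(1) by (simp add: normal_set_iff)
  fix b' assume b': "b' \<in> set x'"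
  then obtain i where i: "i < length x'" "b' = x' ! i" by (auto simp: in_set_conv_nth)
  have l: "length x = length x'" using eqtp_length[OF assms(4)] .
  then have "(x ! i, b') \<in> set (zip x x')" using i by (auto simp: in_set_zip)
  then have "eqtp A [x ! i] [b']"
    using eqtp_zip[OF assms(4), of "[(x ! i, b')]"] A_univ assms(2,3) BM M_univ by auto
  moreover have "x ! i \<in> B" using i l assms(2) by auto
  ultimately show "b' \<in> B" using assms(1) b' assms(3) by (auto simp: normal_set_iff)
qed

text \<open>An element \<open>u\<close> of the next stage is defined from an internal tuple
  \<open>c\<close>, its base \<open>d\<close> and further parameters \<open>e\<close> of the current
  stage. A conjugate of \<open>u\<close> in \<open>M\<close> extends to a conjugate of all these
  data; the induction hypothesis keeps the images of \<open>d\<close> and \<open>e\<close> in the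
  stage, and internality is preserved.\<close>

lemma GX_normal: "normal_set L U A M (GX n)"
proof (induction n)
  case 0
  have "b' = b" if "b \<in> A" "eqtp A [b] [b']" for b b'
    using eqtpD[OF that(2), of "\<lambda>x. x = [b]"] that(1) subset_dcl[OF A_univ] by (auto simp: dcl_iff)
  then show ?case using AM by (auto simp: normal_set_iff)
next
  case (Suc n)
  have "u' \<in> GX (Suc n)" if u: "u \<in> GX (Suc n)" "u' \<in> M" "eqtp A [u] [u']" for u u'
  proof -
    obtain c d where c: "set c \<subseteq> M" "set d \<subseteq> GX n" "internal_over d c"
      "u \<in> dcl L U (GX n \<union> set c)" using u(1) GX_Suc by blast
    have "GX n \<union> set c = (A \<union> set c) \<union> GX n" using GX_bounds by blast
    then have "u \<in> dcl L U ((A \<union> set c) \<union> GX n)" using c(4) by simp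
    then obtain e where e: "set e \<subseteq> GX n" "u \<in> dcl L U (A \<union> set c \<union> set e)"
      by (rule dcl_finite) (use c(1) A_univ M_univ GX_univ in auto)
    have uM: "u \<in> M" using u(1) GX_bounds by blast
    have deM: "set d \<subseteq> M" "set e \<subseteq> M" using c(2) e(1) GX_bounds by blast+
    have "set ([u] @ c @ d @ e) \<subseteq> M" "set [u'] \<subseteq> M" using uM u(2) c(1) deM by auto
    then obtain w where w: "w \<in> tuples M (length (c @ d @ e))" "eqtp A ([u] @ c @ d @ e) ([u'] @ w)"
      using atomic_extend[OF M atomic AM _ _ u(3)] by blast
    then obtain c' d' e' where w': "w = c' @ d' @ e'" "c' \<in> tuples M (length c)"
      "d' \<in> tuples M (length d)" "e' \<in> tuples M (length e)"
      using tuples_append_split[of w M "length c" "length d + length e"]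
        tuples_append_split[of _ M "length d" "length e"] by (metis length_append)
    let ?z = "zip ([u] @ c @ d @ e) ([u'] @ w)"
    have z: "?z = (u, u') # zip c c' @ zip d d' @ zip e e'" using w' by (simp add: tuples_def)
    have len: "length c' = length c" "length d' = length d" "length e' = length e"
      and M': "set c' \<subseteq> M" "set d' \<subseteq> M" "set e' \<subseteq> M"
      using w' by (auto simp: tuples_def)
    have "set ([u] @ c @ d @ e) \<subseteq> M" "set ([u'] @ w) \<subseteq> M"
      using uM u(2) c(1) deM w'(1) M' by auto
    then have "set ([u] @ c @ d @ e) \<subseteq> univ U" "set ([u'] @ w) \<subseteq> univ U" using M_univ by blast+
    then have sub: "eqtp A (map fst ps) (map snd ps)" if "set ps \<subseteq> set ?z" for ps
      using eqtp_zip[OF w(2) that A_univ] by blast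
    have "eqtp A d d'" "eqtp A e e'" "eqtp A (c @ d) (c' @ d')" "eqtp A ((c @ e) @ [u]) ((c' @ e') @ [u'])"
      using sub[of "zip d d'"] sub[of "zip e e'"] sub[of "zip c c' @ zip d d'"]
        sub[of "zip c c' @ zip e e' @ [(u, u')]"] z len by auto
    note eqs = this
    have "set d' \<subseteq> GX n" "set e' \<subseteq> GX n"
      using normal_set_tuple[OF Suc] eqs(1,2) c(2) e(1) M' by blast+
    moreover have "internal_over d' c'" using internal_over_eqtp[OF c(3) eqs(3)] len by simp
    moreover have "u' \<in> dcl L U (GX n \<union> set c')"
    proof -
      have "set [u'] \<subseteq> dcl L U (A \<union> set (c' @ e'))"
        by (rule eqtp_dcl_transfer[OF A_univ eqs(4)])
           (use e(2) len c(1) deM M' u(2) M_univ in \<open>auto simp: ac_simps\<close>)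
      moreover have "A \<union> set (c' @ e') \<subseteq> GX n \<union> set c'"
        using \<open>set e' \<subseteq> GX n\<close> GX_bounds[of n] by auto
      from dcl_mono[OF this] calculation show ?thesis by auto
    qed
    ultimately show ?thesis using GX_Suc M'(1) by blast
  qed
  then show ?case using GX_bounds[of "Suc n"] by (auto simp only: normal_set_iff)
qed

lemma N_normal: "normal_set L U A M N"
  using GX_normal N_bounds by (fastforce simp: normal_set_iff N_eq)

section \<open>Automorphisms of the union of the tower\<close>

lemma maximal_elem_rel_Domain:
  assumes R: "elem_rel R" "Id_on A \<subseteq> R" "R \<subseteq> N \<times> N"
    and max: "\<And>R'. elem_rel R' \<Longrightarrow> R \<subseteq> R' \<Longrightarrow> R' \<subseteq> N \<times> N \<Longrightarrow> R' = R"
  shows "N \<subseteq> Domain R"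
proof -
  let ?D = "Domain R"
  have D: "A \<subseteq> ?D" "?D \<subseteq> M" using R(2,3) N_bounds by auto
  have RM: "R \<subseteq> M \<times> M" using R(3) N_bounds by blast
  \<comment> \<open>A tuple of \<open>N\<close> with isolated type over the domain can be added to
    \<open>R\<close> together with a conjugate in \<open>M\<close>, which is in \<open>N\<close> by
    normality; maximality then puts it in the domain already.\<close>
  have ext: "set c \<subseteq> ?D" if c: "isol ?D c" "set c \<subseteq> N" for c
  proof -
    have cM: "c \<in> tuples M (length c)" using c(2) N_bounds by (auto simp: tuples_def)
    obtain c' where c': "c' \<in> tuples M (length c)" "elem_rel (R \<union> set (zip c c'))"
      using elem_rel_extend[OF R(1) RM M cM c(1)] by blast
    have l: "length c' = length c" "set c' \<subseteq> M" using c'(1) by (auto simp: tuples_def)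
    have "eqtp A (map fst (zip c c')) (map snd (zip c c'))"
      using R(2) by (intro elem_rel_eqtp[OF c'(2)]) auto
    then have "set c' \<subseteq> N" using normal_set_tuple[OF N_normal c(2) l(2)] l(1) by simp
    then have "R \<union> set (zip c c') \<subseteq> N \<times> N"
      using R(3) c(2) by (auto dest: set_zip_leftD set_zip_rightD)
    then have "R \<union> set (zip c c') = R" using max c'(2) by blast
    then have "set (zip c c') \<subseteq> R" by blast
    then have "fst ` set (zip c c') \<subseteq> ?D" unfolding Domain_fst by (rule image_mono)
    then show ?thesis using l(1) by (simp flip: set_map)
  qed
  \<comment> \<open>Internal tuples over \<open>GX n\<close> have isolated type over the domain,
    whatever else the domain contains; the other elements of the next stage are then definable over
    the domain.\<close>
  have "GX n \<subseteq> ?D" for n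
  proof (induction n)
    case (Suc n)
    show ?case
    proof
      fix u assume u: "u \<in> GX (Suc n)"
      then obtain c d where c: "set c \<subseteq> M" "set d \<subseteq> GX n" "internal_over d c"
        "u \<in> dcl L U (GX n \<union> set c)" using GX_Suc by blast
      have "GX n \<union> set c \<subseteq> univ U" using c(1) M_univ GX_univ by blast
      from subset_dcl[OF this] have "set c \<subseteq> GX (Suc n)" using c(1-3) GX_Suc by blast
      then have cN: "set c \<subseteq> N" unfolding N_eq by blast
      have "isol ?D c" using c Suc D by (intro isol_internal[OF c(3)]) auto
      then have "set c \<subseteq> ?D" using ext cN by blast
      then have "u \<in> dcl L U ?D" using c(4) Suc dcl_mono[of "GX n \<union> set c" ?D] by blast
      moreover have "u \<in> N" using u unfolding N_eq by blast
      ultimately have "set [u] \<subseteq> ?D" by (intro ext isol_dcl) auto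
      then show "u \<in> ?D" by simp
    qed
  qed (use D in simp)
  then show ?thesis by (auto simp: N_eq)
qed

lemma aut_N_exists:
  assumes R0: "elem_rel R0" "Id_on A \<subseteq> R0" "R0 \<subseteq> N \<times> N"
  shows "\<exists>\<sigma> \<in> aut L U A N. \<forall>(a, b) \<in> R0. \<sigma> a = b"
proof -
  let ?S = "{R. R0 \<subseteq> R \<and> R \<subseteq> N \<times> N \<and> elem_rel R}"
  have "\<exists>R \<in> ?S. \<forall>R' \<in> ?S. R \<subseteq> R' \<longrightarrow> R' = R"
  proof (rule subset_Zorn_nonempty)
    show "?S \<noteq> {}" using R0 by blast
    fix \<C> assume ch: "\<C> \<noteq> {}" "subset.chain ?S \<C>"
    have C: "R0 \<subseteq> R \<and> R \<subseteq> N \<times> N \<and> elem_rel R" if "R \<in> \<C>" for R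
      using that ch(2) by (auto simp: subset.chain_def)
    have "eqtp {} (map fst ps) (map snd ps)" if ps: "set ps \<subseteq> \<Union>\<C>" for ps
    proof -
      obtain R where "R \<in> \<C>" "set ps \<subseteq> R"
        using finite_subset_Union_chain[OF finite_set ps ch] by blast
      then show ?thesis using C unfolding elem_rel_def by blast
    qed
    moreover have "\<Union>\<C> \<subseteq> univ U \<times> univ U" using C N_bounds M_univ by blast
    ultimately have "elem_rel (\<Union>\<C>)" by (simp add: elem_rel_def)
    then show "\<Union>\<C> \<in> ?S" using C ch(1) by blast
  qed
  then obtain R where "R \<in> ?S" and max: "\<forall>R' \<in> ?S. R \<subseteq> R' \<longrightarrow> R' = R" by (rule bexE)
  then have R: "R0 \<subseteq> R" "R \<subseteq> N \<times> N" "elem_rel R" by auto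
  have IdA: "Id_on A \<subseteq> R" using R0(2) R(1) by blast
  have max': "R' = R" if "elem_rel R'" "R \<subseteq> R'" "R' \<subseteq> N \<times> N" for R'
    using bspec[OF max, of R'] that R(1) by blast
  have dom: "N \<subseteq> Domain R" by (rule maximal_elem_rel_Domain[OF R(3) IdA R(2) max'])
  \<comment> \<open>The converse of a maximal relation is again maximal, so the range is everything
    as well.\<close>
  have ran: "N \<subseteq> Domain (R\<inverse>)"
  proof (rule maximal_elem_rel_Domain[OF elem_rel_converse[OF R(3)]])
    fix R' assume R': "elem_rel R'" "R\<inverse> \<subseteq> R'" "R' \<subseteq> N \<times> N"
    have "R'\<inverse> = R"
      by (rule max'[OF elem_rel_converse[OF R'(1)]]) (use R'(2,3) in auto)
    then show "R' = R\<inverse>" by auto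
  qed (use IdA R(2) in auto)
  define \<sigma> where "\<sigma> a = (if a \<in> N then THE b. (a, b) \<in> R else a)" for a
  have \<sigma>: "\<sigma> a = b" if "(a, b) \<in> R" for a b
    using that R(2) elem_rel_functional[OF R(3)] by (auto simp: \<sigma>_def)
  have \<sigma>R: "(a, \<sigma> a) \<in> R" if "a \<in> N" for a using that dom \<sigma> by auto
  have "bij_betw \<sigma> N N"
  proof (rule bij_betwI')
    show "\<sigma> a \<in> N" if "a \<in> N" for a using \<sigma>R[OF that] R(2) by blast
    show "\<sigma> a = \<sigma> b \<longleftrightarrow> a = b" if "a \<in> N" "b \<in> N" for a b
      using \<sigma>R[OF that(1)] \<sigma>R[OF that(2)] elem_rel_functional[OF elem_rel_converse[OF R(3)]]
      by (metis converse_iff)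
    show "\<exists>a \<in> N. b = \<sigma> a" if "b \<in> N" for b
      using that ran \<sigma> R(2) by blast
  qed
  then have "\<sigma> permutes N" by (rule bij_imp_permutes) (simp add: \<sigma>_def)
  moreover have "elementary_map L U N \<sigma>"
    unfolding elementary_map_def
  proof (intro conjI allI impI ballI)
    show "\<sigma> ` N \<subseteq> univ U" using \<sigma>R R(2) N_bounds M_univ by blast
    fix n \<phi> x assume \<phi>: "wf_form L n \<phi>" and x: "x \<in> tuples N n"
    have "set (map (\<lambda>a. (a, \<sigma> a)) x) \<subseteq> R" using x \<sigma>R by (auto simp: tuples_def)
    then have "eqtp {} (map fst (map (\<lambda>a. (a, \<sigma> a)) x)) (map snd (map (\<lambda>a. (a, \<sigma> a)) x))"
      using R(3) by (simp only: elem_rel_def)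
    then have "eqtp {} x (map \<sigma> x)" by (simp add: o_def)
    moreover have "def_pred {} (length x) (sat U \<phi>)"
      using \<phi> x by (intro def_predI[of "[]"]) (auto simp: tuples_def)
    ultimately show "sat U \<phi> x \<longleftrightarrow> sat U \<phi> (map \<sigma> x)" by (rule eqtpD)
  qed
  moreover have "\<forall>a \<in> A. \<sigma> a = a" using \<sigma> IdA by auto
  ultimately have "\<sigma> \<in> aut L U A N" by (simp add: aut_def)
  then show ?thesis using \<sigma> R(1) by blast
qed

lemma aut_eqtp:
  assumes "\<sigma> \<in> aut L U A B" "A \<subseteq> B" "B \<subseteq> univ U" "set x \<subseteq> B"
  shows "eqtp A x (map \<sigma> x)"
  using assms by (intro elementary_map_eqtp[of B]) (auto simp: aut_def)

text \<open>Cocycles require agreement on one finite tuple only, so the starting relation for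
  \<open>aut_N_exists\<close> is the graph of \<open>\<tau>\<close> on \<open>A\<close> and
  \<open>b\<close>.\<close>

lemma aut_extend_finite:
  assumes \<tau>: "\<tau> \<in> aut L U A D" and D: "A \<subseteq> D" "D \<subseteq> N" and b: "set b \<subseteq> D"
  obtains \<sigma> where "\<sigma> \<in> aut L U A N" "map \<sigma> b = map \<tau> b"
proof -
  have DU: "D \<subseteq> univ U" using D N_bounds M_univ by blast
  have \<tau>D: "\<tau> a \<in> D" if "a \<in> D" for a using \<tau> that by (auto simp: aut_def permutes_in_image)
  have \<tau>A: "\<tau> a = a" if "a \<in> A" for a using \<tau> that by (simp add: aut_def)
  let ?R = "Id_on A \<union> set (zip b (map \<tau> b))"
  have RD: "p \<in> ?R \<Longrightarrow> fst p \<in> D \<and> snd p = \<tau> (fst p)" for p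
    using \<tau>A D(1) b by (auto simp: zip_map2 zip_same_conv_map)
  have R: "?R \<subseteq> D \<times> D" using RD \<tau>D by fastforce
  have "eqtp {} (map fst ps) (map snd ps)" if ps: "set ps \<subseteq> ?R" for ps
  proof -
    have eq: "map snd ps = map \<tau> (map fst ps)" and sub: "set (map fst ps) \<subseteq> D"
      using ps RD by force+
    show ?thesis unfolding eq by (rule eqtp_mono[OF aut_eqtp[OF \<tau> D(1) DU sub]]) simp
  qed
  moreover have "?R \<subseteq> univ U \<times> univ U" using R DU by blast
  ultimately have "elem_rel ?R" by (simp add: elem_rel_def)
  then obtain \<sigma> where \<sigma>: "\<sigma> \<in> aut L U A N" "\<forall>(a, b) \<in> ?R. \<sigma> a = b"
    using aut_N_exists[of ?R] R D(2) by blast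
  have "map \<sigma> b = map \<tau> b"
  proof (rule map_cong[OF refl])
    fix a assume "a \<in> set b"
    then have "(a, \<tau> a) \<in> ?R" by (auto simp: zip_map2 zip_same_conv_map)
    from bspec[OF \<sigma>(2) this] show "\<sigma> a = \<tau> a" by simp
  qed
  then show ?thesis using that \<sigma>(1) by blast
qed

section \<open>Iterated extensions of finite type and their normal closures\<close>

abbreviation iterated :: "'m set \<Rightarrow> bool" where
  "iterated \<equiv> iterated_galois_ext_ft L U X M A"

lemma iterated_base: "iterated A"
  unfolding iterated_galois_ext_ft_def using AM dcl_A
  by (intro conjI exI[of _ 0] exI[of _ "\<lambda>_. A"]) auto

lemma iteratedE:
  assumes "iterated B"
  obtains n C where "C 0 = A" "C n = B" "\<And>i. i \<le> n \<Longrightarrow> dcl L U (C i) = C i"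
    "\<And>i. i < n \<Longrightarrow> C i \<subseteq> C (Suc i)" "\<And>i. i < n \<Longrightarrow> galois_ext_ft L U X (C i) (C (Suc i))"
proof -
  have "\<exists>n C. C 0 = A \<and> C n = B \<and> (\<forall>i \<le> n. dcl L U (C i) = C i) \<and>
      (\<forall>i < n. C i \<subseteq> C (Suc i) \<and> galois_ext_ft L U X (C i) (C (Suc i)))"
    using assms unfolding iterated_galois_ext_ft_def by (rule conjunct2)
  then obtain n C where C: "C 0 = A" "C n = B" "\<forall>i \<le> n. dcl L U (C i) = C i"
    "\<forall>i < n. C i \<subseteq> C (Suc i) \<and> galois_ext_ft L U X (C i) (C (Suc i))" by (elim exE conjE)
  then show ?thesis using that[of C n] by simp
qed

lemma iterated_bounds:
  assumes "iterated B"
  shows "A \<subseteq> B" "B \<subseteq> M" "dcl L U B = B"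
proof -
  obtain n C where C: "C 0 = A" "C n = B" "\<And>i. i \<le> n \<Longrightarrow> dcl L U (C i) = C i"
    "\<And>i. i < n \<Longrightarrow> C i \<subseteq> C (Suc i)" using assms by (rule iteratedE) blast
  have "i \<le> n \<Longrightarrow> A \<subseteq> C i" for i
  proof (induction i)
    case (Suc i)
    then show ?case using C(4)[of i] by auto
  qed (use C(1) in simp)
  then show "A \<subseteq> B" using C(2) by blast
  show "dcl L U B = B" using C(2,3) by blast
  show "B \<subseteq> M" using assms by (simp add: iterated_galois_ext_ft_def)
qed

lemma iterated_step:
  assumes B: "iterated B" and c: "set c \<subseteq> M" "set d \<subseteq> B" "internal_over d c"
  shows "iterated (dcl L U (B \<union> set c))"
proof -
  let ?E = "dcl L U (B \<union> set c)"
  obtain n C where C: "C 0 = A" "C n = B" "\<And>i. i \<le> n \<Longrightarrow> dcl L U (C i) = C i"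
    "\<And>i. i < n \<Longrightarrow> C i \<subseteq> C (Suc i)" "\<And>i. i < n \<Longrightarrow> galois_ext_ft L U X (C i) (C (Suc i))"
    using B by (rule iteratedE) blast
  note Bb = iterated_bounds[OF B]
  have U: "B \<union> set c \<subseteq> univ U" using Bb c(1) M_univ by blast
  define C' where "C' = C(Suc n := ?E)"
  have "galois_ext_ft L U X B ?E" using galois_ext_ftI[OF c Bb(1,2)] .
  moreover have "B \<subseteq> ?E" using subset_dcl[OF U] by blast
  moreover have "?E \<subseteq> M" using dcl_subset_M Bb c(1) by auto
  ultimately show ?thesis
    unfolding iterated_galois_ext_ft_def
    using C dcl_dcl[OF U]
    by (intro conjI exI[of _ "Suc n"] exI[of _ C']) (auto simp: C'_def less_Suc_eq le_Suc_eq)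
qed

text \<open>All members of the chain lie in its last set \<open>B\<close> and hence in
  \<open>M\<close>, so each link is the adjunction of an internal tuple by
  \<open>galois_ext_ftD\<close>.\<close>

lemma iterated_induct [consumes 1, case_names base step]:
  assumes B: "iterated B" and base: "P A"
    and step: "\<And>B c d. iterated B \<Longrightarrow> P B \<Longrightarrow> set c \<subseteq> M \<Longrightarrow> set d \<subseteq> B \<Longrightarrow> internal_over d c \<Longrightarrow>
      P (dcl L U (B \<union> set c))"
  shows "P B"
proof -
  obtain n C where C: "C 0 = A" "C n = B" "\<And>i. i \<le> n \<Longrightarrow> dcl L U (C i) = C i"
    "\<And>i. i < n \<Longrightarrow> C i \<subseteq> C (Suc i)" "\<And>i. i < n \<Longrightarrow> galois_ext_ft L U X (C i) (C (Suc i))"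
    using B by (rule iteratedE) blast
  have BM: "B \<subseteq> M" using iterated_bounds[OF B] by blast
  have "i \<le> n \<Longrightarrow> C i \<subseteq> B" for i
    by (induction i rule: inc_induct) (use C(2,4) in auto)
  then have CM: "i \<le> n \<Longrightarrow> C i \<subseteq> M" for i using BM by blast
  have "i \<le> n \<Longrightarrow> iterated (C i) \<and> P (C i)" for i
  proof (induction i)
    case 0
    then show ?case using C(1) base iterated_base by simp
  next
    case (Suc i)
    then have IH: "iterated (C i)" "P (C i)" by auto
    have "galois_ext_ft L U X (C i) (C (Suc i))" "C (Suc i) \<subseteq> M" "A \<subseteq> C i" "C i \<subseteq> M"
      using Suc.prems C(5) CM iterated_bounds[OF IH(1)] by auto
    then obtain c d where "set c \<subseteq> M" "set d \<subseteq> C i" "internal_over d c"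
      "C (Suc i) = dcl L U (C i \<union> set c)" using galois_ext_ftD by metis
    then show ?case using step[OF IH] iterated_step[OF IH(1)] by auto
  qed
  then show ?thesis using C(2) by blast
qed

text \<open>The steps leading to \<open>C\<close> are repeated on top of \<open>B\<close>:
  \<open>internal_over d c\<close> refers only to the finite base \<open>d\<close> and survives any
  enlargement of the ground set.\<close>

lemma iterated_directed:
  assumes "iterated B" "iterated C"
  shows "\<exists>D. iterated D \<and> B \<subseteq> D \<and> C \<subseteq> D"
  using assms(2)
proof (induction rule: iterated_induct)
  case base
  show ?case using assms(1) iterated_bounds(1)[OF assms(1)] by blast
next
  case (step C c d)
  then obtain D where D: "iterated D" "B \<subseteq> D" "C \<subseteq> D" by blast
  have "set d \<subseteq> D" using \<open>set d \<subseteq> C\<close> D(3) by blast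
  with D(1) \<open>set c \<subseteq> M\<close> have "iterated (dcl L U (D \<union> set c))"
    using \<open>internal_over d c\<close> by (rule iterated_step)
  moreover have "D \<union> set c \<subseteq> dcl L U (D \<union> set c)"
    using iterated_bounds[OF D(1)] step M_univ by (intro subset_dcl) blast
  moreover have "dcl L U (C \<union> set c) \<subseteq> dcl L U (D \<union> set c)" using D by (intro dcl_mono) blast
  ultimately show ?case using D by blast
qed

lemma iterated_subset_N:
  assumes "iterated B"
  shows "B \<subseteq> N"
proof -
  have "\<exists>n. B \<subseteq> GX n"
    using assms
  proof (induction rule: iterated_induct)
    case base
    then show ?case using GX_bounds by blast
  next
    case (step B c d)
    then obtain n where n: "B \<subseteq> GX n" by blast
    then have "dcl L U (B \<union> set c) \<subseteq> dcl L U (GX n \<union> set c)" by (intro dcl_mono) blast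
    also have "\<dots> \<subseteq> GX (Suc n)"
    proof
      fix u assume "u \<in> dcl L U (GX n \<union> set c)"
      then show "u \<in> GX (Suc n)" using GX_Suc n step by blast
    qed
    finally show ?case by blast
  qed
  then show ?thesis by (auto simp: N_eq)
qed

lemma iterated_covers_list:
  assumes "\<And>u. u \<in> S \<Longrightarrow> \<exists>B. iterated B \<and> u \<in> B" "set x \<subseteq> S"
  shows "\<exists>B. iterated B \<and> set x \<subseteq> B"
  using assms(2)
proof (induction x)
  case Nil
  then show ?case using iterated_base by auto
next
  case (Cons u x)
  then obtain C where C: "iterated C" "set x \<subseteq> C" by auto
  obtain B where B: "iterated B" "u \<in> B" using assms(1)[of u] Cons.prems by auto
  obtain D where "iterated D" "B \<subseteq> D" "C \<subseteq> D" using iterated_directed[OF B(1) C(1)] by blast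
  then show ?case using B(2) C(2) by (intro exI[of _ D]) auto
qed

text \<open>An element of the next stage depends on the base of one internal tuple and on finitely
  many defining parameters from the current stage, all of which lie in a single iterated extension
  by directedness.\<close>

lemma iterated_covers_N:
  assumes "set x \<subseteq> N"
  shows "\<exists>B. iterated B \<and> set x \<subseteq> B"
proof (rule iterated_covers_list[OF _ assms])
  have "\<exists>B. iterated B \<and> u \<in> B" if "u \<in> GX n" for u n
    using that
  proof (induction n arbitrary: u)
    case 0
    then show ?case using iterated_base by auto
  next
    case (Suc n)
    obtain c d where c: "set c \<subseteq> M" "set d \<subseteq> GX n" "internal_over d c"
      "u \<in> dcl L U (GX n \<union> set c)" using Suc.prems GX_Suc by blast
    have "u \<in> dcl L U (set c \<union> GX n)" using c(4) by (simp add: Un_commute)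
    then obtain e where e: "set e \<subseteq> GX n" "u \<in> dcl L U (set c \<union> set e)"
      by (rule dcl_finite) (use c(1) M_univ GX_univ in auto)
    obtain B where B: "iterated B" "set (d @ e) \<subseteq> B"
      using iterated_covers_list[of "GX n" "d @ e"] Suc.IH c(2) e(1) by auto
    have "iterated (dcl L U (B \<union> set c))" using iterated_step[OF B(1) c(1) _ c(3)] B(2) by auto
    moreover have "u \<in> dcl L U (B \<union> set c)"
      using e(2) dcl_mono[of "set c \<union> set e" "B \<union> set c"] B(2) by auto
    ultimately show ?case by blast
  qed
  then show "\<exists>B. iterated B \<and> u \<in> B" if "u \<in> N" for u using that by (auto simp: N_eq)
qed

text \<open>Finitely many elements of \<open>N\<close> lie in one iterated extension, which is
  \<open>dcl\<close>-closed. Together with \<open>N_normal\<close> this makes \<open>N\<close> one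
  of the sets intersected in a normal closure.\<close>

lemma dcl_N: "dcl L U N = N"
proof
  have NU: "N \<subseteq> univ U" using N_bounds M_univ by blast
  then show "N \<subseteq> dcl L U N" by (rule subset_dcl)
  show "dcl L U N \<subseteq> N"
  proof
    fix u assume "u \<in> dcl L U N"
    then have "u \<in> dcl L U ({} \<union> N)" by simp
    then obtain c where c: "set c \<subseteq> N" "u \<in> dcl L U ({} \<union> set c)"
      by (rule dcl_finite) (use NU in auto)
    obtain B where B: "iterated B" "set c \<subseteq> B" using iterated_covers_N[OF c(1)] by blast
    then have "u \<in> B" using c(2) dcl_mono[of "{} \<union> set c" B] iterated_bounds[OF B(1)] by auto
    then show "u \<in> N" using iterated_subset_N[OF B(1)] by blast
  qed
qed

lemma normal_closure_props:
  assumes "iterated B"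
  shows "B \<subseteq> normal_closure L U A M B" "normal_closure L U A M B \<subseteq> N"
    "normal_set L U A M (normal_closure L U A M B)"
proof -
  have mem: "b \<in> normal_closure L U A M B \<longleftrightarrow>
      (\<forall>C. normal_set L U A M C \<longrightarrow> dcl L U C = C \<longrightarrow> B \<subseteq> C \<longrightarrow> b \<in> C)" for b
    by (auto simp: normal_closure_def)
  show "B \<subseteq> normal_closure L U A M B" by (auto simp: mem)
  show sub: "normal_closure L U A M B \<subseteq> N"
    using N_normal dcl_N iterated_subset_N[OF assms] by (auto simp: mem)
  show "normal_set L U A M (normal_closure L U A M B)"
    unfolding normal_set_iff
  proof (intro conjI ballI impI)
    show "A \<subseteq> normal_closure L U A M B" using iterated_bounds(1)[OF assms] unfolding mem subset_iff by blast
    show "normal_closure L U A M B \<subseteq> M" using sub N_bounds by blast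
    fix b b' assume b: "b \<in> normal_closure L U A M B" "b' \<in> M" "eqtp A [b] [b']"
    show "b' \<in> normal_closure L U A M B"
      unfolding mem
    proof (intro allI impI)
      fix C assume C: "normal_set L U A M C" "dcl L U C = C" "B \<subseteq> C"
      then have "b \<in> C" using b(1) by (simp add: mem)
      then show "b' \<in> C" using C(1) b(2,3) by (auto simp: normal_set_iff)
    qed
  qed
qed

abbreviation \<G> :: "'m set set" where "\<G> \<equiv> galois_family L U X M A"

lemma galois_family_bounds:
  assumes "B \<in> \<G>"
  shows "A \<subseteq> B" "B \<subseteq> N" "normal_set L U A M B"
proof -
  obtain C where C: "iterated C" "B = normal_closure L U A M C"
    using assms by (auto simp: galois_family_def)
  show "B \<subseteq> N" "normal_set L U A M B" using normal_closure_props(2,3)[OF C(1)] C(2) by simp_all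
  then show "A \<subseteq> B" by (simp add: normal_set_iff)
qed

lemma galois_family_directed: "directed_family \<G>"
  unfolding directed_family_def
proof (intro conjI ballI)
  show "\<G> \<noteq> {}" using iterated_base by (auto simp: galois_family_def)
  fix B C assume "B \<in> \<G>" "C \<in> \<G>"
  then obtain B' C' where BC: "iterated B'" "B = normal_closure L U A M B'"
    "iterated C'" "C = normal_closure L U A M C'" by (auto simp: galois_family_def)
  obtain D' where D': "iterated D'" "B' \<subseteq> D'" "C' \<subseteq> D'" using iterated_directed[OF BC(1,3)] by blast
  have "B \<subseteq> normal_closure L U A M D'" "C \<subseteq> normal_closure L U A M D'"
    using D' BC unfolding normal_closure_def by blast+
  moreover have "normal_closure L U A M D' \<in> \<G>" using D' by (auto simp: galois_family_def)
  ultimately show "\<exists>D \<in> \<G>. B \<subseteq> D \<and> C \<subseteq> D" by blast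
qed

lemma galois_family_covers_N:
  assumes "set x \<subseteq> N"
  obtains B where "B \<in> \<G>" "set x \<subseteq> B"
proof -
  obtain B where B: "iterated B" "set x \<subseteq> B" using iterated_covers_N[OF assms] by blast
  then show ?thesis
    using that[of "normal_closure L U A M B"] normal_closure_props(1)[OF B(1)]
    by (auto simp: galois_family_def)
qed

end


section \<open>Direct limits\<close>

text \<open>Two elements are identified in the limit exactly if they have the same image in
  \<open>H\<close>: injectivity of \<open>F\<close> at a common upper bound turns equal images into
  equal transition values. Thus the limit is the set of fibres of one map onto
  \<open>H\<close>.\<close>

lemma dirlim_pointed_iso:
  assumes dir: "directed_family I"
    and F: "\<And>B x. B \<in> I \<Longrightarrow> x \<in> S B \<Longrightarrow> F B x \<in> H"
    and t: "\<And>B C x. B \<in> I \<Longrightarrow> C \<in> I \<Longrightarrow> B \<subseteq> C \<Longrightarrow> x \<in> S B \<Longrightarrow> t B C x \<in> S C \<and> F C (t B C x) = F B x"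
    and inj: "\<And>B. B \<in> I \<Longrightarrow> inj_on (F B) (S B)"
    and surj: "\<And>y. y \<in> H \<Longrightarrow> \<exists>B \<in> I. \<exists>x \<in> S B. F B x = y"
    and pt: "\<And>B. B \<in> I \<Longrightarrow> pt B \<in> S B \<and> F B (pt B) = q"
  shows "pointed_iso (dirlim I S t, dirlim_pt I S t pt) (H, q)"
proof -
  let ?E = "Sigma I S" and ?r = "dirlim_rel I S t"
  \<comment> \<open>\<open>K\<close> is constant on the classes of \<open>dirlim_rel\<close> and
    separates them.\<close>
  define K where "K p = F (fst p) (snd p)" for p
  have r: "(p, p') \<in> ?r \<longleftrightarrow> p \<in> ?E \<and> p' \<in> ?E \<and> K p = K p'" for p p'
  proof -
    obtain B x C y where p: "p = (B, x)" "p' = (C, y)" by (cases p, cases p')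
    have "(\<exists>D \<in> I. B \<subseteq> D \<and> C \<subseteq> D \<and> t B D x = t C D y) \<longleftrightarrow> F B x = F C y"
      if B: "B \<in> I" "x \<in> S B" and C: "C \<in> I" "y \<in> S C"
    proof
      assume "\<exists>D \<in> I. B \<subseteq> D \<and> C \<subseteq> D \<and> t B D x = t C D y"
      then obtain D where "D \<in> I" "B \<subseteq> D" "C \<subseteq> D" "t B D x = t C D y" by blast
      then show "F B x = F C y" using t[OF B(1) _ _ B(2), of D] t[OF C(1) _ _ C(2), of D] by simp
    next
      assume eq: "F B x = F C y"
      obtain D where D: "D \<in> I" "B \<subseteq> D" "C \<subseteq> D"
        using dir B(1) C(1) unfolding directed_family_def by blast
      then have "t B D x = t C D y"
        using t[OF B(1) D(1,2) B(2)] t[OF C(1) D(1,3) C(2)] eq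
        by (intro inj_onD[OF inj[OF D(1)]]) auto
      then show "\<exists>D \<in> I. B \<subseteq> D \<and> C \<subseteq> D \<and> t B D x = t C D y" using D by blast
    qed
    then show ?thesis by (auto simp: p dirlim_rel_def K_def)
  qed
  have cls: "?r `` {p} = {p' \<in> ?E. K p' = K p}" if "p \<in> ?E" for p
    using that by (auto simp: r)
  define f where "f Z = the_elem (K ` Z)" for Z
  have f: "f (?r `` {p}) = K p" if "p \<in> ?E" for p
  proof -
    have "K ` (?r `` {p}) = {K p}" using that by (auto simp: cls)
    then show ?thesis by (simp add: f_def)
  qed
  have "bij_betw f (dirlim I S t) H"
  proof (rule bij_betw_imageI)
    show "inj_on f (dirlim I S t)"
    proof (rule inj_onI)
      fix Z Z' assume Z: "Z \<in> dirlim I S t" "Z' \<in> dirlim I S t" "f Z = f Z'"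
      obtain p where p: "p \<in> ?E" "Z = ?r `` {p}" using Z(1) unfolding dirlim_def by (rule quotientE)
      obtain p' where p': "p' \<in> ?E" "Z' = ?r `` {p'}" using Z(2) unfolding dirlim_def by (rule quotientE)
      have "K p = K p'" using Z(3) f[OF p(1)] f[OF p'(1)] p(2) p'(2) by simp
      then show "Z = Z'" using p p' by (simp add: cls)
    qed
    show "f ` dirlim I S t = H"
    proof (intro equalityI subsetI)
      fix y assume "y \<in> f ` dirlim I S t"
      then obtain Z where Z: "Z \<in> dirlim I S t" "y = f Z" by blast
      obtain p where p: "p \<in> ?E" "Z = ?r `` {p}" using Z(1) unfolding dirlim_def by (rule quotientE)
      then show "y \<in> H" using Z(2) F by (auto simp: f K_def)
    next
      fix y assume "y \<in> H"
      then obtain B x where "B \<in> I" "x \<in> S B" "F B x = y" using surj by blast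
      then show "y \<in> f ` dirlim I S t"
        using f[of "(B, x)"] unfolding dirlim_def
        by (intro image_eqI[OF _ quotientI[of "(B, x)"]]) (auto simp: K_def)
    qed
  qed
  moreover obtain B0 where B0: "B0 \<in> I" using dir by (auto simp: directed_family_def)
  then have p0: "(B0, pt B0) \<in> ?E" "K (B0, pt B0) = q" using pt by (auto simp: K_def)
  have "dirlim_pt I S t pt = ?r `` {(B0, pt B0)}"
    using pt p0 unfolding dirlim_pt_def by (auto simp: r K_def Image_iff)
  then have "f (dirlim_pt I S t pt) = q" "dirlim_pt I S t pt \<in> dirlim I S t"
    using f[OF p0(1)] p0 by (auto simp: dirlim_def intro: quotientI)
  moreover have "q \<in> H" using F[OF B0] pt[OF B0] by blast
  ultimately show ?thesis unfolding pointed_iso_def by auto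
qed

section \<open>Cohomology\<close>

locale cohomology_setting = prime_setting L U A M X
  for L :: "('f, 'r) language" and U :: "('m, 'f, 'r) interp" and A M X +
  fixes G :: "'m list monoid" (structure) and k :: nat
  assumes G_def: "definable_group L U A k G" and lives: "lives_on L U A X G"
begin

lemma group_G: "group G"
  using G_def by (simp add: definable_group_def)

sublocale group G
  by (rule group_G)

section \<open>The group of points over A\<close>

abbreviation GA :: "'m list set" where "GA \<equiv> points (carrier G) A"

lemma carrier_tup: "carrier G \<subseteq> tup k"
  using G_def by (simp add: definable_group_def definable_iff_def_pred)

text \<open>As \<open>G\<close> lives on \<open>X\<close>, a point of \<open>G\<close> has its
  coordinates in the definable closure of \<open>A\<close> and \<open>V\<close>; for coordinates in
  \<open>M\<close>, \<open>dcl_V_M\<close> removes \<open>V\<close>.\<close>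

lemma points_eq: "A \<subseteq> B \<Longrightarrow> B \<subseteq> M \<Longrightarrow> points (carrier G) B = GA"
proof
  assume B: "A \<subseteq> B" "B \<subseteq> M"
  show "points (carrier G) B \<subseteq> GA"
  proof
    fix g assume "g \<in> points (carrier G) B"
    then have g: "g \<in> carrier G" "set g \<subseteq> B" by (auto simp: points_def)
    have "set g \<subseteq> coords (carrier G)" using g(1) by (auto simp: coords_def)
    then have "set g \<subseteq> dcl L U (A \<union> V)" using lives by (auto simp: lives_on_def)
    then have "set g \<subseteq> A" using dcl_V_M[OF _ _ order_refl AM] g(2) B(2) dcl_A by blast
    then show "g \<in> GA" using g by (simp add: points_def)
  qed
qed (auto simp: points_def)

lemma mult_graph:
  defines "S \<equiv> {x @ y @ (x \<otimes> y) | x y. x \<in> carrier G \<and> y \<in> carrier G}"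
  shows "def_pred A (k + (k + k)) (\<lambda>w. w \<in> S)"
    "\<And>x y z. x \<in> tup k \<Longrightarrow> y \<in> tup k \<Longrightarrow> z \<in> tup k \<Longrightarrow>
      x @ y @ z \<in> S \<longleftrightarrow> x \<in> carrier G \<and> y \<in> carrier G \<and> z = x \<otimes> y"
proof -
  have 3: "k + (k + k) = 3 * k" by simp
  show "def_pred A (k + (k + k)) (\<lambda>w. w \<in> S)"
    unfolding 3 using G_def by (simp add: definable_group_def definable_iff_def_pred S_def)
  have len: "length x = k" if "x \<in> carrier G" for x
    using that carrier_tup by (auto simp: tuples_def)
  show "x @ y @ z \<in> S \<longleftrightarrow> x \<in> carrier G \<and> y \<in> carrier G \<and> z = x \<otimes> y"
    if "x \<in> tup k" "y \<in> tup k" "z \<in> tup k" for x y z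
  proof
    assume "x @ y @ z \<in> S"
    then obtain x' y' where "x @ y @ z = x' @ y' @ (x' \<otimes> y')" "x' \<in> carrier G" "y' \<in> carrier G"
      by (auto simp: S_def)
    moreover have "length x = length x'" "length y = length y'"
      using that len \<open>x' \<in> carrier G\<close> \<open>y' \<in> carrier G\<close> by (auto simp: tuples_def)
    ultimately show "x \<in> carrier G \<and> y \<in> carrier G \<and> z = x \<otimes> y" by simp
  qed (auto simp: S_def)
qed

lemma GA_I:
  assumes "g \<in> carrier G" "def_pred A k P" "P g" "\<And>z. z \<in> tup k \<Longrightarrow> P z \<Longrightarrow> z = g"
  shows "g \<in> GA"
proof -
  have "set g \<subseteq> dcl L U A"
    by (rule dcl_tupleI[OF A_univ _ assms(2,3)]) (use assms(1,4) carrier_tup in auto)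
  then show ?thesis using assms(1) dcl_A by (simp add: points_def)
qed

lemma GA_carrier: "g \<in> GA \<Longrightarrow> g \<in> carrier G"
  by (simp add: points_def)

lemma GA_tup: "g \<in> GA \<Longrightarrow> g \<in> tup k \<and> set g \<subseteq> A \<and> length g = k"
  using carrier_tup by (auto simp: points_def tuples_def)

lemma GA_mult: 
  assumes "x \<in> GA" "y \<in> GA"
  shows "x \<otimes> y \<in> GA"
proof (rule GA_I)
  note xy = GA_tup[OF assms(1)] GA_tup[OF assms(2)] GA_carrier[OF assms(1)] GA_carrier[OF assms(2)]
  let ?P = "\<lambda>z. x @ y @ z \<in> {x @ y @ (x \<otimes> y) | x y. x \<in> carrier G \<and> y \<in> carrier G}"
  show "def_pred A k ?P"
    using xy by (intro def_pred_sel[OF mult_graph(1) sel_append[OF sel_const sel_append[OF sel_const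
        sel_id refl]] A_univ]) auto
  show "x \<otimes> y \<in> carrier G" using xy by simp
  then have "x \<otimes> y \<in> tup k" using carrier_tup by blast
  then show "?P (x \<otimes> y)" using mult_graph(2) xy by blast
  show "z = x \<otimes> y" if "z \<in> tup k" "?P z" for z using mult_graph(2) xy that by blast
qed

lemma GA_one: "\<one> \<in> GA"
proof (rule GA_I)
  \<comment> \<open>The identity is singled out as the only idempotent of \<open>G\<close>.\<close>
  let ?P = "\<lambda>z. z @ z @ z \<in> {x @ y @ (x \<otimes> y) | x y. x \<in> carrier G \<and> y \<in> carrier G}"
  show "def_pred A k ?P"
    by (intro def_pred_sel[OF mult_graph(1) sel_append[OF sel_id sel_append[OF sel_id
        sel_id refl]] A_univ]) auto
  show "\<one> \<in> carrier G" by simp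
  then have "\<one> \<in> tup k" using carrier_tup by blast
  then show "?P \<one>" using mult_graph(2)[of \<one> \<one> \<one>] by simp
  show "z = \<one>" if "z \<in> tup k" "?P z" for z
  proof -
    have "z \<in> carrier G" "z = z \<otimes> z" using mult_graph(2) that by blast+
    then show ?thesis by (metis l_cancel_one)
  qed
qed

lemma GA_inv:
  assumes "x \<in> GA"
  shows "inv x \<in> GA"
proof (rule GA_I)
  note x = GA_tup[OF assms] GA_carrier[OF assms] GA_tup[OF GA_one]
  let ?P = "\<lambda>z. x @ z @ \<one> \<in> {x @ y @ (x \<otimes> y) | x y. x \<in> carrier G \<and> y \<in> carrier G}"
  show "def_pred A k ?P"
    using x by (intro def_pred_sel[OF mult_graph(1) sel_append[OF sel_const sel_append[OF sel_id
        sel_const refl]] A_univ]) auto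
  show c: "inv x \<in> carrier G" using x by simp
  then have "inv x \<in> tup k" using carrier_tup by blast
  then show "?P (inv x)" using mult_graph(2)[of x "inv x" \<one>] x c by simp
  show "z = inv x" if "z \<in> tup k" "?P z" for z
  proof -
    have "z \<in> carrier G" "\<one> = x \<otimes> z" using mult_graph(2)[of x z \<one>] that x by blast+
    then show ?thesis using x by (metis inv_equality inv_inv l_inv_ex inv_comm)
  qed
qed

section \<open>Automorphism groups and definable cocycles\<close>

abbreviation \<Gamma> :: "'m set \<Rightarrow> ('m \<Rightarrow> 'm) set" where "\<Gamma> \<equiv> aut L U A"

abbreviation Z :: "'m set \<Rightarrow> 'm cochain set" where "Z \<equiv> def_cocycles L U G A"

abbreviation coh :: "'m set \<Rightarrow> 'm cochain rel" where "coh \<equiv> cohomologous L U G A"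

lemma aut_GA: "\<sigma> \<in> \<Gamma> B \<Longrightarrow> g \<in> GA \<Longrightarrow> map \<sigma> g = g"
  using GA_tup[of g] by (intro map_idI) (auto simp: aut_def)

lemma aut_comp:
  assumes "\<sigma> \<in> \<Gamma> B" "\<tau> \<in> \<Gamma> B"
  shows "\<sigma> \<circ> \<tau> \<in> \<Gamma> B"
proof -
  have p: "\<sigma> permutes B" "\<tau> permutes B" using assms by (auto simp: aut_def)
  have \<tau>B: "map \<tau> x \<in> tuples B n" if "x \<in> tuples B n" for x n
    using that p(2) by (auto simp: tuples_def permutes_in_image)
  have "elementary_map L U B (\<sigma> \<circ> \<tau>)"
    unfolding elementary_map_def
  proof (intro conjI allI impI ballI)
    show "(\<sigma> \<circ> \<tau>) ` B \<subseteq> univ U"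
      using assms p(2) by (auto simp: aut_def elementary_map_def permutes_in_image)
    fix n \<phi> x assume \<phi>: "wf_form L n \<phi>" and x: "x \<in> tuples B n"
    have "sat U \<phi> x \<longleftrightarrow> sat U \<phi> (map \<tau> x)"
      using assms(2) \<phi> x by (simp add: aut_def elementary_map_def)
    also have "\<dots> \<longleftrightarrow> sat U \<phi> (map \<sigma> (map \<tau> x))"
      using assms(1) \<phi> \<tau>B[OF x] unfolding aut_def elementary_map_def by blast
    finally show "sat U \<phi> x \<longleftrightarrow> sat U \<phi> (map (\<sigma> \<circ> \<tau>) x)" by simp
  qed
  then show ?thesis using assms permutes_compose[OF p(2,1)] by (simp add: aut_def)
qed

text \<open>Normality of \<open>B\<close>, applied to \<open>\<sigma>\<close> and to its inverse,
  shows that \<open>\<sigma>\<close> maps \<open>B\<close> onto itself.\<close>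

lemma aut_restrict:
  assumes B: "normal_set L U A M B" "B \<subseteq> C" "C \<subseteq> M" and \<sigma>: "\<sigma> \<in> \<Gamma> C"
  shows "restrict_id \<sigma> B \<in> \<Gamma> B"
proof -
  have p: "\<sigma> permutes C" using \<sigma> by (simp add: aut_def)
  have AC: "A \<subseteq> C" and CU: "C \<subseteq> univ U" using B M_univ by (auto simp: normal_set_iff)
  have eq: "eqtp A [b] [\<sigma> b]" if "b \<in> C" for b
    using aut_eqtp[OF \<sigma> AC CU, of "[b]"] that by simp
  have "bij_betw \<sigma> B B"
  proof (rule bij_betw_imageI)
    show "inj_on \<sigma> B" using permutes_inj[OF p] by (auto intro: inj_on_subset)
    show "\<sigma> ` B = B"
    proof
      show "\<sigma> ` B \<subseteq> B"
      proof
        fix b' assume "b' \<in> \<sigma> ` B"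
        then obtain b where b: "b \<in> B" "b' = \<sigma> b" by blast
        then have "b \<in> C" using B(2) by blast
        moreover have "b' \<in> M" using permutes_in_image[OF p, of b] \<open>b \<in> C\<close> b(2) B(3) by blast
        ultimately show "b' \<in> B" using B(1) eq[of b] b by (auto simp: normal_set_iff)
      qed
      show "B \<subseteq> \<sigma> ` B"
      proof
        fix b assume b: "b \<in> B"
        let ?a = "Hilbert_Choice.inv \<sigma> b"
        have a: "?a \<in> C" "\<sigma> ?a = b"
          using b B(2) p permutes_inverses(1)[OF p] permutes_in_image[OF permutes_inv[OF p]] by auto
        then have "eqtp A [b] [?a]" using eq[of ?a] eqtp_sym by simp
        then have "?a \<in> B" using B b a(1) by (auto simp: normal_set_iff)
        then show "b \<in> \<sigma> ` B" using a(2) by force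
      qed
    qed
  qed
  then have perm: "restrict_id \<sigma> B permutes B"
    by (intro bij_imp_permutes) (auto simp: restrict_id_def cong: bij_betw_cong)
  have map: "map (restrict_id \<sigma> B) x = map \<sigma> x" if "set x \<subseteq> B" for x
    using that by (auto simp: restrict_id_def)
  have "elementary_map L U B (restrict_id \<sigma> B)"
    unfolding elementary_map_def
  proof (intro conjI allI impI ballI)
    show "restrict_id \<sigma> B ` B \<subseteq> univ U" using permutes_image[OF perm] B(2) CU by simp
    fix n \<phi> x assume \<phi>: "wf_form L n \<phi>" and x: "x \<in> tuples B n"
    have "sat U \<phi> x \<longleftrightarrow> sat U \<phi> (map \<sigma> x)"
      using \<sigma> \<phi> tuples_mono[OF B(2) x] by (simp add: aut_def elementary_map_def)
    moreover have "set x \<subseteq> B" using x by (simp add: tuples_def)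
    ultimately show "sat U \<phi> x \<longleftrightarrow> sat U \<phi> (map (restrict_id \<sigma> B) x)"
      by (simp only: map)
  qed
  moreover have "\<forall>a \<in> A. restrict_id \<sigma> B a = a" using \<sigma> by (simp add: aut_def restrict_id_def)
  ultimately show ?thesis using perm by (simp add: aut_def)
qed

lemma map_restrict_id: "set b \<subseteq> B \<Longrightarrow> map (restrict_id \<sigma> B) b = map \<sigma> b"
  by (auto simp: restrict_id_def)

text \<open>The definability clause of cocycles, with the defining tuple and function exposed so
  that they can be reused for a different automorphism group.\<close>

definition represents :: "'m set \<Rightarrow> 'm cochain \<Rightarrow> 'm list \<Rightarrow> ('m list \<Rightarrow> 'm list) \<Rightarrow> bool" where
  "represents B \<phi> b h \<longleftrightarrow> set b \<subseteq> B \<and> (\<exists>n Y. definable_fun L U A (2 * length b) n Y h \<and>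
     (\<forall>\<sigma> \<in> \<Gamma> B. b @ map \<sigma> b \<in> Y \<and> \<phi> \<sigma> = h (b @ map \<sigma> b)))"

text \<open>Since \<open>G(M) = G(A)\<close> is fixed by automorphisms, cocycles are homomorphisms.\<close>

lemma cocycle_iff:
  assumes "A \<subseteq> B" "B \<subseteq> M"
  shows "\<phi> \<in> Z B \<longleftrightarrow> \<phi> \<in> \<Gamma> B \<rightarrow>\<^sub>E GA \<and>
    (\<forall>\<sigma> \<in> \<Gamma> B. \<forall>\<tau> \<in> \<Gamma> B. \<phi> (\<sigma> \<circ> \<tau>) = \<phi> \<sigma> \<otimes> \<phi> \<tau>) \<and> (\<exists>b h. represents B \<phi> b h)"
proof -
  have 1: "(\<forall>\<sigma> \<in> \<Gamma> B. \<forall>\<tau> \<in> \<Gamma> B. \<phi> (\<sigma> \<circ> \<tau>) = \<phi> \<sigma> \<otimes> map \<sigma> (\<phi> \<tau>)) \<longleftrightarrow>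
      (\<forall>\<sigma> \<in> \<Gamma> B. \<forall>\<tau> \<in> \<Gamma> B. \<phi> (\<sigma> \<circ> \<tau>) = \<phi> \<sigma> \<otimes> \<phi> \<tau>)" if "\<phi> \<in> \<Gamma> B \<rightarrow>\<^sub>E GA"
  proof (intro ball_cong refl)
    fix \<sigma> \<tau> assume "\<sigma> \<in> \<Gamma> B" "\<tau> \<in> \<Gamma> B"
    then show "\<phi> (\<sigma> \<circ> \<tau>) = \<phi> \<sigma> \<otimes> map \<sigma> (\<phi> \<tau>) \<longleftrightarrow> \<phi> (\<sigma> \<circ> \<tau>) = \<phi> \<sigma> \<otimes> \<phi> \<tau>"
      using aut_GA[of \<sigma> B "\<phi> \<tau>"] PiE_mem[OF that] by simp
  qed
  have 2: "(\<exists>m n b Y h. b \<in> tuples B m \<and> definable_fun L U A (2 * m) n Y h \<and>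
      (\<forall>\<sigma> \<in> \<Gamma> B. b @ map \<sigma> b \<in> Y \<and> \<phi> \<sigma> = h (b @ map \<sigma> b))) \<longleftrightarrow> (\<exists>b h. represents B \<phi> b h)"
    unfolding represents_def tuples_def by blast
  show ?thesis
    by (cases "\<phi> \<in> \<Gamma> B \<rightarrow>\<^sub>E GA")
      (simp_all only: def_cocycles_def points_eq[OF assms] mem_Collect_eq 1 2 simp_thms)
qed

lemma cohomologous_iff:
  assumes "A \<subseteq> B" "B \<subseteq> M"
  shows "(\<phi>, \<psi>) \<in> coh B \<longleftrightarrow> \<phi> \<in> Z B \<and> \<psi> \<in> Z B \<and>
    (\<exists>g \<in> GA. \<forall>\<sigma> \<in> \<Gamma> B. \<phi> \<sigma> = inv g \<otimes> \<psi> \<sigma> \<otimes> g)"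
  unfolding cohomologous_def points_eq[OF assms] using aut_GA[of _ B] by auto

lemma cocycle_GA: "\<phi> \<in> Z B \<Longrightarrow> A \<subseteq> B \<Longrightarrow> B \<subseteq> M \<Longrightarrow> \<sigma> \<in> \<Gamma> B \<Longrightarrow> \<phi> \<sigma> \<in> GA"
  by (auto simp: cocycle_iff)

lemma equiv_coh:
  assumes B: "A \<subseteq> B" "B \<subseteq> M"
  shows "equiv (Z B) (coh B)"
proof (rule equivI)
  show "coh B \<subseteq> Z B \<times> Z B" by (auto simp: cohomologous_def)
  show "refl_on (Z B) (coh B)"
  proof (rule refl_onI)
    fix \<phi> assume \<phi>: "\<phi> \<in> Z B"
    have eq: "\<phi> \<sigma> = inv \<one> \<otimes> \<phi> \<sigma> \<otimes> \<one>" if "\<sigma> \<in> \<Gamma> B" for \<sigma>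
      using GA_carrier[OF cocycle_GA[OF \<phi> B that]] by simp
    show "(\<phi>, \<phi>) \<in> coh B"
      unfolding cohomologous_iff[OF B] by (intro conjI \<phi> bexI[OF _ GA_one] ballI eq)
  qed
  show "sym (coh B)"
  proof (rule symI)
    fix \<phi> \<psi> assume "(\<phi>, \<psi>) \<in> coh B"
    then obtain g where Z: "\<phi> \<in> Z B" "\<psi> \<in> Z B" and g: "g \<in> GA"
      "\<And>\<sigma>. \<sigma> \<in> \<Gamma> B \<Longrightarrow> \<phi> \<sigma> = inv g \<otimes> \<psi> \<sigma> \<otimes> g" by (auto simp: cohomologous_iff[OF B])
    have "\<psi> \<sigma> = inv (inv g) \<otimes> \<phi> \<sigma> \<otimes> inv g" if "\<sigma> \<in> \<Gamma> B" for \<sigma>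
    proof -
      note c = GA_carrier[OF g(1)] GA_carrier[OF cocycle_GA[OF Z(2) B that]]
      have "g \<otimes> (inv g \<otimes> \<psi> \<sigma>) = \<psi> \<sigma>" using c m_assoc[of g "inv g" "\<psi> \<sigma>"] by simp
      then show ?thesis using g(2)[OF that] c by (simp add: m_assoc)
    qed
    then show "(\<psi>, \<phi>) \<in> coh B" using Z GA_inv[OF g(1)] unfolding cohomologous_iff[OF B] by blast
  qed
  show "trans (coh B)"
  proof (rule transI)
    fix \<phi> \<psi> \<chi> assume "(\<phi>, \<psi>) \<in> coh B" "(\<psi>, \<chi>) \<in> coh B"
    then obtain g h where Z: "\<phi> \<in> Z B" "\<chi> \<in> Z B" and g: "g \<in> GA" "h \<in> GA"
      "\<And>\<sigma>. \<sigma> \<in> \<Gamma> B \<Longrightarrow> \<phi> \<sigma> = inv g \<otimes> \<psi> \<sigma> \<otimes> g" "\<And>\<sigma>. \<sigma> \<in> \<Gamma> B \<Longrightarrow> \<psi> \<sigma> = inv h \<otimes> \<chi> \<sigma> \<otimes> h"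
      by (auto simp: cohomologous_iff[OF B])
    have "\<phi> \<sigma> = inv (h \<otimes> g) \<otimes> \<chi> \<sigma> \<otimes> (h \<otimes> g)" if "\<sigma> \<in> \<Gamma> B" for \<sigma>
      using g(3,4)[OF that] GA_carrier[OF g(1)] GA_carrier[OF g(2)]
        GA_carrier[OF cocycle_GA[OF Z(2) B that]]
      by (simp add: m_assoc inv_mult_group)
    then show "(\<phi>, \<chi>) \<in> coh B" using Z GA_mult[OF g(2,1)] unfolding cohomologous_iff[OF B] by blast
  qed
qed

section \<open>Cohomology classes and inflation\<close>

abbreviation H1 :: "'m set \<Rightarrow> 'm cochain set set" where "H1 \<equiv> H1def L U G A"

lemma H1E:
  assumes "c \<in> H1 B"
  obtains \<phi> where "\<phi> \<in> Z B" "c = coh B `` {\<phi>}"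
  using assms unfolding H1def_def by (rule quotientE)

lemma trivial_cocycle:
  assumes B: "A \<subseteq> B" "B \<subseteq> M"
  shows "(\<lambda>\<sigma> \<in> \<Gamma> B. \<one>) \<in> Z B"
proof -
  have one: "\<one> \<in> tup k" "set \<one> \<subseteq> dcl L U A" "length \<one> = k" using GA_tup[OF GA_one] dcl_A by auto
  have d: "def_pred A k (\<lambda>x. x = \<one>)" using dcl_tupleD[OF A_univ one(2)] one(3) by simp
  \<comment> \<open>The trivial cocycle is represented by the empty tuple, with a constant function
    on the single \<open>0\<close>-tuple; the constant is definable because its coordinates are in
    \<open>A\<close>.\<close>
  have "definable_fun L U A (2 * 0) k {[]} (\<lambda>_. \<one>)"
    unfolding definable_fun_def definable_iff_def_pred
    using one d def_pred_cong[OF def_pred_True, of 0 "\<lambda>x. x = []" A] by (auto simp: tuples_def)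
  then have "represents B (\<lambda>\<sigma> \<in> \<Gamma> B. \<one>) [] (\<lambda>_. \<one>)" unfolding represents_def by fastforce
  moreover have "(\<lambda>\<sigma> \<in> \<Gamma> B. \<one>) \<in> \<Gamma> B \<rightarrow>\<^sub>E GA" using GA_one by simp
  moreover have "\<forall>\<sigma> \<in> \<Gamma> B. \<forall>\<tau> \<in> \<Gamma> B. (\<lambda>\<sigma> \<in> \<Gamma> B. \<one>) (\<sigma> \<circ> \<tau>) = (\<lambda>\<sigma> \<in> \<Gamma> B. \<one>) \<sigma> \<otimes> (\<lambda>\<sigma> \<in> \<Gamma> B. \<one>) \<tau>"
    by (simp add: aut_comp)
  ultimately show ?thesis unfolding cocycle_iff[OF B] by blast
qed

lemma H1_pt_mem: "A \<subseteq> B \<Longrightarrow> B \<subseteq> M \<Longrightarrow> H1_pt L U G A B \<in> H1 B"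
  unfolding H1_pt_def H1def_def by (intro quotientI trivial_cocycle)

abbreviation infl :: "'m set \<Rightarrow> 'm set \<Rightarrow> 'm cochain \<Rightarrow> 'm cochain" where
  "infl \<equiv> inflation L U A"

text \<open>The same tuple and function represent the inflated cochain, because restricting an
  automorphism to \<open>B\<close> does not change the images of tuples from
  \<open>B\<close>.\<close>

lemma inflation_cocycle:
  assumes B: "normal_set L U A M B" "B \<subseteq> C" "C \<subseteq> M" and \<phi>: "\<phi> \<in> Z B"
  shows "infl B C \<phi> \<in> Z C"
proof -
  have AB: "A \<subseteq> B" "B \<subseteq> M" and AC: "A \<subseteq> C" using B by (auto simp: normal_set_iff)
  note r = aut_restrict[OF B]
  have \<phi>': "\<phi> \<in> \<Gamma> B \<rightarrow>\<^sub>E GA" "\<And>\<sigma> \<tau>. \<sigma> \<in> \<Gamma> B \<Longrightarrow> \<tau> \<in> \<Gamma> B \<Longrightarrow> \<phi> (\<sigma> \<circ> \<tau>) = \<phi> \<sigma> \<otimes> \<phi> \<tau>"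
    "\<exists>b h. represents B \<phi> b h" using \<phi> unfolding cocycle_iff[OF AB] by blast+
  have "infl B C \<phi> \<in> \<Gamma> C \<rightarrow>\<^sub>E GA" using \<phi>'(1) r by (auto simp: inflation_def)
  moreover have "infl B C \<phi> (\<sigma> \<circ> \<tau>) = infl B C \<phi> \<sigma> \<otimes> infl B C \<phi> \<tau>"
    if st: "\<sigma> \<in> \<Gamma> C" "\<tau> \<in> \<Gamma> C" for \<sigma> \<tau>
  proof -
    have "restrict_id \<tau> B permutes B" using r[OF st(2)] by (simp add: aut_def)
    then have "x \<in> B \<Longrightarrow> \<tau> x \<in> B" for x using permutes_in_image[of "restrict_id \<tau> B" B x]
      by (simp add: restrict_id_def)
    then have "restrict_id (\<sigma> \<circ> \<tau>) B = restrict_id \<sigma> B \<circ> restrict_id \<tau> B"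
      by (auto simp: restrict_id_def)
    then show ?thesis
      using st aut_comp[OF st] \<phi>'(2)[OF r[OF st(1)] r[OF st(2)]] by (simp add: inflation_def)
  qed
  moreover have "\<exists>b h. represents C (infl B C \<phi>) b h"
  proof -
    obtain b h n Y where b: "set b \<subseteq> B" "definable_fun L U A (2 * length b) n Y h"
      "\<And>\<sigma>. \<sigma> \<in> \<Gamma> B \<Longrightarrow> b @ map \<sigma> b \<in> Y \<and> \<phi> \<sigma> = h (b @ map \<sigma> b)"
      using \<phi>'(3) unfolding represents_def by blast
    have "b @ map \<sigma> b \<in> Y \<and> infl B C \<phi> \<sigma> = h (b @ map \<sigma> b)" if "\<sigma> \<in> \<Gamma> C" for \<sigma>
      using b(3)[OF r[OF that]] map_restrict_id[OF b(1)] that by (simp add: inflation_def)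
    then have "represents C (infl B C \<phi>) b h" using b(1,2) B(2) unfolding represents_def by blast
    then show ?thesis by blast
  qed
  ultimately show ?thesis unfolding cocycle_iff[OF AC B(3)] by blast
qed

lemma inflation_coh:
  assumes B: "normal_set L U A M B" "B \<subseteq> C" "C \<subseteq> M" and "(\<phi>, \<psi>) \<in> coh B"
  shows "(infl B C \<phi>, infl B C \<psi>) \<in> coh C"
proof -
  have AB: "A \<subseteq> B" "B \<subseteq> M" and AC: "A \<subseteq> C" using B by (auto simp: normal_set_iff)
  obtain g where Z: "\<phi> \<in> Z B" "\<psi> \<in> Z B" and g: "g \<in> GA"
      "\<And>\<sigma>. \<sigma> \<in> \<Gamma> B \<Longrightarrow> \<phi> \<sigma> = inv g \<otimes> \<psi> \<sigma> \<otimes> g" using assms(4) by (auto simp: cohomologous_iff[OF AB])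
  have "infl B C \<phi> \<sigma> = inv g \<otimes> infl B C \<psi> \<sigma> \<otimes> g" if "\<sigma> \<in> \<Gamma> C" for \<sigma>
    using g(2)[OF aut_restrict[OF B that]] that by (simp add: inflation_def)
  then show ?thesis
    using inflation_cocycle[OF B] Z g(1) unfolding cohomologous_iff[OF AC B(3)] by blast
qed

text \<open>\<open>H1_trans\<close> is a union over all members of a class; their inflations are
  cohomologous, so the union collapses to one class and can be computed from a
  representative.\<close>

lemma H1_trans_class:
  assumes B: "normal_set L U A M B" "B \<subseteq> C" "C \<subseteq> M" and \<phi>: "\<phi> \<in> Z B"
  shows "H1_trans L U G A B C (coh B `` {\<phi>}) = coh C `` {infl B C \<phi>}"
proof -
  have AB: "A \<subseteq> B" "B \<subseteq> M" and AC: "A \<subseteq> C" using B by (auto simp: normal_set_iff)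
  note eqC = equiv_coh[OF AC B(3)]
  have "coh C `` {infl B C \<psi>} = coh C `` {infl B C \<phi>}" if "(\<phi>, \<psi>) \<in> coh B" for \<psi>
    using equiv_class_eq[OF eqC inflation_coh[OF B that]] by simp
  moreover have "(\<phi>, \<phi>) \<in> coh B" using equiv_coh[OF AB] \<phi> by (simp add: equiv_def refl_on_def)
  moreover have "H1_trans L U G A B C (coh B `` {\<phi>}) =
      (\<Union>\<psi> \<in> coh B `` {\<phi>}. coh C `` {infl B C \<psi>})" by (auto simp: H1_trans_def)
  ultimately show ?thesis by blast
qed

lemma inflation_trans:
  assumes "normal_set L U A M C" "B \<subseteq> C" "C \<subseteq> D" "D \<subseteq> M"
  shows "infl C D (infl B C \<phi>) = infl B D \<phi>"
proof
  fix \<sigma>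
  have "restrict_id (restrict_id \<sigma> C) B = restrict_id \<sigma> B"
    by (rule ext) (use assms(2) in \<open>auto simp: restrict_id_def\<close>)
  then show "infl C D (infl B C \<phi>) \<sigma> = infl B D \<phi> \<sigma>"
    using aut_restrict[OF assms(1,3,4)] by (simp add: inflation_def)
qed

lemma inflation_trivial:
  assumes "normal_set L U A M B" "B \<subseteq> C" "C \<subseteq> M"
  shows "infl B C (\<lambda>\<sigma> \<in> \<Gamma> B. \<one>) = (\<lambda>\<sigma> \<in> \<Gamma> C. \<one>)"
  using aut_restrict[OF assms] by (auto simp: inflation_def)

text \<open>Every \<open>\<tau>\<close> in \<open>Aut(B/A)\<close> agrees with the restriction of an automorphism of \<open>N\<close> on the finite
  tuples that define the cocycles involved.\<close>

lemma inflation_N_coh: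
  assumes B: "normal_set L U A M B" "B \<subseteq> N" and Z: "\<phi> \<in> Z B" "\<psi> \<in> Z B"
    and coh: "(infl B N \<phi>, infl B N \<psi>) \<in> coh N"
  shows "(\<phi>, \<psi>) \<in> coh B"
proof -
  have AB: "A \<subseteq> B" "B \<subseteq> M" using B by (auto simp: normal_set_iff)
  obtain g where g: "g \<in> GA" "\<And>\<sigma>. \<sigma> \<in> \<Gamma> N \<Longrightarrow> infl B N \<phi> \<sigma> = inv g \<otimes> infl B N \<psi> \<sigma> \<otimes> g"
    using coh by (auto simp: cohomologous_iff[OF N_bounds])
  obtain b h where b: "represents B \<phi> b h" using Z(1) by (auto simp: cocycle_iff[OF AB])
  obtain b' h' where b': "represents B \<psi> b' h'" using Z(2) by (auto simp: cocycle_iff[OF AB])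
  have bB: "set b \<subseteq> B" "set b' \<subseteq> B" using b b' by (auto simp: represents_def)
  have "\<phi> \<tau> = inv g \<otimes> \<psi> \<tau> \<otimes> g" if \<tau>: "\<tau> \<in> \<Gamma> B" for \<tau>
  proof -
    obtain \<sigma> where \<sigma>: "\<sigma> \<in> \<Gamma> N" "map \<sigma> (b @ b') = map \<tau> (b @ b')"
      using aut_extend_finite[OF \<tau> AB(1) B(2), of "b @ b'"] bB by auto
    let ?\<rho> = "restrict_id \<sigma> B"
    have \<rho>: "?\<rho> \<in> \<Gamma> B" by (rule aut_restrict[OF B N_bounds(2) \<sigma>(1)])
    have "map ?\<rho> b = map \<tau> b" "map ?\<rho> b' = map \<tau> b'"
      using \<sigma>(2) unfolding map_restrict_id[OF bB(1)] map_restrict_id[OF bB(2)] by simp_all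
    then have "\<phi> \<tau> = \<phi> ?\<rho>" "\<psi> \<tau> = \<psi> ?\<rho>"
      using b b' \<tau> \<rho> unfolding represents_def by metis+
    then show ?thesis using g(2)[OF \<sigma>(1)] \<sigma>(1) by (simp add: inflation_def)
  qed
  then show ?thesis using Z g(1) unfolding cohomologous_iff[OF AB] by blast
qed

text \<open>The defining tuple \<open>b\<close> lies in some \<open>B\<close> of the family, and the
  same function defines a cochain there. Its properties are inherited from \<open>\<phi>\<close> by
  replacing each automorphism of \<open>B\<close> with one of \<open>N\<close> that agrees with it
  on the finitely many elements in question.\<close>

lemma cocycle_N_from_family:
  assumes \<phi>: "\<phi> \<in> Z N"
  obtains B \<psi> where "B \<in> \<G>" "\<psi> \<in> Z B" "infl B N \<psi> = \<phi>"
proof -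
  have \<phi>': "\<phi> \<in> \<Gamma> N \<rightarrow>\<^sub>E GA" "\<And>\<sigma> \<tau>. \<sigma> \<in> \<Gamma> N \<Longrightarrow> \<tau> \<in> \<Gamma> N \<Longrightarrow> \<phi> (\<sigma> \<circ> \<tau>) = \<phi> \<sigma> \<otimes> \<phi> \<tau>"
    "\<exists>b h. represents N \<phi> b h" using \<phi> unfolding cocycle_iff[OF N_bounds] by blast+
  obtain b h n Y where b: "set b \<subseteq> N" "definable_fun L U A (2 * length b) n Y h"
      "\<And>\<sigma>. \<sigma> \<in> \<Gamma> N \<Longrightarrow> b @ map \<sigma> b \<in> Y \<and> \<phi> \<sigma> = h (b @ map \<sigma> b)"
    using \<phi>'(3) unfolding represents_def by blast
  obtain B where B: "B \<in> \<G>" "set b \<subseteq> B" using galois_family_covers_N[OF b(1)] by blast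
  note Bb = galois_family_bounds[OF B(1)]
  have BM: "B \<subseteq> M" using Bb(2) N_bounds by blast
  define \<psi> where "\<psi> = (\<lambda>\<tau> \<in> \<Gamma> B. h (b @ map \<tau> b))"
  have \<psi>: "\<psi> \<tau> = \<phi> \<sigma>" if "\<tau> \<in> \<Gamma> B" "\<sigma> \<in> \<Gamma> N" "map \<sigma> b = map \<tau> b" for \<sigma> \<tau>
    using b(3)[OF that(2)] that by (simp add: \<psi>_def)
  have ext: "\<exists>\<sigma> \<in> \<Gamma> N. map \<sigma> x = map \<tau> x" if "\<tau> \<in> \<Gamma> B" "set x \<subseteq> B" for x \<tau>
    using aut_extend_finite[OF that(1) Bb(1,2) that(2)] by blast
  have "\<psi> \<in> Z B"
    unfolding cocycle_iff[OF Bb(1) BM]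
  proof (intro conjI ballI)
    have "\<psi> \<tau> \<in> GA" if \<tau>: "\<tau> \<in> \<Gamma> B" for \<tau>
    proof -
      obtain \<sigma> where "\<sigma> \<in> \<Gamma> N" "map \<sigma> b = map \<tau> b" using ext[OF \<tau> B(2)] by blast
      then show ?thesis using \<psi>[OF \<tau>] \<phi>'(1) by auto
    qed
    then show "\<psi> \<in> \<Gamma> B \<rightarrow>\<^sub>E GA" by (auto simp: \<psi>_def)
    fix \<tau> \<tau>' assume \<tau>: "\<tau> \<in> \<Gamma> B" and \<tau>': "\<tau>' \<in> \<Gamma> B"
    obtain \<sigma>' where \<sigma>': "\<sigma>' \<in> \<Gamma> N" "map \<sigma>' b = map \<tau>' b" using ext[OF \<tau>' B(2)] by blast
    have "\<tau>' permutes B" using \<tau>' by (simp add: aut_def)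
    \<comment> \<open>\<open>\<sigma>\<close> has to agree with \<open>\<tau>\<close> on
      \<open>map \<tau>' b\<close> too, since \<open>\<tau> \<circ> \<tau>'\<close> sends
      \<open>b\<close> through it.\<close>
    then have "set (b @ map \<tau>' b) \<subseteq> B" using B(2) by (auto simp: permutes_in_image)
    from ext[OF \<tau> this] obtain \<sigma> where "\<sigma> \<in> \<Gamma> N" "map \<sigma> (b @ map \<tau>' b) = map \<tau> (b @ map \<tau>' b)" by blast
    then have \<sigma>: "\<sigma> \<in> \<Gamma> N" "map \<sigma> b = map \<tau> b" "map \<sigma> (map \<tau>' b) = map \<tau> (map \<tau>' b)"
      by simp_all
    have "map (\<sigma> \<circ> \<sigma>') b = map \<sigma> (map \<sigma>' b)" by simp
    also have "\<dots> = map (\<tau> \<circ> \<tau>') b" using \<sigma>(3) \<sigma>'(2) by simp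
    finally have "\<psi> (\<tau> \<circ> \<tau>') = \<phi> (\<sigma> \<circ> \<sigma>')" using \<tau> \<tau>' \<sigma> \<sigma>' by (intro \<psi> aut_comp)
    then show "\<psi> (\<tau> \<circ> \<tau>') = \<psi> \<tau> \<otimes> \<psi> \<tau>'"
      using \<phi>'(2)[OF \<sigma>(1) \<sigma>'(1)] \<psi>[OF \<tau> \<sigma>(1,2)] \<psi>[OF \<tau>' \<sigma>'] by simp
  next
    have "b @ map \<tau> b \<in> Y" if \<tau>: "\<tau> \<in> \<Gamma> B" for \<tau>
      using ext[OF \<tau> B(2)] b(3) by metis
    then have "represents B \<psi> b h" using b(2) B(2) unfolding represents_def \<psi>_def by auto
    then show "\<exists>b h. represents B \<psi> b h" by blast
  qed
  moreover have "infl B N \<psi> = \<phi>"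
  proof
    fix \<sigma>
    show "infl B N \<psi> \<sigma> = \<phi> \<sigma>"
    proof (cases "\<sigma> \<in> \<Gamma> N")
      case True
      then show ?thesis
        using \<psi>[OF aut_restrict[OF Bb(3,2) N_bounds(2) True] True] map_restrict_id[OF B(2)]
        by (simp add: inflation_def)
    next
      case False
      then show ?thesis using \<phi>'(1) by (auto simp: inflation_def PiE_def extensional_def)
    qed
  qed
  ultimately show ?thesis using that B(1) by blast
qed

lemma dirlim_H1_pointed_iso:
  "pointed_iso (dirlim \<G> H1 (H1_trans L U G A), dirlim_pt \<G> H1 (H1_trans L U G A) (H1_pt L U G A))
    (H1 N, H1_pt L U G A N)"
proof (rule dirlim_pointed_iso[where F = "\<lambda>B. H1_trans L U G A B N"])
  show "directed_family \<G>" by (rule galois_family_directed)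
  have mem: "coh C `` {\<phi>} \<in> H1 C" if "\<phi> \<in> Z C" for C \<phi>
    unfolding H1def_def using that by (rule quotientI)
  have BM: "B \<subseteq> M" if "B \<in> \<G>" for B using galois_family_bounds(2)[OF that] N_bounds by blast
  note bounds = galois_family_bounds
  show "H1_trans L U G A B N c \<in> H1 N" if B: "B \<in> \<G>" and c: "c \<in> H1 B" for B c
    using c
  proof (rule H1E)
    fix \<phi> assume \<phi>: "\<phi> \<in> Z B" "c = coh B `` {\<phi>}"
    show ?thesis
      using H1_trans_class[OF bounds(3,2)[OF B] N_bounds(2) \<phi>(1)] \<phi>(2)
        mem inflation_cocycle[OF bounds(3,2)[OF B] N_bounds(2) \<phi>(1)] by simp
  qed
  show "H1_trans L U G A B C c \<in> H1 C \<and>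
      H1_trans L U G A C N (H1_trans L U G A B C c) = H1_trans L U G A B N c"
    if B: "B \<in> \<G>" and C: "C \<in> \<G>" "B \<subseteq> C" and c: "c \<in> H1 B" for B C c
    using c
  proof (rule H1E)
    fix \<phi> assume \<phi>: "\<phi> \<in> Z B" "c = coh B `` {\<phi>}"
    have Z: "infl B C \<phi> \<in> Z C" by (rule inflation_cocycle[OF bounds(3)[OF B] C(2) BM[OF C(1)] \<phi>(1)])
    show ?thesis
      using H1_trans_class[OF bounds(3)[OF B] C(2) BM[OF C(1)] \<phi>(1)] \<phi>(2) mem[OF Z]
        H1_trans_class[OF bounds(3,2)[OF C(1)] N_bounds(2) Z]
        H1_trans_class[OF bounds(3,2)[OF B] N_bounds(2) \<phi>(1)]
        inflation_trans[OF bounds(3)[OF C(1)] C(2) bounds(2)[OF C(1)] N_bounds(2)] by simp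
  qed
  show "inj_on (H1_trans L U G A B N) (H1 B)" if B: "B \<in> \<G>" for B
  proof (rule inj_onI)
    fix c c' assume c: "c \<in> H1 B" "c' \<in> H1 B" "H1_trans L U G A B N c = H1_trans L U G A B N c'"
    obtain \<phi> where \<phi>: "\<phi> \<in> Z B" "c = coh B `` {\<phi>}" using c(1) by (rule H1E)
    obtain \<psi> where \<psi>: "\<psi> \<in> Z B" "c' = coh B `` {\<psi>}" using c(2) by (rule H1E)
    note Bn = bounds(3,2)[OF B] N_bounds(2)
    have "coh N `` {infl B N \<phi>} = coh N `` {infl B N \<psi>}"
      using c(3) H1_trans_class[OF Bn] \<phi> \<psi> by simp
    then have "(infl B N \<phi>, infl B N \<psi>) \<in> coh N"
      using eq_equiv_class[OF _ equiv_coh[OF N_bounds]] inflation_cocycle[OF Bn \<psi>(1)] by blast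
    then have "(\<phi>, \<psi>) \<in> coh B" by (rule inflation_N_coh[OF bounds(3,2)[OF B] \<phi>(1) \<psi>(1)])
    then show "c = c'"
      using equiv_class_eq[OF equiv_coh[OF bounds(1)[OF B] BM[OF B]]] \<phi>(2) \<psi>(2) by simp
  qed
  show "\<exists>B \<in> \<G>. \<exists>x \<in> H1 B. H1_trans L U G A B N x = c" if c: "c \<in> H1 N" for c
    using c
  proof (rule H1E)
    fix \<phi> assume \<phi>: "\<phi> \<in> Z N" "c = coh N `` {\<phi>}"
    obtain B \<psi> where B: "B \<in> \<G>" "\<psi> \<in> Z B" "infl B N \<psi> = \<phi>"
      using \<phi>(1) by (rule cocycle_N_from_family)
    then show ?thesis
      using mem[OF B(2)] H1_trans_class[OF bounds(3,2)[OF B(1)] N_bounds(2) B(2)] \<phi>(2) by metis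
  qed
  show "H1_pt L U G A B \<in> H1 B \<and> H1_trans L U G A B N (H1_pt L U G A B) = H1_pt L U G A N"
    if B: "B \<in> \<G>" for B
    using H1_pt_mem[OF bounds(1)[OF B] BM[OF B]]
      H1_trans_class[OF bounds(3,2)[OF B] N_bounds(2) trivial_cocycle[OF bounds(1)[OF B] BM[OF B]]]
      inflation_trivial[OF bounds(3,2)[OF B] N_bounds(2)] by (simp add: H1_pt_def)
qed

end

theorem theorem1p13:
  fixes L :: "('f, 'r) language" and T :: "('f, 'r) form set" and U :: "('m, 'f, 'r) interp"
    and \<kappa> :: "'k rel" and A M :: "'m set" and X :: "'m list set" and G :: "'m list monoid"
    and d k :: nat
  assumes "complete_theory L T"
    and "monster L T \<kappa> U"
    and "totally_transcendental L U"
    and "eliminates_imaginaries L U"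
    and "A \<subseteq> univ U" and "small \<kappa> A" and "dcl L U A = A"
    and "prime_model_over L U A M"
    and "definable L U A d X" and "points X M = points X A"
    and "definable_group L U A k G" and "lives_on L U A X G"
  shows "directed_family (galois_family L U X M A) \<and>
    pointed_iso
      (dirlim (galois_family L U X M A) (H1def L U G A) (H1_trans L U G A),
       dirlim_pt (galois_family L U X M A) (H1def L U G A) (H1_trans L U G A) (H1_pt L U G A))
      (H1def L U G A (XDG_inf L U X M A), H1_pt L U G A (XDG_inf L U X M A))"
proof -
  have struct: "is_struct L U" using assms(2) by (simp add: monster_def is_model_def)
  interpret fo_struct L U by standard (rule struct)
  have M: "elementary_submodel L U M" "A \<subseteq> M" using assms(8) by (auto simp: prime_model_over_def)
  have MU: "M \<subseteq> univ U" using M(1) by (rule elementary_submodel_subset)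
  have X: "X \<subseteq> tup d" "def_pred A d (\<lambda>x. x \<in> X)" using assms(9) by (simp_all add: definable_iff_def_pred)
  have coords_iff: "a \<in> coords X \<longleftrightarrow> (\<exists>y \<in> X. \<exists>i < d. y ! i = a)" for a
    using X(1) by (fastforce simp: coords_def tuples_def in_set_conv_nth)
  have small_M: "small \<kappa> M" using assms(2,6,8) by (rule prime_model_small)
  interpret prime_setting L U A M X
  proof
    show "totally_transcendental L U" "elementary_submodel L U M" "A \<subseteq> M" "dcl L U A = A"
      using assms(3,7) M by simp_all
    show "atomic A M" using assms(3,8) by (rule prime_model_atomic)
    show "coords X \<subseteq> univ U" using X(1) by (auto simp: coords_def tuples_def)
    have "def_pred A (Suc 0) (\<lambda>x. \<exists>y \<in> tup d. y \<in> X \<and> (\<exists>i \<in> {..<d}. [y ! i] = x))"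
    proof (intro def_pred_ex[OF assms(5)] def_pred_conj def_pred_finite_ex)
      show "def_pred A (d + Suc 0) (\<lambda>z. take d z \<in> X)"
        by (rule def_pred_sel[OF X(2) sel_prefix assms(5)]) simp
      fix i assume "i \<in> {..<d}"
      then show "def_pred A (d + Suc 0) (\<lambda>z. [take d z ! i] = drop d z)"
        using sel_suffix[of A "d + Suc 0" d]
        by (intro def_pred_sel_eq[OF sel_nth[OF sel_prefix] _ assms(5)]) auto
    qed simp
    then show "def_pred A (Suc 0) (\<lambda>x. x ! 0 \<in> coords X)"
      by (rule def_pred_cong) (use X(1) in \<open>auto simp: coords_iff tuples_def length_Suc_conv; blast\<close>)
    \<comment> \<open>A point of \<open>X\<close> with a coordinate \<open>a\<close> in
      \<open>M\<close> need not lie in \<open>M\<close> itself; it is replaced by a point of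
      \<open>X(M) = X(A)\<close> with the same coordinate.\<close>
    show "coords X \<inter> M \<subseteq> A"
    proof
      fix a assume a: "a \<in> coords X \<inter> M"
      then obtain y i where y: "y \<in> X" "i < d" "y ! i = a" by (auto simp: coords_iff)
      have "def_pred M d (\<lambda>y. y \<in> X \<and> [y ! i] = [a])"
        using a y(2) by (intro def_pred_conj def_pred_mono[OF X(2) M(2)]
            def_pred_sel_eq[OF sel_nth[OF sel_id] sel_const MU]) auto
      from elementary_witness[OF M(1) this, of y] X(1) y
      obtain y' where y': "y' \<in> tuples M d" "y' \<in> X" "y' ! i = a" by auto
      then have "y' \<in> points X M" by (auto simp: points_def tuples_def)
      then have "set y' \<subseteq> A" using assms(10) by (auto simp: points_def)
      then show "a \<in> A" using y' y(2) by (auto simp: tuples_def)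
    qed
    \<comment> \<open>\<open>M\<close> is small, so saturation of the monster model gives
      compactness over all its subsets.\<close>
    show "\<exists>x \<in> tup n. \<forall>P \<in> \<F>. P x"
      if "D \<subseteq> M" "\<F> \<noteq> {}" "\<And>P. P \<in> \<F> \<Longrightarrow> def_pred D n P"
        "\<And>P Q. P \<in> \<F> \<Longrightarrow> Q \<in> \<F> \<Longrightarrow> \<exists>R \<in> \<F>. \<forall>x \<in> tup n. R x \<longrightarrow> P x \<and> Q x"
        "\<And>P. P \<in> \<F> \<Longrightarrow> \<exists>x \<in> tup n. P x" for D n \<F>
      by (rule compactness[OF assms(2) subset_trans[OF that(1) MU] small_mono[OF small_M that(1)]
          that(2-5)])
  qed
  interpret cohomology_setting L U A M X G k by standard (rule assms(11,12))+
  show ?thesis using galois_family_directed dirlim_H1_pointed_iso by simp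
qed

end
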